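(* Let $M$ be a finite orthogroup, $k$ a splitting field for $M$ whose characteristic divides the order of no maximal subgroup of $M$. Let $X,Y\in\Lambda(M)$, $U\in\mathrm{Irr}(G_X)$, $V\in\mathrm{Irr}(G_Y)$, with $e_X,e_Y$ the identities of $G_X,G_Y$. Then: (1) If $X,Y$ are incomparable or $X=Y$, there are no arrows from $U$ to $V$ in $Q(kM)$. (2) If $X<Y$, assume (as may be arranged) $e_X<e_Y$. Let $\equiv$ be the smallest equivalence relation on $e_YL_{e_X}$ such that (a) $e_Ymx\equiv e_Yme_Yx$ for $x\in L_{e_X}$ and $\sigma(m)\ge X$; (b) $x\equiv x'$ whenever $x,x'\in e_YL_{e_X}$, $e_Xx=e_Xx'$, and there is $e\in E(e_YMe_Y)$ with $X<\sigma(e)$, $e\ne e_Y$, $ex=x$, $ex'=x'$. Writing $[x]$ for the $\equiv$-class, let $V_{X,Y}$ be the subspace of $k[e_YL_{e_X}/{\equiv}]$ with basis the differences $[x]-[e_Xx]$, $x\in e_YL_{e_X}\setminus G_X$; it is a $G_Y\times G_X$-module via $(g,h)([x]-[e_Xx])=[gxh^{-1}]-[ge_Xxh^{-1}]$. The number of arrows from $U$ to $V$ is the multiplicity of $V\otimes_kU^*$ as an irreducible constituent of $V_{X,Y}$. (3) If $Y<X$, the number of arrows from $U$ to $V$ in $Q(kM)$ coincides with the number of arrows from $V$ to $U$ in $Q(kM^{op})$ (which can be computed by case (2) applied to $M^{op}$).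
   Context: $M$ finite monoid, $E(M)$ its idempotents, $m^\omega$ the idempotent power of $m$. $M$ is rectangular if each set $\{f\in E(M):MfM=MeM\}$ is closed under multiplication; an orthogroup is a rectangular monoid which is (von Neumann) regular, i.e. $m\in mMm$ for all $m$. $\Lambda(M)$: ideals $MeM$, $e\in E(M)$, ordered by inclusion; $\sigma(m)=Mm^\omega M$. For $X\in\Lambda(M)$, $e_X$ is a fixed idempotent with $Me_XM=X$ and $G_X$ the group of units of $e_XMe_X$; a $kG_X$-module is a $kM$-module via $m\mapsto e_Xme_X$ if $\sigma(m)\supseteq X$, $m\mapsto 0$ otherwise; these give the vertices of $Q(kM)$ (quiver: $\dim\mathrm{Ext}^1(S,T)$ arrows from $S$ to $T$). $L_m=\{n\in M: Mn=Mm\}$. $e<f$ for idempotents means $ef=e=fe$, $e\neq f$. $U^*$ is the contragredient. $M^{op}$ is the opposite monoid; its maximal subgroups are the $G_X^{op}$, and a $G_X$-module is regarded as a $G_X^{op}$-module via $g\mapsto g^{-1}$. $k$ splits $M$ if $kM/\mathrm{rad}(kM)$ is a product of matrix algebras over $k$. *)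

theory Defs
  imports "Jordan_Normal_Form.Matrix" "HOL-Library.Function_Algebras"
begin

definition is_monoid :: "'a set \<Rightarrow> ('a \<Rightarrow> 'a \<Rightarrow> 'a) \<Rightarrow> 'a \<Rightarrow> bool" where
  "is_monoid M mul uu \<longleftrightarrow> uu \<in> M \<and> (\<forall>x\<in>M. \<forall>y\<in>M. mul x y \<in> M)
     \<and> (\<forall>x\<in>M. \<forall>y\<in>M. \<forall>z\<in>M. mul (mul x y) z = mul x (mul y z))
     \<and> (\<forall>x\<in>M. mul uu x = x \<and> mul x uu = x)"

definition opmul :: "('a \<Rightarrow> 'a \<Rightarrow> 'a) \<Rightarrow> 'a \<Rightarrow> 'a \<Rightarrow> 'a" where
  "opmul mul = (\<lambda>x y. mul y x)"

definition idem :: "'a set \<Rightarrow> ('a \<Rightarrow> 'a \<Rightarrow> 'a) \<Rightarrow> 'a \<Rightarrow> bool" where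
  "idem M mul e \<longleftrightarrow> e \<in> M \<and> mul e e = e"

definition idem_less :: "('a \<Rightarrow> 'a \<Rightarrow> 'a) \<Rightarrow> 'a \<Rightarrow> 'a \<Rightarrow> bool" where
  "idem_less mul e f \<longleftrightarrow> mul e f = e \<and> mul f e = e \<and> e \<noteq> f"

definition ideal2 :: "'a set \<Rightarrow> ('a \<Rightarrow> 'a \<Rightarrow> 'a) \<Rightarrow> 'a \<Rightarrow> 'a set" where
  "ideal2 M mul m = {mul (mul a m) b | a b. a \<in> M \<and> b \<in> M}"

definition leftideal :: "'a set \<Rightarrow> ('a \<Rightarrow> 'a \<Rightarrow> 'a) \<Rightarrow> 'a \<Rightarrow> 'a set" where
  "leftideal M mul m = {mul a m | a. a \<in> M}"

definition Lcl :: "'a set \<Rightarrow> ('a \<Rightarrow> 'a \<Rightarrow> 'a) \<Rightarrow> 'a \<Rightarrow> 'a set" where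
  "Lcl M mul m = {n \<in> M. leftideal M mul n = leftideal M mul m}"

definition mpow :: "('a \<Rightarrow> 'a \<Rightarrow> 'a) \<Rightarrow> 'a \<Rightarrow> 'a \<Rightarrow> nat \<Rightarrow> 'a" where
  "mpow mul uu m n = (mul m ^^ n) uu"

definition omega :: "'a set \<Rightarrow> ('a \<Rightarrow> 'a \<Rightarrow> 'a) \<Rightarrow> 'a \<Rightarrow> 'a \<Rightarrow> 'a" where
  "omega M mul uu m = (THE e. idem M mul e \<and> (\<exists>n\<ge>1. e = mpow mul uu m n))"

definition sigma :: "'a set \<Rightarrow> ('a \<Rightarrow> 'a \<Rightarrow> 'a) \<Rightarrow> 'a \<Rightarrow> 'a \<Rightarrow> 'a set" where
  "sigma M mul uu m = ideal2 M mul (omega M mul uu m)"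

definition rectangular :: "'a set \<Rightarrow> ('a \<Rightarrow> 'a \<Rightarrow> 'a) \<Rightarrow> bool" where
  "rectangular M mul \<longleftrightarrow> (\<forall>e f g. idem M mul e \<and> idem M mul f \<and> idem M mul g
      \<and> ideal2 M mul f = ideal2 M mul e \<and> ideal2 M mul g = ideal2 M mul e
      \<longrightarrow> idem M mul (mul f g) \<and> ideal2 M mul (mul f g) = ideal2 M mul e)"

definition regular :: "'a set \<Rightarrow> ('a \<Rightarrow> 'a \<Rightarrow> 'a) \<Rightarrow> bool" where
  "regular M mul \<longleftrightarrow> (\<forall>m\<in>M. \<exists>n\<in>M. mul (mul m n) m = m)"

definition orthogroup :: "'a set \<Rightarrow> ('a \<Rightarrow> 'a \<Rightarrow> 'a) \<Rightarrow> 'a \<Rightarrow> bool" where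
  "orthogroup M mul uu \<longleftrightarrow> is_monoid M mul uu \<and> rectangular M mul \<and> regular M mul"

definition corner :: "'a set \<Rightarrow> ('a \<Rightarrow> 'a \<Rightarrow> 'a) \<Rightarrow> 'a \<Rightarrow> 'a set" where
  "corner M mul e = {mul (mul e m) e | m. m \<in> M}"

definition Gp :: "'a set \<Rightarrow> ('a \<Rightarrow> 'a \<Rightarrow> 'a) \<Rightarrow> 'a \<Rightarrow> 'a set" where
  "Gp M mul e = {g \<in> corner M mul e. \<exists>h \<in> corner M mul e. mul g h = e \<and> mul h g = e}"

definition ginv :: "'a set \<Rightarrow> ('a \<Rightarrow> 'a \<Rightarrow> 'a) \<Rightarrow> 'a \<Rightarrow> 'a \<Rightarrow> 'a" where
  "ginv M mul e g = (THE h. h \<in> corner M mul e \<and> mul g h = e \<and> mul h g = e)"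

definition mrep :: "'a set \<Rightarrow> ('a \<Rightarrow> 'a \<Rightarrow> 'a) \<Rightarrow> 'a \<Rightarrow> nat \<Rightarrow> ('a \<Rightarrow> 'k::field mat) \<Rightarrow> bool" where
  "mrep G mul uu n \<rho> \<longleftrightarrow> (\<forall>g\<in>G. \<rho> g \<in> carrier_mat n n) \<and> \<rho> uu = 1\<^sub>m n
     \<and> (\<forall>g\<in>G. \<forall>h\<in>G. \<rho> (mul g h) = \<rho> g * \<rho> h)"

definition inv_subspace :: "'a set \<Rightarrow> nat \<Rightarrow> ('a \<Rightarrow> 'k::field mat) \<Rightarrow> 'k vec set \<Rightarrow> bool" where
  "inv_subspace G n \<rho> W \<longleftrightarrow> W \<subseteq> carrier_vec n \<and> 0\<^sub>v n \<in> W
     \<and> (\<forall>v\<in>W. \<forall>w\<in>W. v + w \<in> W) \<and> (\<forall>c. \<forall>v\<in>W. c \<cdot>\<^sub>v v \<in> W)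
     \<and> (\<forall>g\<in>G. \<forall>v\<in>W. \<rho> g *\<^sub>v v \<in> W)"

definition irrep :: "'a set \<Rightarrow> ('a \<Rightarrow> 'a \<Rightarrow> 'a) \<Rightarrow> 'a \<Rightarrow> nat \<Rightarrow> ('a \<Rightarrow> 'k::field mat) \<Rightarrow> bool" where
  "irrep G mul e n \<rho> \<longleftrightarrow> mrep G mul e n \<rho> \<and> n > 0
     \<and> (\<forall>W. inv_subspace G n \<rho> W \<longrightarrow> W = {0\<^sub>v n} \<or> W = carrier_vec n)"

definition inflate :: "'a set \<Rightarrow> ('a \<Rightarrow> 'a \<Rightarrow> 'a) \<Rightarrow> 'a \<Rightarrow> 'a \<Rightarrow> nat \<Rightarrow> ('a \<Rightarrow> 'k::field mat) \<Rightarrow> 'a \<Rightarrow> 'k mat" where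
  "inflate M mul uu e n \<rho> = (\<lambda>m. if ideal2 M mul e \<subseteq> sigma M mul uu m
      then \<rho> (mul (mul e m) e) else 0\<^sub>m n n)"

definition tomat :: "nat \<Rightarrow> nat \<Rightarrow> (nat \<Rightarrow> nat \<Rightarrow> 'k) \<Rightarrow> 'k mat" where
  "tomat t s f = mat t s (\<lambda>(i,j). f i j)"

definition fscale :: "'k::field \<Rightarrow> ('a \<Rightarrow> nat \<Rightarrow> nat \<Rightarrow> 'k) \<Rightarrow> ('a \<Rightarrow> nat \<Rightarrow> nat \<Rightarrow> 'k)" where
  "fscale c Z = (\<lambda>x i j. c * Z x i j)"

text \<open>Z encodes an extension 0 \<rightarrow> T \<rightarrow> E \<rightarrow> S \<rightarrow> 0 with E(m) = [[T(m), Z(m)], [0, S(m)]]\<close>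
definition cocycles :: "'a set \<Rightarrow> ('a \<Rightarrow> 'a \<Rightarrow> 'a) \<Rightarrow> nat \<Rightarrow> ('a \<Rightarrow> 'k::field mat) \<Rightarrow> nat \<Rightarrow> ('a \<Rightarrow> 'k mat)
    \<Rightarrow> ('a \<Rightarrow> nat \<Rightarrow> nat \<Rightarrow> 'k) set" where
  "cocycles M mul s \<rho>S t \<rho>T = {Z. (\<forall>x. x \<notin> M \<longrightarrow> Z x = (\<lambda>i j. 0))
     \<and> (\<forall>x i j. t \<le> i \<or> s \<le> j \<longrightarrow> Z x i j = 0)
     \<and> (\<forall>x\<in>M. \<forall>y\<in>M. tomat t s (Z (mul x y)) = \<rho>T x * tomat t s (Z y) + tomat t s (Z x) * \<rho>S y)}"

definition coboundaries :: "'a set \<Rightarrow> nat \<Rightarrow> ('a \<Rightarrow> 'k::field mat) \<Rightarrow> nat \<Rightarrow> ('a \<Rightarrow> 'k mat)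
    \<Rightarrow> ('a \<Rightarrow> nat \<Rightarrow> nat \<Rightarrow> 'k) set" where
  "coboundaries M s \<rho>S t \<rho>T = {Z. \<exists>A \<in> carrier_mat t s. \<forall>x.
     Z x = (if x \<in> M then (\<lambda>i j. if i < t \<and> j < s then (\<rho>T x * A - A * \<rho>S x) $$ (i,j) else 0)
            else (\<lambda>i j. 0))}"

text \<open>Number of arrows from S to T in the quiver of kM: dim Ext^1(S,T)\<close>
definition arrows :: "'a set \<Rightarrow> ('a \<Rightarrow> 'a \<Rightarrow> 'a) \<Rightarrow> nat \<Rightarrow> ('a \<Rightarrow> 'k::field mat) \<Rightarrow> nat \<Rightarrow> ('a \<Rightarrow> 'k mat) \<Rightarrow> nat" where
  "arrows M mul s \<rho>S t \<rho>T =
     vector_space.dim (fscale :: 'k \<Rightarrow> _) (cocycles M mul s \<rho>S t \<rho>T)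
     - vector_space.dim (fscale :: 'k \<Rightarrow> _) (coboundaries M s \<rho>S t \<rho>T)"

section \<open>Splitting fields: kM/rad(kM) is a product of matrix algebras over k\<close>

definition malg :: "'a set \<Rightarrow> ('a \<Rightarrow> 'k::field) set" where
  "malg M = {a. \<forall>x. x \<notin> M \<longrightarrow> a x = 0}"

definition conv :: "'a set \<Rightarrow> ('a \<Rightarrow> 'a \<Rightarrow> 'a) \<Rightarrow> ('a \<Rightarrow> 'k::field) \<Rightarrow> ('a \<Rightarrow> 'k) \<Rightarrow> ('a \<Rightarrow> 'k)" where
  "conv M mul a b = (\<lambda>z. \<Sum>p \<in> {(x,y). x \<in> M \<and> y \<in> M \<and> mul x y = z}. a (fst p) * b (snd p))"

definition delta :: "'a \<Rightarrow> ('a \<Rightarrow> 'k::field)" where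
  "delta x = (\<lambda>y. if y = x then 1 else 0)"

definition left_ideal :: "'a set \<Rightarrow> ('a \<Rightarrow> 'a \<Rightarrow> 'a) \<Rightarrow> ('a \<Rightarrow> 'k::field) set \<Rightarrow> bool" where
  "left_ideal M mul I \<longleftrightarrow> I \<subseteq> malg M \<and> 0 \<in> I \<and> (\<forall>a\<in>I. \<forall>b\<in>I. a + b \<in> I)
     \<and> (\<forall>c. \<forall>a\<in>I. (\<lambda>x. c * a x) \<in> I) \<and> (\<forall>a\<in>malg M. \<forall>b\<in>I. conv M mul a b \<in> I)"

definition max_left_ideal :: "'a set \<Rightarrow> ('a \<Rightarrow> 'a \<Rightarrow> 'a) \<Rightarrow> ('a \<Rightarrow> 'k::field) set \<Rightarrow> bool" where
  "max_left_ideal M mul I \<longleftrightarrow> left_ideal M mul I \<and> I \<noteq> malg M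
     \<and> (\<forall>J. left_ideal M mul J \<and> I \<subseteq> J \<longrightarrow> J = I \<or> J = malg M)"

definition rad :: "'a set \<Rightarrow> ('a \<Rightarrow> 'a \<Rightarrow> 'a) \<Rightarrow> ('a \<Rightarrow> 'k::field) set" where
  "rad M mul = malg M \<inter> \<Inter>{I. max_left_ideal M mul I}"

definition splits :: "'k::field itself \<Rightarrow> 'a set \<Rightarrow> ('a \<Rightarrow> 'a \<Rightarrow> 'a) \<Rightarrow> 'a \<Rightarrow> bool" where
  "splits _ M mul uu \<longleftrightarrow> (\<exists>(ns :: nat list) (\<phi> :: ('a \<Rightarrow> 'k) \<Rightarrow> 'k mat list).
     (\<forall>n \<in> set ns. n > 0)
     \<and> (\<forall>a\<in>malg M. length (\<phi> a) = length ns \<and> (\<forall>i<length ns. \<phi> a ! i \<in> carrier_mat (ns!i) (ns!i)))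
     \<and> (\<forall>a\<in>malg M. \<forall>b\<in>malg M. \<phi> (a + b) = map2 (+) (\<phi> a) (\<phi> b))
     \<and> (\<forall>c. \<forall>a\<in>malg M. \<phi> (\<lambda>x. c * a x) = map (\<lambda>A. c \<cdot>\<^sub>m A) (\<phi> a))
     \<and> (\<forall>a\<in>malg M. \<forall>b\<in>malg M. \<phi> (conv M mul a b) = map2 (*) (\<phi> a) (\<phi> b))
     \<and> \<phi> (delta uu) = map (\<lambda>n. 1\<^sub>m n) ns
     \<and> (\<forall>As. length As = length ns \<and> (\<forall>i<length ns. As ! i \<in> carrier_mat (ns!i) (ns!i))
           \<longrightarrow> (\<exists>a\<in>malg M. \<phi> a = As))
     \<and> {a \<in> malg M. \<phi> a = map (\<lambda>n. 0\<^sub>m n n) ns} = rad M mul)"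

text \<open>e_Y L_{e_X}, with e = e_X, f = e_Y\<close>
definition TT :: "'a set \<Rightarrow> ('a \<Rightarrow> 'a \<Rightarrow> 'a) \<Rightarrow> 'a \<Rightarrow> 'a \<Rightarrow> 'a set" where
  "TT M mul e f = {mul f x | x. x \<in> Lcl M mul e}"

definition genrel :: "'a set \<Rightarrow> ('a \<Rightarrow> 'a \<Rightarrow> 'a) \<Rightarrow> 'a \<Rightarrow> 'a \<Rightarrow> 'a \<Rightarrow> ('a \<times> 'a) set" where
  "genrel M mul uu e f =
     {(mul f (mul m x), mul f (mul (mul m f) x)) | m x. m \<in> M \<and> x \<in> Lcl M mul e
         \<and> ideal2 M mul e \<subseteq> sigma M mul uu m}
   \<union> {(x, x') | x x'. x \<in> TT M mul e f \<and> x' \<in> TT M mul e f \<and> mul e x = mul e x'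
         \<and> (\<exists>\<epsilon>. idem M mul \<epsilon> \<and> \<epsilon> \<in> corner M mul f \<and> ideal2 M mul e \<subset> sigma M mul uu \<epsilon>
               \<and> \<epsilon> \<noteq> f \<and> mul \<epsilon> x = x \<and> mul \<epsilon> x' = x')}"

definition eqv :: "'a set \<Rightarrow> ('a \<Rightarrow> 'a \<Rightarrow> 'a) \<Rightarrow> 'a \<Rightarrow> 'a \<Rightarrow> 'a \<Rightarrow> ('a \<times> 'a) set" where
  "eqv M mul uu e f =
     (let R = genrel M mul uu e f \<inter> (TT M mul e f \<times> TT M mul e f)
      in (R \<union> R\<inverse>)\<^sup>* \<inter> (TT M mul e f \<times> TT M mul e f))"

definition cls :: "'a set \<Rightarrow> ('a \<Rightarrow> 'a \<Rightarrow> 'a) \<Rightarrow> 'a \<Rightarrow> 'a \<Rightarrow> 'a \<Rightarrow> 'a \<Rightarrow> 'a set" where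
  "cls M mul uu e f x = eqv M mul uu e f `` {x}"

text \<open>k[TT/\<equiv>] is represented as functions from classes to k supported on TT/\<equiv>\<close>
definition vscale :: "'k::field \<Rightarrow> ('b \<Rightarrow> 'k) \<Rightarrow> ('b \<Rightarrow> 'k)" where
  "vscale c v = (\<lambda>x. c * v x)"

definition VXY :: "'a set \<Rightarrow> ('a \<Rightarrow> 'a \<Rightarrow> 'a) \<Rightarrow> 'a \<Rightarrow> 'a \<Rightarrow> 'a \<Rightarrow> ('a set \<Rightarrow> 'k::field) set" where
  "VXY M mul uu e f = module.span (vscale :: 'k \<Rightarrow> _)
     {delta (cls M mul uu e f x) - delta (cls M mul uu e f (mul e x)) | x.
        x \<in> TT M mul e f - Gp M mul e}"

definition clsmap :: "'a set \<Rightarrow> ('a \<Rightarrow> 'a \<Rightarrow> 'a) \<Rightarrow> 'a \<Rightarrow> 'a \<Rightarrow> 'a \<Rightarrow> 'a \<times> 'a \<Rightarrow> 'a set \<Rightarrow> 'a set" where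
  "clsmap M mul uu e f gh c =
     cls M mul uu e f (mul (mul (fst gh) (SOME x. x \<in> c)) (ginv M mul e (snd gh)))"

definition act :: "'a set \<Rightarrow> ('a \<Rightarrow> 'a \<Rightarrow> 'a) \<Rightarrow> 'a \<Rightarrow> 'a \<Rightarrow> 'a \<Rightarrow> 'a \<times> 'a \<Rightarrow> ('a set \<Rightarrow> 'k::field) \<Rightarrow> ('a set \<Rightarrow> 'k)" where
  "act M mul uu e f gh v = (\<lambda>d. \<Sum>c \<in> {c \<in> TT M mul e f // eqv M mul uu e f.
                                        clsmap M mul uu e f gh c = d}. v c)"

definition fsub :: "('b \<Rightarrow> 'k::field) set \<Rightarrow> bool" where
  "fsub W \<longleftrightarrow> 0 \<in> W \<and> (\<forall>v\<in>W. \<forall>w\<in>W. v + w \<in> W) \<and> (\<forall>c. \<forall>v\<in>W. vscale c v \<in> W)"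

definition invsub :: "'g set \<Rightarrow> ('g \<Rightarrow> ('b \<Rightarrow> 'k::field) \<Rightarrow> ('b \<Rightarrow> 'k)) \<Rightarrow> ('b \<Rightarrow> 'k) set \<Rightarrow> bool" where
  "invsub G a W \<longleftrightarrow> fsub W \<and> (\<forall>g\<in>G. \<forall>v\<in>W. a g v \<in> W)"

definition comp_series :: "'g set \<Rightarrow> ('g \<Rightarrow> ('b \<Rightarrow> 'k::field) \<Rightarrow> ('b \<Rightarrow> 'k)) \<Rightarrow> ('b \<Rightarrow> 'k) set
    \<Rightarrow> ('b \<Rightarrow> 'k) set list \<Rightarrow> bool" where
  "comp_series G a V Ws \<longleftrightarrow> Ws \<noteq> [] \<and> hd Ws = {0} \<and> last Ws = V
     \<and> (\<forall>i<length Ws. invsub G a (Ws ! i))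
     \<and> (\<forall>i. Suc i < length Ws \<longrightarrow> Ws ! i \<subset> Ws ! Suc i
          \<and> \<not> (\<exists>W. invsub G a W \<and> Ws ! i \<subset> W \<and> W \<subset> Ws ! Suc i))"

definition factor_iso :: "'g set \<Rightarrow> ('g \<Rightarrow> ('b \<Rightarrow> 'k::field) \<Rightarrow> ('b \<Rightarrow> 'k)) \<Rightarrow> ('b \<Rightarrow> 'k) set
    \<Rightarrow> ('b \<Rightarrow> 'k) set \<Rightarrow> nat \<Rightarrow> ('g \<Rightarrow> 'k mat) \<Rightarrow> bool" where
  "factor_iso G a A B n \<rho> \<longleftrightarrow> (\<exists>\<phi> :: ('b \<Rightarrow> 'k) \<Rightarrow> 'k vec.
       \<phi> ` B = carrier_vec n
     \<and> (\<forall>u\<in>B. \<forall>v\<in>B. \<phi> (u + v) = \<phi> u + \<phi> v)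
     \<and> (\<forall>c. \<forall>v\<in>B. \<phi> (vscale c v) = c \<cdot>\<^sub>v \<phi> v)
     \<and> {v \<in> B. \<phi> v = 0\<^sub>v n} = A
     \<and> (\<forall>g\<in>G. \<forall>v\<in>B. \<phi> (a g v) = \<rho> g *\<^sub>v \<phi> v))"

definition multiplicity :: "'g set \<Rightarrow> ('g \<Rightarrow> ('b \<Rightarrow> 'k::field) \<Rightarrow> ('b \<Rightarrow> 'k)) \<Rightarrow> ('b \<Rightarrow> 'k) set
    \<Rightarrow> nat \<Rightarrow> ('g \<Rightarrow> 'k mat) \<Rightarrow> nat" where
  "multiplicity G a V n \<rho> = (SOME c. \<exists>Ws. comp_series G a V Ws
       \<and> c = card {i. Suc i < length Ws \<and> factor_iso G a (Ws ! i) (Ws ! Suc i) n \<rho>})"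

definition kron :: "'k::field mat \<Rightarrow> 'k mat \<Rightarrow> 'k mat" where
  "kron A B = mat (dim_row A * dim_row B) (dim_col A * dim_col B)
     (\<lambda>(i,j). A $$ (i div dim_row B, j div dim_col B) * B $$ (i mod dim_row B, j mod dim_col B))"

definition tensor_dual :: "'a set \<Rightarrow> ('a \<Rightarrow> 'a \<Rightarrow> 'a) \<Rightarrow> 'a \<Rightarrow> ('a \<Rightarrow> 'k::field mat) \<Rightarrow> ('a \<Rightarrow> 'k mat)
    \<Rightarrow> 'a \<times> 'a \<Rightarrow> 'k mat" where
  "tensor_dual M mul e \<rho>V \<rho>U = (\<lambda>(g,h). kron (\<rho>V g) (transpose_mat (\<rho>U (ginv M mul e h))))"

end

theory Submission
  imports Defs
begin

text \<open>In an orthogroup \<open>m \<mapsto> e m e\<close> is multiplicative on the elements whose ideal contains \<open>M e M\<close>.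
  Subtracting a coboundary from a cocycle \<open>Z\<close> on \<open>Hom(U, V)\<close> achieves \<open>Z(e) = 0\<close>. For
  incomparable ideals this forces \<open>Z = 0\<close>; for equal ideals one averages over the maximal subgroup
  instead. For \<open>e < f\<close> a cocycle with \<open>Z(e) = 0\<close> satisfies \<open>Z(m) = Z(f m e)\<close>, is constant on the
  classes of \<open>\<equiv>\<close>, and \<open>[x] - [e x] \<mapsto> Z(x)\<close> is an equivariant map from \<open>V\<^sub>X\<^sub>Y\<close> to \<open>V \<otimes> U*\<close>;
  conversely \<open>\<psi>\<close> gives the cocycle \<open>m \<mapsto> \<psi>([f m e] - [e m e])\<close>. So the number of arrows is the
  dimension of \<open>Hom(V\<^sub>X\<^sub>Y, V \<otimes> U*)\<close>, which is a multiplicity by semisimplicity and because over a splitting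
  field \<open>V \<otimes> U*\<close> is absolutely irreducible. Transposition identifies extensions of
  \<open>M\<close> with extensions of the opposite monoid between the transposed modules; these are the
  contragredients of the modules in the statement. Passing to contragredients is harmless
  since \<open>V\<^sub>X\<^sub>Y\<close> is a difference of two permutation modules, whose equivariant maps into a module and its dual
  have equal dimensions.\<close>

section \<open>Dimensions\<close>

text \<open>\<open>dim\<close> is the cardinality of a basis, so it is 0 and uninformative for
  infinite-dimensional subsets of the ambient function spaces, while \<open>arrows\<close> subtracts
  natural numbers; finite dimension is therefore carried along with every dimension formula.
  \<open>multiplicity\<close> reads a count off an arbitrarily chosen composition series.
  Jordan-Hoelder is bypassed: the count along any series equals the dimension of one fixed space of
  equivariant maps. Splitting is a hypothesis on kM, while absolute irreducibility is wanted for the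
  maximal subgroups; the passage uses that an inflated module sees \<open>m\<close> only through
  \<open>e m e\<close> or as 0. Equal dimensions for a module and its dual are not read off from
  characters, as the characteristic may be positive; a pairing gives an inequality in each
  direction. It needs a permuted basis, which the spanning vectors of \<open>VXY\<close> are not, so
  it is applied to the two permutation modules and the results are subtracted. The last case
  supplies comparable ideals only, so a comparable idempotent has to be produced and representations
  transported to it.\<close>

definition fin_dim :: "('k::field \<Rightarrow> 'b::ab_group_add \<Rightarrow> 'b) \<Rightarrow> 'b set \<Rightarrow> bool" where
  "fin_dim s A \<longleftrightarrow> (\<exists>B. finite B \<and> A \<subseteq> module.span s B)"

locale vspace = vs: vector_space s for s :: "'k::field \<Rightarrow> 'b::ab_group_add \<Rightarrow> 'b"
begin

lemma fin_dim_subset: "fin_dim s B \<Longrightarrow> A \<subseteq> B \<Longrightarrow> fin_dim s A"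
  unfolding fin_dim_def by blast

lemma fin_dim_finite_basis:
  assumes "fin_dim s A" "\<not> vs.dependent B" "B \<subseteq> A"
  shows "finite B"
  using assms vs.independent_span_bound unfolding fin_dim_def by blast

lemma fin_dim_basis:
  assumes "fin_dim s A" "vs.subspace A"
  obtains B where "finite B" "\<not> vs.dependent B" "vs.span B = A" "B \<subseteq> A" "vs.dim A = card B"
proof -
  obtain B where B: "B \<subseteq> A" "\<not> vs.dependent B" "A \<subseteq> vs.span B"
    using vs.maximal_independent_subset by blast
  have "vs.span B = A" using B assms(2) vs.span_minimal by blast
  then show thesis using that B fin_dim_finite_basis[OF assms(1) B(2,1)] vs.basis_card_eq_dim by metis
qed

text \<open>A basis of \<open>A\<close> together with one vector of \<open>B\<close> outside
  \<open>A\<close> stays independent and extends to a basis of \<open>B\<close>. The strict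
  inequality drives the induction that builds composition series.\<close>

lemma dim_psubset_fin_dim:
  assumes "fin_dim s B" "vs.subspace A" "vs.subspace B" "A \<subset> B"
  shows "vs.dim A < vs.dim B"
proof -
  obtain C where C: "finite C" "\<not> vs.dependent C" "vs.span C = A" "C \<subseteq> A" "vs.dim A = card C"
    using fin_dim_basis[OF fin_dim_subset[OF assms(1)] assms(2)] assms(4) by blast
  obtain x where x: "x \<in> B" "x \<notin> A" using assms(4) by blast
  have ind: "\<not> vs.dependent (insert x C)" using C x vs.independent_insertI by blast
  obtain D where D: "insert x C \<subseteq> D" "D \<subseteq> B" "\<not> vs.dependent D" "B \<subseteq> vs.span D"
    using vs.maximal_independent_subset_extend[OF _ ind, of B] assms(4) C x by blast
  have "finite D" using fin_dim_finite_basis[OF assms(1) D(3,2)] .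
  moreover have "vs.dim B = card D" using D vs.basis_card_eq_dim by metis
  moreover have "x \<notin> C" using C x by blast
  ultimately have "Suc (card C) \<le> vs.dim B"
    using C(1) D(1) card_mono[of D "insert x C"] by simp
  then show ?thesis using C(5) by simp
qed

end

context vector_space_pair
begin

text \<open>Linearity of \<open>f\<close> is asked for on \<open>A\<close> only, because the maps
  used later are meaningful only on their subspace. That \<open>A\<close> is finite dimensional is a
  conclusion, drawn from kernel and image.\<close>

lemma rank_nullity_on:
  assumes A: "vs1.subspace A"
    and add: "\<And>x y. x \<in> A \<Longrightarrow> y \<in> A \<Longrightarrow> f (x + y) = f x + f y"
    and scale: "\<And>c x. x \<in> A \<Longrightarrow> f (s1 c x) = s2 c (f x)"
    and fin: "fin_dim s1 {x \<in> A. f x = 0}" "fin_dim s2 (f ` A)"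
  shows "fin_dim s1 A" and "vs1.dim A = vs1.dim {x \<in> A. f x = 0} + vs2.dim (f ` A)"
proof -
  interpret w1: vspace s1 by standard
  interpret w2: vspace s2 by standard
  let ?K = "{x \<in> A. f x = 0}"
  obtain bK where bK: "bK \<subseteq> ?K" "vs1.independent bK" "?K \<subseteq> vs1.span bK"
    using vs1.maximal_independent_subset by blast
  obtain bA where bA: "bK \<subseteq> bA" "bA \<subseteq> A" "vs1.independent bA" "A \<subseteq> vs1.span bA"
    using vs1.maximal_independent_subset_extend[OF _ bK(2), of A] bK(1) by blast
  \<comment> \<open>A globally linear map with the values of \<open>f\<close> on the basis
    \<open>bA\<close>; it agrees with \<open>f\<close> on all of \<open>A\<close>, so the theory of
    linear maps applies to it.\<close>
  obtain F where F: "Vector_Spaces.linear s1 s2 F" "\<And>x. x \<in> bA \<Longrightarrow> F x = f x"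
    using linear_independent_extend[OF bA(3), of f] by blast
  interpret F: Vector_Spaces.linear s1 s2 F by (rule F(1))
  have f0: "f 0 = 0" using scale[of 0 0] vs1.subspace_0[OF A] by simp
  have "vs1.span bA \<subseteq> {x \<in> A. F x = f x}"
  proof (rule vs1.span_minimal)
    show "bA \<subseteq> {x \<in> A. F x = f x}" using bA(2) F(2) by blast
    show "vs1.subspace {x \<in> A. F x = f x}"
      unfolding vs1.subspace_def
      by (simp add: vs1.subspace_0[OF A] vs1.subspace_add[OF A] vs1.subspace_scale[OF A]
          F.add F.scale F.zero f0 add scale)
  qed
  then have Ff: "F x = f x" if "x \<in> A" for x using that bA(4) by blast
  let ?C = "bA - bK"
  have iC: "vs1.independent ?C" using bA(3) vs1.independent_mono by blast
  have CA: "vs1.span ?C \<subseteq> A" using vs1.span_minimal[of ?C A] bA(2) A by blast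
  \<comment> \<open>A kernel element in the span of \<open>bA - bK\<close> also lies in the span of
    \<open>bK\<close>; its unique coordinates with respect to \<open>bA\<close> are supported on
    both parts and hence vanish.\<close>
  have inj: "inj_on F (vs1.span ?C)"
  proof (subst F.inj_on_iff_eq_0[OF vs1.subspace_span], intro ballI impI)
    fix x assume x: "x \<in> vs1.span ?C" "F x = 0"
    then have "x \<in> A" using CA by blast
    then have xK: "x \<in> vs1.span bK" using bK(3) Ff x(2) by auto
    have "vs1.representation bA x = vs1.representation bK x"
      by (rule vs1.representation_extend[OF bA(3) xK bA(1)])
    moreover have "vs1.representation bA x = vs1.representation ?C x"
      by (rule vs1.representation_extend[OF bA(3) x(1)]) blast
    ultimately have "vs1.representation bA x b = 0" for b
      by (metis DiffE vs1.representation_ne_zero)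
    moreover have "x \<in> vs1.span bA" using CA x(1) bA(4) by blast
    ultimately show "x = 0" using vs1.sum_nonzero_representation_eq[OF bA(3)] by fastforce
  qed
  have iFC: "vs2.independent (F ` ?C)" by (rule F.independent_injective_image[OF iC inj])
  have injC: "inj_on F ?C" using inj vs1.span_superset inj_on_subset by blast
  have FA: "F ` ?C \<subseteq> f ` A" using Ff bA(2) by force
  have finC: "finite ?C"
    using w2.fin_dim_finite_basis[OF fin(2) iFC FA] injC finite_imageD by blast
  have finK: "finite bK" by (rule w1.fin_dim_finite_basis[OF fin(1) bK(2,1)])
  have finA: "finite bA" using finC finK by simp
  show "fin_dim s1 A" using finA bA(4) unfolding fin_dim_def by blast
  have "f ` A \<subseteq> vs2.span (F ` ?C)"
  proof -
    have "f ` A = F ` A" using Ff by force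
    also have "\<dots> \<subseteq> F ` vs1.span bA" using bA(4) by blast
    also have "\<dots> = vs2.span (F ` bA)" by (rule F.span_image[symmetric])
    also have "\<dots> \<subseteq> vs2.span (F ` ?C)"
    proof (rule vs2.span_minimal[OF _ vs2.subspace_span], rule subsetI)
      fix y assume "y \<in> F ` bA"
      then obtain b where b: "b \<in> bA" "y = F b" by blast
      show "y \<in> vs2.span (F ` ?C)"
      proof (cases "b \<in> bK")
        case True
        then have "y = 0" using b bK(1) F(2) by auto
        then show ?thesis by (simp add: vs2.span_zero)
      next
        case False
        then show ?thesis using b by (auto intro: vs2.span_base)
      qed
    qed
    finally show ?thesis .
  qed
  then have "vs2.dim (f ` A) = card (F ` ?C)" using vs2.basis_card_eq_dim[OF FA _ iFC] by simp
  also have "\<dots> = card ?C" by (rule card_image[OF injC])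
  finally have 1: "vs2.dim (f ` A) = card ?C" .
  have 2: "vs1.dim A = card bA" using vs1.basis_card_eq_dim[OF bA(2,4,3)] by simp
  have 3: "vs1.dim ?K = card bK" using vs1.basis_card_eq_dim[OF bK(1,3,2)] by simp
  show "vs1.dim A = vs1.dim ?K + vs2.dim (f ` A)"
    unfolding 1 2 3 using finK finA bA(1) by (metis card_Diff_subset card_mono le_add_diff_inverse)
qed

lemma dim_iso_on:
  assumes A: "vs1.subspace A"
    and add: "\<And>x y. x \<in> A \<Longrightarrow> y \<in> A \<Longrightarrow> f (x + y) = f x + f y"
    and scale: "\<And>c x. x \<in> A \<Longrightarrow> f (s1 c x) = s2 c (f x)"
    and ker: "\<And>x. x \<in> A \<Longrightarrow> f x = 0 \<Longrightarrow> x = 0"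
    and fin: "fin_dim s2 (f ` A)"
  shows "fin_dim s1 A" and "vs1.dim A = vs2.dim (f ` A)"
proof -
  have f0: "f 0 = 0" using scale[of 0 0] vs1.subspace_0[OF A] by simp
  have K: "{x \<in> A. f x = 0} = {0}" using ker f0 vs1.subspace_0[OF A] by auto
  have "fin_dim s1 {0}" unfolding fin_dim_def using vs1.span_base by blast
  moreover have "vs1.dim {0} = 0"
    using vs1.basis_card_eq_dim[of "{}" "{0}"] vs1.independent_empty by simp
  ultimately show "fin_dim s1 A" "vs1.dim A = vs2.dim (f ` A)"
    using rank_nullity_on[OF A add scale] fin K by auto
qed

end

lemma vector_space_vscale: "vector_space vscale"
  by standard (auto simp: vscale_def fun_eq_iff algebra_simps)

lemma vector_space_fscale: "vector_space fscale"
  by standard (auto simp: fscale_def fun_eq_iff algebra_simps)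

interpretation V: vector_space vscale by (rule vector_space_vscale)
interpretation F: vector_space fscale by (rule vector_space_fscale)
interpretation VS: vspace vscale by standard
interpretation VV: vector_space_pair vscale vscale by standard
interpretation FV: vector_space_pair fscale vscale by standard
interpretation FF: vector_space_pair fscale fscale by standard

lemma fsub_iff_subspace: "fsub W \<longleftrightarrow> V.subspace W"
  unfolding fsub_def V.subspace_def by blast

lemma sum_fun_apply: "sum f A x = (\<Sum>a\<in>A. f a x)"
  by (induction A rule: infinite_finite_induct) auto

lemma finite_support_expand:
  fixes v :: "'b \<Rightarrow> 'k::field"
  assumes "finite S" "\<And>x. x \<notin> S \<Longrightarrow> v x = 0"
  shows "v = (\<Sum>s\<in>S. vscale (v s) (delta s))"
proof
  fix x
  have "(\<Sum>s\<in>S. vscale (v s) (delta s)) x = (\<Sum>s\<in>S. if s = x then v s else 0)"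
    unfolding sum_fun_apply by (intro sum.cong) (auto simp: vscale_def delta_def)
  also have "\<dots> = v x" using assms by simp
  finally show "v x = (\<Sum>s\<in>S. vscale (v s) (delta s)) x" by simp
qed

lemma fin_dim_finite_support:
  fixes S :: "'b set"
  assumes "finite S"
  shows "fin_dim vscale {v. \<forall>x. x \<notin> S \<longrightarrow> v x = (0::'k::field)}"
  unfolding fin_dim_def
proof (intro exI conjI subsetI)
  show "finite (delta ` S)" using assms by blast
  fix v :: "'b \<Rightarrow> 'k" assume "v \<in> {v. \<forall>x. x \<notin> S \<longrightarrow> v x = 0}"
  then have "v = (\<Sum>s\<in>S. vscale (v s) (delta s))" using finite_support_expand[OF assms] by blast
  moreover have "\<dots> \<in> V.span (delta ` S)"
    by (intro V.span_sum V.span_scale V.span_base) blast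
  ultimately show "v \<in> V.span (delta ` S)" by simp
qed

lemma dim_finite_support_le:
  fixes A :: "('b \<Rightarrow> 'k::field) set"
  assumes "finite S" "A \<subseteq> {v. \<forall>x. x \<notin> S \<longrightarrow> v x = 0}"
  shows "V.dim A \<le> card S"
proof -
  have "A \<subseteq> V.span (delta ` S)"
  proof
    fix v assume "v \<in> A"
    then have "v = (\<Sum>s\<in>S. vscale (v s) (delta s))" using assms finite_support_expand by blast
    moreover have "\<dots> \<in> V.span (delta ` S)"
      by (intro V.span_sum V.span_scale V.span_base) blast
    ultimately show "v \<in> V.span (delta ` S)" by simp
  qed
  then have "V.dim A \<le> card (delta ` S :: ('b \<Rightarrow> 'k) set)" 
    by (rule V.dim_le_card[OF _ finite_imageI[OF assms(1)]])
  also have "\<dots> \<le> card S" by (rule card_image_le[OF assms(1)])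
  finally show ?thesis .
qed

text \<open>Pairing with a basis of \<open>B\<close> embeds \<open>A\<close> into the functions on
  that basis. Nondegeneracy is demanded on the side of \<open>A\<close> alone, so one use yields one
  inequality.\<close>

lemma dim_le_pairing:
  fixes A B :: "('b \<Rightarrow> 'k::field) set" and S :: "'b set"
  assumes S: "finite S"
    and A: "V.subspace A" and B: "V.subspace B" "B \<subseteq> {v. \<forall>x. x \<notin> S \<longrightarrow> v x = 0}"
    and nondeg: "\<And>v. v \<in> A \<Longrightarrow> (\<And>w. w \<in> B \<Longrightarrow> (\<Sum>s\<in>S. v s * w s) = 0) \<Longrightarrow> v = 0"
  shows "V.dim A \<le> V.dim B"
proof -
  have "fin_dim vscale B" using fin_dim_finite_support[OF S] B(2) VS.fin_dim_subset by blast
  then obtain b where b: "finite b" "V.span b = B" "V.dim B = card b" "b \<subseteq> B"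
    using VS.fin_dim_basis[OF _ B(1)] by metis
  define f where "f v = (\<lambda>w. if w \<in> b then \<Sum>s\<in>S. v s * w s else 0)" for v :: "'b \<Rightarrow> 'k"
  have img: "f ` A \<subseteq> {u. \<forall>w. w \<notin> b \<longrightarrow> u w = 0}" by (auto simp: f_def)
  have "V.dim A = V.dim (f ` A)"
  proof (rule VV.dim_iso_on(2)[OF A])
    fix v assume v: "v \<in> A" "f v = 0"
    show "v = 0"
    proof (rule nondeg[OF v(1)])
      fix w assume "w \<in> B"
      then have "w \<in> V.span b" using b by simp
      moreover have "V.span b \<subseteq> {w. (\<Sum>s\<in>S. v s * w s) = 0}"
      proof (rule V.span_minimal)
        show "b \<subseteq> {w. (\<Sum>s\<in>S. v s * w s) = 0}"
        proof
          fix w assume "w \<in> b"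
          then show "w \<in> {w. (\<Sum>s\<in>S. v s * w s) = 0}" using fun_cong[OF v(2), of w] by (simp add: f_def)
        qed
        show "V.subspace {w. (\<Sum>s\<in>S. v s * w s) = 0}"
          by (simp add: V.subspace_def vscale_def distrib_left sum.distrib mult.left_commute
              flip: sum_distrib_left)
      qed
      ultimately show "(\<Sum>s\<in>S. v s * w s) = 0" by blast
    qed
  next
    show "fin_dim vscale (f ` A)"
      by (rule VS.fin_dim_subset[OF fin_dim_finite_support[OF b(1)] img])
  qed (simp_all add: f_def fun_eq_iff distrib_right sum.distrib vscale_def sum_distrib_left mult.assoc)
  also have "\<dots> \<le> card b" by (rule dim_finite_support_le[OF b(1) img])
  finally show ?thesis using b by simp
qed

section \<open>Structure of finite orthogroups\<close>

locale fin_monoid =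
  fixes M :: "'a set" and mul :: "'a \<Rightarrow> 'a \<Rightarrow> 'a" (infixl \<open>\<cdot>\<close> 70) and uu :: 'a
  assumes mon: "is_monoid M mul uu" and fin: "finite M"
begin

abbreviation "J \<equiv> ideal2 M mul"
abbreviation "pw \<equiv> mpow mul uu"
abbreviation "om \<equiv> omega M mul uu"
abbreviation "idm \<equiv> idem M mul"

lemma uu_in [simp]: "uu \<in> M"
  and closed [simp]: "x \<in> M \<Longrightarrow> y \<in> M \<Longrightarrow> x \<cdot> y \<in> M"
  and assoc: "x \<in> M \<Longrightarrow> y \<in> M \<Longrightarrow> z \<in> M \<Longrightarrow> (x \<cdot> y) \<cdot> z = x \<cdot> (y \<cdot> z)"
  and uu_left [simp]: "x \<in> M \<Longrightarrow> uu \<cdot> x = x"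
  and uu_right [simp]: "x \<in> M \<Longrightarrow> x \<cdot> uu = x"
  using mon unfolding is_monoid_def by auto

lemma idm_in [simp]: "idm e \<Longrightarrow> e \<in> M"
  and idm_sq: "idm e \<Longrightarrow> e \<cdot> e = e"
  by (auto simp: idem_def)

lemma pw_0 [simp]: "pw m 0 = uu" and pw_Suc: "pw m (Suc n) = m \<cdot> pw m n"
  by (auto simp: mpow_def)

lemma pw_in [simp]: "m \<in> M \<Longrightarrow> pw m n \<in> M"
  by (induction n) (auto simp: pw_Suc)

lemma pw_add: "m \<in> M \<Longrightarrow> pw m (a + b) = pw m a \<cdot> pw m b"
  by (induction a) (auto simp: pw_Suc assoc)

lemma pw_1: "m \<in> M \<Longrightarrow> pw m (Suc 0) = m"
  by (simp add: pw_Suc)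

lemma pw_Suc2: "m \<in> M \<Longrightarrow> pw m (Suc n) = pw m n \<cdot> m"
  using pw_add[of m n 1] by (simp add: pw_1)

lemma pw_mult: "m \<in> M \<Longrightarrow> pw (pw m a) b = pw m (a * b)"
  by (induction b) (auto simp: pw_Suc pw_add)

lemma pw_idm: "idm e \<Longrightarrow> n \<ge> 1 \<Longrightarrow> pw e n = e"
proof (induction n)
  case (Suc n)
  then show ?case by (cases n) (auto simp: pw_Suc idem_def)
qed simp

lemma idempotent_power:
  assumes "m \<in> M"
  obtains n where "n \<ge> 1" "idm (pw m n)"
proof -
  have "range (pw m) \<subseteq> M" using assms by auto
  then have "\<not> inj (pw m)" using finite_subset[OF _ fin] finite_imageD[of "pw m" UNIV] infinite_UNIV_nat by blast
  then obtain i j where ij: "i < j" "pw m i = pw m j" using linorder_injI by metis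
  define p where "p = j - i"
  have p: "p \<ge> 1" "pw m i = pw m (i + p)" using ij by (auto simp: p_def)
  have 1: "pw m (k + i) = pw m (k + i + p)" for k
    using p(2) pw_add[OF assms, of k i] pw_add[OF assms, of k "i + p"] by (simp add: add.assoc)
  have 2: "pw m (k + i) = pw m (k + i + r * p)" for k r
  proof (induction r)
    case (Suc r)
    then show ?case using 1[of "k + r * p"] by (simp add: algebra_simps)
  qed simp
  \<comment> \<open>A multiple of the period \<open>p\<close> that is at least the preperiod
    \<open>i\<close>, so that the powers with exponents \<open>?n\<close> and \<open>?n + ?n\<close>
    coincide.\<close>
  let ?n = "(i + 1) * p"
  have "?n \<ge> i" using p(1) by (cases p) auto
  then have "pw m ?n = pw m (?n + ?n)" using 2[of "?n - i" "i + 1"] by simp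
  then have "idm (pw m ?n)" using assms pw_add[OF assms] by (simp add: idem_def)
  moreover have "?n \<ge> 1" using p(1) by simp
  ultimately show thesis using that by blast
qed

text \<open>Two idempotent powers of \<open>m\<close> have a common power, and positive powers of an
  idempotent are that idempotent; this settles the definite description in
  \<open>omega\<close>.\<close>

lemma omega_eqI:
  assumes "m \<in> M" "idm e" "e = pw m n" "n \<ge> 1"
  shows "om m = e"
  unfolding omega_def
proof (rule the_equality)
  show "idm e \<and> (\<exists>n\<ge>1. e = pw m n)" using assms by blast
  fix f assume "idm f \<and> (\<exists>n\<ge>1. f = pw m n)"
  then obtain b where b: "idm f" "b \<ge> 1" "f = pw m b" by blast
  have "f = pw f n" using pw_idm[OF b(1) assms(4)] by simp
  also have "\<dots> = pw e b" using b(3) assms(1,3) by (simp add: pw_mult mult.commute)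
  also have "\<dots> = e" using pw_idm[OF assms(2) b(2)] .
  finally show "f = e" .
qed

lemma omega_power:
  assumes "m \<in> M"
  obtains n where "n \<ge> 1" "om m = pw m n"
  using idempotent_power[OF assms] omega_eqI[OF assms] by metis

lemma omega_idm [simp]: "m \<in> M \<Longrightarrow> idm (om m)"
  using idempotent_power omega_eqI by metis

lemma omega_in [simp]: "m \<in> M \<Longrightarrow> om m \<in> M"
  by simp

lemma J_le_iff:
  assumes "x \<in> M" "y \<in> M"
  shows "J y \<subseteq> J x \<longleftrightarrow> (\<exists>a\<in>M. \<exists>b\<in>M. y = a \<cdot> x \<cdot> b)"
proof
  assume "J y \<subseteq> J x"
  moreover have "y \<in> J y" using assms unfolding ideal2_def
    by (intro CollectI exI[of _ uu]) auto
  ultimately show "\<exists>a\<in>M. \<exists>b\<in>M. y = a \<cdot> x \<cdot> b" unfolding ideal2_def by blast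
next
  assume "\<exists>a\<in>M. \<exists>b\<in>M. y = a \<cdot> x \<cdot> b"
  then obtain a b where ab: "a \<in> M" "b \<in> M" "y = a \<cdot> x \<cdot> b" by blast
  show "J y \<subseteq> J x"
  proof
    fix z assume "z \<in> J y"
    then obtain c d where "c \<in> M" "d \<in> M" "z = c \<cdot> y \<cdot> d" unfolding ideal2_def by blast
    then have "z = (c \<cdot> a) \<cdot> x \<cdot> (b \<cdot> d)" "c \<cdot> a \<in> M" "b \<cdot> d \<in> M"
      using ab assms by (simp_all add: assoc)
    then show "z \<in> J x" unfolding ideal2_def by blast
  qed
qed

lemma J_leI: "a \<in> M \<Longrightarrow> x \<in> M \<Longrightarrow> b \<in> M \<Longrightarrow> y = a \<cdot> x \<cdot> b \<Longrightarrow> J y \<subseteq> J x"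
  using J_le_iff[of x y] by auto

lemma J_mul1: "x \<in> M \<Longrightarrow> y \<in> M \<Longrightarrow> J (x \<cdot> y) \<subseteq> J x"
  by (rule J_leI[of uu _ y]) auto

lemma J_mul2: "x \<in> M \<Longrightarrow> y \<in> M \<Longrightarrow> J (x \<cdot> y) \<subseteq> J y"
  by (rule J_leI[of x _ uu]) auto

lemma corner_iff: "idm e \<Longrightarrow> x \<in> corner M mul e \<longleftrightarrow> x \<in> M \<and> e \<cdot> x = x \<and> x \<cdot> e = x"
proof
  assume e: "idm e" and "x \<in> corner M mul e"
  then obtain m where m: "m \<in> M" "x = e \<cdot> m \<cdot> e" unfolding corner_def by blast
  then show "x \<in> M \<and> e \<cdot> x = x \<and> x \<cdot> e = x"
    using e idm_sq[OF e] by (simp add: assoc) (simp flip: assoc)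
next
  assume "idm e" "x \<in> M \<and> e \<cdot> x = x \<and> x \<cdot> e = x"
  then show "x \<in> corner M mul e" unfolding corner_def by (metis (mono_tags, lifting) mem_Collect_eq)
qed

lemma corner_pw:
  assumes "idm e" "x \<in> corner M mul e" "n \<ge> 1"
  shows "pw x n \<in> corner M mul e"
proof -
  have x: "x \<in> M" "e \<cdot> x = x" "x \<cdot> e = x" using corner_iff assms by auto
  obtain k where "n = Suc k" using assms(3) by (cases n) auto
  then show ?thesis using x assms(1) pw_Suc2[OF x(1)] by (simp add: corner_iff pw_Suc flip: assoc)
      (metis assoc idm_in pw_Suc pw_in)
qed

end

locale fin_orthogroup = fin_monoid +
  assumes rect: "rectangular M mul" and regu: "regular M mul"
begin

lemma rect_closed:
  assumes "idm e" "idm f" "J e = J f"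
  shows "idm (e \<cdot> f)" "J (e \<cdot> f) = J e"
  using rect assms unfolding rectangular_def by metis+

text \<open>Write \<open>m = m n m\<close>. The idempotents \<open>m n\<close> and
  \<open>n m\<close> generate the ideal of \<open>m\<close>, and by rectangularity so does their
  product \<open>(n m) (m n)\<close>, which has \<open>m m\<close> as a factor.\<close>

lemma J_sq:
  assumes "m \<in> M"
  shows "J m \<subseteq> J (m \<cdot> m)"
proof -
  obtain n where n: "n \<in> M" "m \<cdot> n \<cdot> m = m" using regu assms unfolding regular_def by blast
  let ?e = "m \<cdot> n" and ?f = "n \<cdot> m"
  have e: "idm ?e" "idm ?f" using n assms by (simp_all add: idem_def) (simp_all flip: assoc, simp add: assoc)
  have "J ?e = J m"
    using J_mul1[OF assms n(1)] J_mul1[of ?e m] n assms by auto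
  moreover have "J ?f = J m"
    using J_mul2[OF n(1) assms] J_mul2[of m ?f] n assms by (auto simp: assoc)
  ultimately have "J (?f \<cdot> ?e) = J m" using rect_closed[OF e(2,1)] by simp
  moreover have "J (?f \<cdot> ?e) \<subseteq> J (m \<cdot> m)"
    by (rule J_leI[of n _ n]) (use n assms in \<open>simp_all add: assoc\<close>)
  ultimately show ?thesis by simp
qed

text \<open>Stability of the finite monoid turns \<open>m \<in> M m\<^sup>2 M\<close> into \<open>m \<in> m\<^sup>2 M\<close>, so that
  \<open>m\<close> lies in a subgroup.\<close>
lemma omega_absorb:
  assumes m: "m \<in> M"
  shows "om m \<cdot> m = m" "m \<cdot> om m = m"
proof -
  obtain a b where ab: "a \<in> M" "b \<in> M" "m = a \<cdot> (m \<cdot> m) \<cdot> b"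
    using J_sq[OF m] J_le_iff[of "m \<cdot> m" m] m by auto
  \<comment> \<open>Each substitution of \<open>m = a (m m) b\<close> adds a factor \<open>a\<close>
    on the left and a factor \<open>m b\<close> on the right. Once the power of \<open>m b\<close>
    is idempotent, \<open>m\<close> absorbs it on the right.\<close>
  have 1: "m = pw a k \<cdot> m \<cdot> pw (m \<cdot> b) k" for k
  proof (induction k)
    case (Suc k)
    have "m = pw a k \<cdot> (a \<cdot> (m \<cdot> m) \<cdot> b) \<cdot> pw (m \<cdot> b) k" using Suc ab(3) by simp
    also have "\<dots> = pw a (Suc k) \<cdot> m \<cdot> pw (m \<cdot> b) (Suc k)"
      using m ab(1,2) pw_Suc2[OF ab(1)] by (simp add: assoc pw_Suc[of "m \<cdot> b"])
    finally show ?case .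
  qed (use m in simp)
  obtain k where k: "k \<ge> 1" "om (m \<cdot> b) = pw (m \<cdot> b) k" using omega_power[of "m \<cdot> b"] m ab by auto
  have eps: "idm (pw (m \<cdot> b) k)" using k omega_idm m ab by (metis closed)
  then have "m \<cdot> pw (m \<cdot> b) k = m"
    using 1[of k] m ab(1,2) idm_sq[OF eps] by (metis assoc closed pw_in)
  moreover obtain j where j: "k = Suc j" using k by (cases k) auto
  ultimately have mc: "m = m \<cdot> m \<cdot> (b \<cdot> pw (m \<cdot> b) j)" using m ab by (simp add: pw_Suc assoc)
  define c where "c = b \<cdot> pw (m \<cdot> b) j"
  have c: "c \<in> M" "m = m \<cdot> m \<cdot> c" using mc m ab by (auto simp: c_def)
  \<comment> \<open>The same iteration for \<open>m = m m c\<close>; with the exponent of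
    \<open>om m\<close> it displays \<open>m\<close> with an idempotent left factor.\<close>
  have 2: "m = pw m i \<cdot> m \<cdot> pw c i" for i
  proof (induction i)
    case (Suc i)
    have "m = pw m i \<cdot> (m \<cdot> m \<cdot> c) \<cdot> pw c i" using Suc c(2) by simp
    also have "\<dots> = pw m (Suc i) \<cdot> m \<cdot> pw c (Suc i)"
      using m c(1) pw_Suc2[OF m] by (simp add: assoc pw_Suc[of c])
    finally show ?case .
  qed (use m in simp)
  obtain n where n: "n \<ge> 1" "om m = pw m n" using omega_power[OF m] by blast
  show 3: "om m \<cdot> m = m"
    using 2[of n] n m c(1) idm_sq[OF omega_idm[OF m]] by (metis assoc closed pw_in)
  show "m \<cdot> om m = m" using 3 n pw_Suc2[OF m] pw_Suc[of m n] by simp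
qed

lemma J_omega: "m \<in> M \<Longrightarrow> J (om m) = J m"
proof
  assume m: "m \<in> M"
  show "J m \<subseteq> J (om m)" using J_mul1[of "om m" m] omega_absorb[OF m] m by simp
  obtain n where "n \<ge> 1" "om m = pw m n" using omega_power[OF m] by blast
  then obtain k where "om m = m \<cdot> pw m k" by (cases n) (auto simp: pw_Suc)
  then show "J (om m) \<subseteq> J m" using J_mul1[of m "pw m k"] m by simp
qed

lemma sigma_J: "m \<in> M \<Longrightarrow> sigma M mul uu m = J m"
  by (simp add: sigma_def J_omega)

text \<open>The square of \<open>x y\<close> is \<open>x (y x) y\<close>, and by \<open>J_sq\<close>
  squaring does not shrink the ideal.\<close>

lemma J_swap: "x \<in> M \<Longrightarrow> y \<in> M \<Longrightarrow> J (x \<cdot> y) \<subseteq> J (y \<cdot> x)"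
  using J_sq[of "x \<cdot> y"] J_leI[of x "y \<cdot> x" y "(x \<cdot> y) \<cdot> (x \<cdot> y)"] by (simp add: assoc)

text \<open>If \<open>z\<close> factors through \<open>x\<close> and through \<open>y\<close>, then
  \<open>z z\<close> has a factor \<open>y d a x\<close>, which rotates to a multiple of
  \<open>x y\<close>. So the ideal of a product is the meet of the ideals of its factors, and the
  elements on which an inflated module is supported contain a product exactly when they contain both
  factors.\<close>

lemma J_meet:
  assumes "x \<in> M" "y \<in> M" "z \<in> M" "J z \<subseteq> J x" "J z \<subseteq> J y"
  shows "J z \<subseteq> J (x \<cdot> y)"
proof -
  obtain a b where ab: "a \<in> M" "b \<in> M" "z = a \<cdot> x \<cdot> b" using assms J_le_iff[of x z] by auto
  obtain c d where cd: "c \<in> M" "d \<in> M" "z = c \<cdot> y \<cdot> d" using assms J_le_iff[of y z] by auto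
  have "J z \<subseteq> J (z \<cdot> z)" by (rule J_sq[OF assms(3)])
  also have "z \<cdot> z = c \<cdot> ((y \<cdot> (d \<cdot> a)) \<cdot> x) \<cdot> b"
    by (subst (1) cd(3), subst (1) ab(3)) (use ab(1,2) cd(1,2) assms in \<open>simp add: assoc\<close>)
  also have "J \<dots> \<subseteq> J ((y \<cdot> (d \<cdot> a)) \<cdot> x)"
    by (rule J_leI[of c _ b]) (use ab cd assms in simp_all)
  also have "\<dots> \<subseteq> J (x \<cdot> (y \<cdot> (d \<cdot> a)))"
    by (rule J_swap) (use ab cd assms in simp_all)
  also have "\<dots> \<subseteq> J (x \<cdot> y)"
    using J_mul1[of "x \<cdot> y" "d \<cdot> a"] ab cd assms by (simp add: assoc)
  finally show ?thesis .
qed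

lemma J_le_mul_iff:
  assumes "x \<in> M" "y \<in> M" "z \<in> M"
  shows "J z \<subseteq> J (x \<cdot> y) \<longleftrightarrow> J z \<subseteq> J x \<and> J z \<subseteq> J y"
  using J_meet[OF assms] J_mul1[OF assms(1,2)] J_mul2[OF assms(1,2)] by blast

lemma J_mul_eq:
  assumes "x \<in> M" "y \<in> M" "J x \<subseteq> J y"
  shows "J (x \<cdot> y) = J x" "J (y \<cdot> x) = J x"
  using J_mul1 J_mul2 J_meet assms by (meson subset_antisym order_refl)+

text \<open>In the finite monoid \<open>e M e\<close> one-sided inverses are two-sided. From
  \<open>e = a g b\<close> come \<open>p\<close> and \<open>q\<close> with \<open>p q = e\<close>; a
  power of \<open>p\<close> equals \<open>e\<close>, hence \<open>q p = e\<close>, and this writes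
  \<open>e\<close> as \<open>g\<close> times something.\<close>

lemma idm_J_minimal:
  assumes e: "idm e" and g: "idm g" "e \<cdot> g = g" "g \<cdot> e = g" and J: "J g = J e"
  shows "g = e"
proof -
  obtain a b where ab: "a \<in> M" "b \<in> M" "e = a \<cdot> g \<cdot> b" using J e g J_le_iff[of g e] by auto
  define p where "p = e \<cdot> a \<cdot> g"
  define q where "q = g \<cdot> b \<cdot> e"
  have M: "e \<in> M" "g \<in> M" "p \<in> M" "q \<in> M" using e g ab by (auto simp: p_def q_def)
  have pq: "p \<cdot> q = e"
  proof -
    have "p \<cdot> q = e \<cdot> (a \<cdot> (g \<cdot> g) \<cdot> b) \<cdot> e" using M ab(1,2) by (simp add: p_def q_def assoc)
    also have "\<dots> = e" using idm_sq[OF g(1)] ab(3) idm_sq[OF e] by simp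
    finally show ?thesis .
  qed
  have pe: "e \<cdot> p = p" using M ab(1,2) idm_sq[OF e] by (simp add: p_def flip: assoc)
  have eq: "e \<cdot> q = q" using M ab(1,2) g(2) by (simp add: q_def flip: assoc)
  have ppe: "p \<cdot> e = p" using M ab(1,2) g(3) by (simp add: p_def assoc)
  obtain n where n: "n \<ge> 1" "om p = pw p n" using omega_power[OF M(3)] by blast
  obtain k where k: "om p = pw p k \<cdot> p" using n pw_Suc2[OF M(3)] by (cases n) auto
  have "e = om p \<cdot> p \<cdot> q" using omega_absorb[OF M(3)] pq by simp
  also have "\<dots> = om p \<cdot> e" using pq M by (simp add: assoc)
  also have "\<dots> = om p" using k ppe M by (simp add: assoc)
  finally have e_om: "e = om p" .
  have "q = pw p k \<cdot> p \<cdot> q" using e_om k eq by simp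
  also have "\<dots> = pw p k \<cdot> e" using pq M by (simp add: assoc)
  finally have "q \<cdot> p = pw p k \<cdot> e \<cdot> p" by simp
  also have "\<dots> = e" using pe e_om k M by (simp add: assoc)
  finally have "e = g \<cdot> (b \<cdot> e \<cdot> p)" using M ab(1,2) by (simp add: q_def assoc)
  then have "g \<cdot> e = e" using M ab(1,2) idm_sq[OF g(1)] by (metis assoc closed)
  then show ?thesis using g(3) by simp
qed

text \<open>\<open>e f e\<close> is an idempotent below \<open>e\<close> with the ideal of
  \<open>e\<close>, so \<open>idm_J_minimal\<close> applies.\<close>

lemma rect_band:
  assumes "idm e" "idm f" "J e = J f"
  shows "e \<cdot> f \<cdot> e = e"
proof (rule idm_J_minimal[OF assms(1)])
  have M: "e \<in> M" "f \<in> M" using assms by auto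
  note ef = rect_closed[OF assms]
  have "J (e \<cdot> f \<cdot> e) = J (e \<cdot> f)" using J_mul_eq(1)[of "e \<cdot> f" e] ef M by simp
  then show "J (e \<cdot> f \<cdot> e) = J e" using ef by simp
  have "(e \<cdot> f \<cdot> e) \<cdot> (e \<cdot> f \<cdot> e) = (e \<cdot> f) \<cdot> (e \<cdot> e) \<cdot> f \<cdot> e" using M by (simp add: assoc)
  also have "\<dots> = ((e \<cdot> f) \<cdot> (e \<cdot> f)) \<cdot> e" using M idm_sq[OF assms(1)] by (simp add: assoc)
  also have "\<dots> = e \<cdot> f \<cdot> e" using idm_sq[OF ef(1)] by simp
  finally show "idm (e \<cdot> f \<cdot> e)" using M by (simp add: idem_def)
  show "e \<cdot> (e \<cdot> f \<cdot> e) = e \<cdot> f \<cdot> e" using M idm_sq[OF assms(1)] by (simp flip: assoc)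
  show "e \<cdot> f \<cdot> e \<cdot> e = e \<cdot> f \<cdot> e" using M idm_sq[OF assms(1)] by (simp add: assoc)
qed

text \<open>The law of rectangular bands: in \<open>x z\<close> expand \<open>x\<close> to
  \<open>x (y z) x\<close>, then contract \<open>z x z\<close> to \<open>z\<close>.\<close>

lemma rect_band3:
  assumes "idm x" "idm y" "idm z" "J x = J z" "J y = J z"
  shows "x \<cdot> y \<cdot> z = x \<cdot> z"
proof -
  have M: "x \<in> M" "y \<in> M" "z \<in> M" using assms by auto
  have yz: "idm (y \<cdot> z)" "J (y \<cdot> z) = J z" using rect_closed[OF assms(2,3)] assms(5) by auto
  have "x \<cdot> z = (x \<cdot> (y \<cdot> z) \<cdot> x) \<cdot> z" using rect_band[OF assms(1) yz(1)] yz assms by simp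
  also have "\<dots> = (x \<cdot> y) \<cdot> (z \<cdot> x \<cdot> z)" using M by (simp add: assoc)
  also have "\<dots> = x \<cdot> y \<cdot> z" using rect_band[OF assms(3,1)] assms by simp
  finally show ?thesis by simp
qed

text \<open>The factor \<open>e\<close> is deleted between the idempotents \<open>om a\<close> and
  \<open>om b\<close>, which \<open>a\<close> and \<open>b\<close> absorb.\<close>

lemma rect_mul:
  assumes "idm e" "a \<in> M" "b \<in> M" "J a = J e" "J b = J e"
  shows "a \<cdot> e \<cdot> b = a \<cdot> b"
proof -
  have M: "e \<in> M" "om a \<in> M" "om b \<in> M" using assms by auto
  have "a \<cdot> e \<cdot> b = (a \<cdot> om a) \<cdot> e \<cdot> (om b \<cdot> b)" using omega_absorb assms by simp
  also have "\<dots> = a \<cdot> (om a \<cdot> e \<cdot> om b) \<cdot> b" using M assms by (simp add: assoc)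
  also have "om a \<cdot> e \<cdot> om b = om a \<cdot> om b"
    by (rule rect_band3) (use assms J_omega in auto)
  also have "a \<cdot> (om a \<cdot> om b) \<cdot> b = (a \<cdot> om a) \<cdot> (om b \<cdot> b)" using M assms by (simp add: assoc)
  also have "\<dots> = a \<cdot> b" using omega_absorb assms by simp
  finally show ?thesis .
qed

text \<open>Both \<open>e m\<close> and \<open>n e\<close> have the ideal of \<open>e\<close>, so by
  \<open>rect_mul\<close> a factor \<open>e\<close> may be inserted between them.\<close>

lemma local_hom:
  assumes "idm e" "m \<in> M" "n \<in> M" "J e \<subseteq> J m" "J e \<subseteq> J n"
  shows "e \<cdot> m \<cdot> n \<cdot> e = (e \<cdot> m \<cdot> e) \<cdot> (e \<cdot> n \<cdot> e)"
proof -
  have "(e \<cdot> m) \<cdot> e \<cdot> (n \<cdot> e) = (e \<cdot> m) \<cdot> (n \<cdot> e)"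
    by (rule rect_mul) (use assms J_mul_eq[of e] in simp_all)
  moreover have "(e \<cdot> m \<cdot> e) \<cdot> (e \<cdot> n \<cdot> e) = (e \<cdot> m) \<cdot> (e \<cdot> e) \<cdot> (n \<cdot> e)"
    using assms by (simp add: assoc)
  ultimately show ?thesis using assms idm_sq[OF assms(1)] by (simp add: assoc)
qed

text \<open>If \<open>g\<close> has the ideal of \<open>e\<close>, then \<open>om g\<close> is an
  idempotent of the corner with that same ideal, hence equals \<open>e\<close>, and a power of
  \<open>g\<close> inverts it. Units are thereby traded for a condition on ideals, which is easy to
  check for products.\<close>

lemma Gp_iff:
  assumes e: "idm e"
  shows "g \<in> Gp M mul e \<longleftrightarrow> g \<in> M \<and> e \<cdot> g = g \<and> g \<cdot> e = g \<and> J g = J e"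
proof
  assume "g \<in> Gp M mul e"
  then obtain h where g: "g \<in> M" "e \<cdot> g = g" "g \<cdot> e = g" and h: "h \<in> M" "g \<cdot> h = e"
    unfolding Gp_def using corner_iff[OF e] by blast
  have "J g = J e" using J_mul1[of g h] J_mul1[of e g] g h e by auto
  then show "g \<in> M \<and> e \<cdot> g = g \<and> g \<cdot> e = g \<and> J g = J e" using g by blast
next
  assume g: "g \<in> M \<and> e \<cdot> g = g \<and> g \<cdot> e = g \<and> J g = J e"
  then have gc: "g \<in> corner M mul e" using corner_iff[OF e] by blast
  obtain n where n: "n \<ge> 1" "om g = pw g n" using omega_power g by blast
  have "om g \<in> corner M mul e" using n corner_pw[OF e gc] by simp
  then have om: "om g = e"
    by (intro idm_J_minimal[OF e]) (use g J_omega corner_iff[OF e] in auto)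
  \<comment> \<open>The exponent is doubled so that it is at least 2: the inverse
    \<open>pw g (Suc k)\<close> has to be a positive power, because \<open>pw g 0 = uu\<close> need
    not lie in the corner.\<close>
  then have "pw g (n + n) = e" using n g pw_add idm_sq[OF e] by simp
  moreover obtain k where k: "n + n = Suc (Suc k)" using n(1) by (metis Suc_le_D add_Suc_right add_Suc One_nat_def)
  ultimately have "g \<cdot> pw g (Suc k) = e" "pw g (Suc k) \<cdot> g = e"
    using g pw_Suc pw_Suc2 by metis+
  moreover have "pw g (Suc k) \<in> corner M mul e" by (rule corner_pw[OF e gc]) simp
  ultimately show "g \<in> Gp M mul e" unfolding Gp_def using gc by blast
qed

lemma ginv_unique:
  assumes e: "idm e" and h: "h \<in> corner M mul e" "g \<cdot> h = e" "h \<cdot> g = e" and g: "g \<in> corner M mul e"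
  shows "ginv M mul e g = h"
  unfolding ginv_def
proof (rule the_equality)
  show "h \<in> corner M mul e \<and> g \<cdot> h = e \<and> h \<cdot> g = e" using h by blast
  fix k assume k: "k \<in> corner M mul e \<and> g \<cdot> k = e \<and> k \<cdot> g = e"
  have "k = (h \<cdot> g) \<cdot> k" using k h corner_iff[OF e] by simp
  also have "\<dots> = h \<cdot> (g \<cdot> k)" by (rule assoc) (use k h(1) g corner_iff[OF e] in auto)
  also have "\<dots> = h" using k h corner_iff[OF e] by simp
  finally show "k = h" .
qed

lemma ginv:
  assumes e: "idm e" and g: "g \<in> Gp M mul e"
  shows ginv_in [simp]: "ginv M mul e g \<in> Gp M mul e"
    and ginv_right: "g \<cdot> ginv M mul e g = e" and ginv_left: "ginv M mul e g \<cdot> g = e"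
proof -
  obtain h where h: "g \<in> corner M mul e" "h \<in> corner M mul e" "g \<cdot> h = e" "h \<cdot> g = e"
    using g unfolding Gp_def by blast
  then have "ginv M mul e g = h" using ginv_unique[OF e] by blast
  then show "ginv M mul e g \<in> Gp M mul e" "g \<cdot> ginv M mul e g = e" "ginv M mul e g \<cdot> g = e"
    using h unfolding Gp_def by auto
qed

lemma Gp_in: "idm e \<Longrightarrow> g \<in> Gp M mul e \<Longrightarrow> g \<in> M"
  by (simp add: Gp_iff)

lemma Gp_one [simp]: "idm e \<Longrightarrow> e \<in> Gp M mul e"
  by (simp add: Gp_iff idm_sq)

lemma Gp_mul [simp]:
  assumes "idm e" "g \<in> Gp M mul e" "h \<in> Gp M mul e"
  shows "g \<cdot> h \<in> Gp M mul e"
proof -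
  have "J (g \<cdot> h) = J e" using assms J_mul_eq(1)[of g h] by (simp add: Gp_iff)
  moreover have "e \<cdot> (g \<cdot> h) = g \<cdot> h" "g \<cdot> h \<cdot> e = g \<cdot> h"
    using assms Gp_iff[OF assms(1)] idm_in[OF assms(1)] assoc by metis+
  ultimately show ?thesis using assms by (simp add: Gp_iff)
qed

lemma finite_Gp: "idm e \<Longrightarrow> finite (Gp M mul e)"
  by (rule finite_subset[OF _ fin]) (auto simp: Gp_iff)

lemma ginv_mul:
  assumes e: "idm e" and g: "g \<in> Gp M mul e" "h \<in> Gp M mul e"
  shows "ginv M mul e (g \<cdot> h) = ginv M mul e h \<cdot> ginv M mul e g"
proof (rule ginv_unique[OF e])
  let ?g = "ginv M mul e g" and ?h = "ginv M mul e h"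
  have M: "g \<in> M" "h \<in> M" "?g \<in> M" "?h \<in> M" "e \<in> M" using ginv_in[OF e] g Gp_in[OF e] e by auto
  have "g \<cdot> h \<cdot> (?h \<cdot> ?g) = g \<cdot> (h \<cdot> ?h) \<cdot> ?g" using M by (simp add: assoc)
  also have "\<dots> = e" using ginv_right[OF e] g Gp_iff[OF e] by simp
  finally show "g \<cdot> h \<cdot> (?h \<cdot> ?g) = e" .
  have "?h \<cdot> ?g \<cdot> (g \<cdot> h) = ?h \<cdot> (?g \<cdot> g) \<cdot> h" using M by (simp add: assoc)
  also have "\<dots> = e" using ginv_left[OF e] ginv_in[OF e] g Gp_iff[OF e] by simp
  finally show "?h \<cdot> ?g \<cdot> (g \<cdot> h) = e" .
  have "?h \<cdot> ?g \<in> Gp M mul e" "g \<cdot> h \<in> Gp M mul e" using e g by simp_all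
  then show "?h \<cdot> ?g \<in> corner M mul e" "g \<cdot> h \<in> corner M mul e" unfolding Gp_def by auto
qed

lemma ginv_ginv:
  assumes e: "idm e" and g: "g \<in> Gp M mul e"
  shows "ginv M mul e (ginv M mul e g) = g"
  by (rule ginv_unique[OF e]) (use ginv[OF e g] g in \<open>auto simp: Gp_def\<close>)

lemma ginv_one: "idm e \<Longrightarrow> ginv M mul e e = e"
  by (rule ginv_unique) (auto simp: corner_iff idm_sq)

lemma local_Gp:
  assumes e: "idm e" "m \<in> M" "J e \<subseteq> J m"
  shows "e \<cdot> m \<cdot> e \<in> Gp M mul e"
proof -
  have "J (e \<cdot> m \<cdot> e) = J e" using assms J_mul_eq[of e m] J_mul_eq(1)[of "e \<cdot> m" e] by simp
  moreover have "e \<cdot> (e \<cdot> m \<cdot> e) = e \<cdot> m \<cdot> e" "e \<cdot> m \<cdot> e \<cdot> e = e \<cdot> m \<cdot> e"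
    using assms idm_sq[OF e(1)] idm_in[OF e(1)] by (metis assoc closed)+
  ultimately show ?thesis using assms by (simp add: Gp_iff)
qed

text \<open>A group has a single idempotent. This is why an idempotent above \<open>e\<close> acts
  as the identity on every module inflated from \<open>e\<close>.\<close>

lemma local_Gp_idm:
  assumes e: "idm e" and m: "idm m" "J e \<subseteq> J m"
  shows "e \<cdot> m \<cdot> e = e"
proof -
  let ?g = "e \<cdot> m \<cdot> e"
  have g: "?g \<in> Gp M mul e" using local_Gp assms by simp
  have M: "e \<in> M" "m \<in> M" using assms by auto
  have "?g \<cdot> ?g = e \<cdot> m \<cdot> m \<cdot> e" using local_hom[OF e M(2,2) m(2,2)] by simp
  also have "\<dots> = e \<cdot> (m \<cdot> m) \<cdot> e" using M by (simp add: assoc)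
  also have "\<dots> = ?g" using idm_sq[OF m(1)] by simp
  finally have "idm ?g" using M by (simp add: idem_def)
  then show ?thesis using g idm_J_minimal[OF e] Gp_iff[OF e] by auto
qed

text \<open>Equal two-sided ideals suffice for equal left ideals inside \<open>M e\<close>: the law
  \<open>e (om x) e = e\<close> exhibits \<open>e\<close> as a left multiple of
  \<open>x\<close>.\<close>

lemma Lcl_iff:
  assumes e: "idm e"
  shows "x \<in> Lcl M mul e \<longleftrightarrow> x \<in> M \<and> x \<cdot> e = x \<and> J x = J e"
proof
  assume "x \<in> Lcl M mul e"
  then have x: "x \<in> M" "leftideal M mul x = leftideal M mul e" by (auto simp: Lcl_def)
  have "x \<in> leftideal M mul x" "e \<in> leftideal M mul e"
    using x(1) idm_in[OF e] unfolding leftideal_def by (intro CollectI exI[of _ uu]; simp)+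
  then obtain a b where ab: "a \<in> M" "b \<in> M" "x = a \<cdot> e" "e = b \<cdot> x"
    using x(2) unfolding leftideal_def by blast
  have "x \<cdot> e = a \<cdot> (e \<cdot> e)" using ab(1,3) e by (simp add: assoc)
  then have "x \<cdot> e = x" using ab(3) idm_sq[OF e] by simp
  moreover have "J x \<subseteq> J e" using J_mul2[of a e] ab(1,3) e by simp
  moreover have "J e \<subseteq> J x" using J_mul2[of b x] ab(2,4) x(1) by simp
  ultimately show "x \<in> M \<and> x \<cdot> e = x \<and> J x = J e" using x by blast
next
  assume x: "x \<in> M \<and> x \<cdot> e = x \<and> J x = J e"
  have M: "e \<in> M" "om x \<in> M" "x \<in> M" using x e by auto
  obtain n where n: "n \<ge> 1" "om x = pw x n" using omega_power x by blast
  then obtain k where k: "om x = pw x k \<cdot> x" using pw_Suc2[of x] x by (cases n) auto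
  then have "om x \<cdot> e = om x" using x M by (simp add: assoc)
  moreover have "e \<cdot> om x \<cdot> e = e" by (rule rect_band) (use x e J_omega in auto)
  ultimately have e_eq: "e = (e \<cdot> pw x k) \<cdot> x" using k M by (simp add: assoc)
  have "leftideal M mul x = leftideal M mul e"
  proof (intro equalityI subsetI)
    fix y assume "y \<in> leftideal M mul x"
    then obtain a where "a \<in> M" "y = a \<cdot> x" unfolding leftideal_def by blast
    then have "y = (a \<cdot> x) \<cdot> e" "a \<cdot> x \<in> M" using x M by (simp_all add: assoc)
    then show "y \<in> leftideal M mul e" unfolding leftideal_def by blast
  next
    fix y assume "y \<in> leftideal M mul e"
    then obtain a where a: "a \<in> M" "y = a \<cdot> e" unfolding leftideal_def by blast
    have "y = a \<cdot> ((e \<cdot> pw x k) \<cdot> x)" using a e_eq by simp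
    also have "\<dots> = (a \<cdot> (e \<cdot> pw x k)) \<cdot> x" using a M by (simp add: assoc)
    finally show "y \<in> leftideal M mul x" using a M unfolding leftideal_def by auto
  qed
  then show "x \<in> Lcl M mul e" using x by (simp add: Lcl_def)
qed

end

section \<open>Representations of finite groups\<close>

text \<open>A linear map to \<open>k\<^sup>n\<close> is encoded as a scalar function of pairs (vector, coordinate),
  which makes all spaces of maps instances of one vector space of functions.\<close>
definition homs :: "'g set \<Rightarrow> ('g \<Rightarrow> ('b \<Rightarrow> 'k::field) \<Rightarrow> ('b \<Rightarrow> 'k)) \<Rightarrow> nat \<Rightarrow> ('g \<Rightarrow> 'k mat)
    \<Rightarrow> ('b \<Rightarrow> 'k) set \<Rightarrow> (('b \<Rightarrow> 'k) \<times> nat \<Rightarrow> 'k) set" where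
  "homs G a n \<rho> W = {\<psi>. (\<forall>v i. v \<notin> W \<or> n \<le> i \<longrightarrow> \<psi> (v, i) = 0)
     \<and> (\<forall>v\<in>W. \<forall>w\<in>W. \<forall>i. \<psi> (v + w, i) = \<psi> (v, i) + \<psi> (w, i))
     \<and> (\<forall>c. \<forall>v\<in>W. \<forall>i. \<psi> (vscale c v, i) = c * \<psi> (v, i))
     \<and> (\<forall>g\<in>G. \<forall>v\<in>W. \<forall>i<n. \<psi> (a g v, i) = (\<Sum>j<n. \<rho> g $$ (i, j) * \<psi> (v, j)))}"

text \<open>Burnside's form of absolute irreducibility: the operators of \<open>G\<close> span the
  full matrix algebra. In this form the property passes directly to duals and tensor
  products.\<close>

definition matrix_units_in_span :: "'g set \<Rightarrow> nat \<Rightarrow> ('g \<Rightarrow> 'k::field mat) \<Rightarrow> bool" where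
  "matrix_units_in_span G n \<rho> \<longleftrightarrow> (\<forall>p<n. \<forall>q<n. \<exists>c. \<forall>i<n. \<forall>j<n.
     (\<Sum>g\<in>G. c g * \<rho> g $$ (i, j)) = (if i = p \<and> j = q then 1 else 0))"

text \<open>For a permutation action \<open>p\<close> on \<open>X\<close> this is the space of
  equivariant maps from the permutation module kX to k^n, a map being recorded by its values on the
  basis \<open>X\<close>.\<close>

definition equivariant_funs :: "'g set \<Rightarrow> 'b set \<Rightarrow> ('g \<Rightarrow> 'b \<Rightarrow> 'b) \<Rightarrow> nat \<Rightarrow> ('g \<Rightarrow> 'k::field mat)
    \<Rightarrow> ('b \<times> nat \<Rightarrow> 'k) set" where
  "equivariant_funs G X p n \<rho> = {F. (\<forall>c i. c \<notin> X \<or> n \<le> i \<longrightarrow> F (c, i) = 0)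
     \<and> (\<forall>g\<in>G. \<forall>c\<in>X. \<forall>i<n. F (p g c, i) = (\<Sum>j<n. \<rho> g $$ (i, j) * F (c, j)))}"

lemma subspace_homs: "V.subspace (homs G a n \<rho> W)"
  unfolding V.subspace_def
proof (intro conjI ballI allI)
  show "0 \<in> homs G a n \<rho> W" by (simp add: homs_def)
next
  fix \<psi> \<psi>' assume "\<psi> \<in> homs G a n \<rho> W" "\<psi>' \<in> homs G a n \<rho> W"
  then show "\<psi> + \<psi>' \<in> homs G a n \<rho> W"
    by (simp add: homs_def algebra_simps sum.distrib)
next
  fix c \<psi> assume "\<psi> \<in> homs G a n \<rho> W"
  then show "vscale c \<psi> \<in> homs G a n \<rho> W"
    by (simp add: homs_def vscale_def algebra_simps sum_distrib_left)
qed

lemma subspace_equivariant_funs: "V.subspace (equivariant_funs G X p n \<rho>)"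
  unfolding V.subspace_def
proof (intro conjI ballI allI)
  show "0 \<in> equivariant_funs G X p n \<rho>" by (simp add: equivariant_funs_def)
next
  fix F F' assume "F \<in> equivariant_funs G X p n \<rho>" "F' \<in> equivariant_funs G X p n \<rho>"
  then show "F + F' \<in> equivariant_funs G X p n \<rho>"
    by (simp add: equivariant_funs_def algebra_simps sum.distrib)
next
  fix c F assume "F \<in> equivariant_funs G X p n \<rho>"
  then show "vscale c F \<in> equivariant_funs G X p n \<rho>"
    by (simp add: equivariant_funs_def vscale_def algebra_simps sum_distrib_left)
qed

lemma equivariant_funs_support:
  "equivariant_funs G X p n \<rho> \<subseteq> {F. \<forall>s. s \<notin> X \<times> {..<n} \<longrightarrow> F s = 0}"
  by (auto simp: equivariant_funs_def not_less)

lemma fin_dim_equivariant_funs: "finite X \<Longrightarrow> fin_dim vscale (equivariant_funs G X p n \<rho>)"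
  by (rule VS.fin_dim_subset[OF fin_dim_finite_support equivariant_funs_support]) simp

lemma mrep_entry:
  assumes "mrep G m u n \<rho>" "g \<in> G" "h \<in> G" "i < n" "k < n"
  shows "\<rho> (m g h) $$ (i, k) = (\<Sum>j<n. \<rho> g $$ (i, j) * \<rho> h $$ (j, k))"
proof -
  have "\<rho> g \<in> carrier_mat n n" "\<rho> h \<in> carrier_mat n n" "\<rho> (m g h) = \<rho> g * \<rho> h"
    using assms unfolding mrep_def by auto
  then show ?thesis using assms(4,5) by (simp add: scalar_prod_def lessThan_atLeast0)
qed

lemma fin_dim_singleton: "fin_dim vscale {0}"
  unfolding fin_dim_def using V.span_base by blast

lemma dim_zero: "V.dim {0} = 0"
  using V.basis_card_eq_dim[of "{}" "{0}"] V.independent_empty by simp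

lemma sum_rotate: "(\<Sum>c\<in>A. \<Sum>i\<in>B. \<Sum>g\<in>C. f c i g) = (\<Sum>g\<in>C. \<Sum>c\<in>A. \<Sum>i\<in>B. f c i g)"
proof -
  have "(\<Sum>i\<in>B. \<Sum>g\<in>C. f c i g) = (\<Sum>g\<in>C. \<Sum>i\<in>B. f c i g)" for c by (rule sum.swap)
  then have "(\<Sum>c\<in>A. \<Sum>i\<in>B. \<Sum>g\<in>C. f c i g) = (\<Sum>c\<in>A. \<Sum>g\<in>C. \<Sum>i\<in>B. f c i g)" by simp
  also have "\<dots> = (\<Sum>g\<in>C. \<Sum>c\<in>A. \<Sum>i\<in>B. f c i g)" by (rule sum.swap)
  finally show ?thesis .
qed

lemma sum_delta_left:
  fixes x :: "nat \<Rightarrow> 'k::field"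
  shows "i < n \<Longrightarrow> (\<Sum>j<n. (if i = j then 1 else 0) * x j) = x i"
  by (subst sum.cong[of _ _ _ "\<lambda>j. if i = j then x j else 0"]) auto

section \<open>Averaging over a finite group\<close>

locale fgrp =
  fixes G :: "'g set" and m :: "'g \<Rightarrow> 'g \<Rightarrow> 'g" and u :: 'g and iv :: "'g \<Rightarrow> 'g"
  assumes finG: "finite G"
    and m_in [simp]: "g \<in> G \<Longrightarrow> h \<in> G \<Longrightarrow> m g h \<in> G"
    and u_in [simp]: "u \<in> G" and iv_in [simp]: "g \<in> G \<Longrightarrow> iv g \<in> G"
    and m_assoc: "g \<in> G \<Longrightarrow> h \<in> G \<Longrightarrow> k \<in> G \<Longrightarrow> m (m g h) k = m g (m h k)"
    and m_u_left [simp]: "g \<in> G \<Longrightarrow> m u g = g" and m_u_right [simp]: "g \<in> G \<Longrightarrow> m g u = g"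
    and iv_left [simp]: "g \<in> G \<Longrightarrow> m (iv g) g = u" and iv_right [simp]: "g \<in> G \<Longrightarrow> m g (iv g) = u"
    and iv_mul: "g \<in> G \<Longrightarrow> h \<in> G \<Longrightarrow> iv (m g h) = m (iv h) (iv g)"
    and iv_iv [simp]: "g \<in> G \<Longrightarrow> iv (iv g) = g"
begin

lemma sum_translate:
  assumes h: "h \<in> G"
  shows "(\<Sum>g\<in>G. f (m g h)) = (\<Sum>g\<in>G. f g)"
  by (rule sum.reindex_bij_witness[where i = "\<lambda>g. m g (iv h)" and j = "\<lambda>g. m g h"])
    (use h in \<open>auto simp: m_assoc\<close>)

end

locale fgrp_rep = fgrp G m u iv for G :: "'g set" and m u iv +
  fixes n :: nat and \<rho> :: "'g \<Rightarrow> 'k::field mat"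
  assumes cardG: "of_nat (card G) \<noteq> (0::'k)" and rep: "mrep G m u n \<rho>"
begin

lemma rep_entry: "g \<in> G \<Longrightarrow> h \<in> G \<Longrightarrow> i < n \<Longrightarrow> k < n \<Longrightarrow>
    \<rho> (m g h) $$ (i, k) = (\<Sum>j<n. \<rho> g $$ (i, j) * \<rho> h $$ (j, k))"
  by (rule mrep_entry[OF rep])

lemma rep_u: "i < n \<Longrightarrow> j < n \<Longrightarrow> \<rho> u $$ (i, j) = (if i = j then 1 else 0)"
  using rep unfolding mrep_def by simp

lemma rep_apply2:
  assumes "g \<in> G" "h \<in> G" "i < n"
  shows "(\<Sum>j<n. \<rho> g $$ (i, j) * (\<Sum>k<n. \<rho> h $$ (j, k) * x k)) = (\<Sum>k<n. \<rho> (m g h) $$ (i, k) * x k)"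
proof -
  have "(\<Sum>j<n. \<rho> g $$ (i, j) * (\<Sum>k<n. \<rho> h $$ (j, k) * x k))
      = (\<Sum>k<n. \<Sum>j<n. \<rho> g $$ (i, j) * \<rho> h $$ (j, k) * x k)"
    by (subst sum.swap) (simp add: sum_distrib_left mult.assoc)
  also have "\<dots> = (\<Sum>k<n. \<rho> (m g h) $$ (i, k) * x k)"
    by (intro sum.cong) (use assms in \<open>simp_all add: rep_entry sum_distrib_right\<close>)
  finally show ?thesis .
qed

lemma rep_apply_u:
  assumes "i < n"
  shows "(\<Sum>k<n. \<rho> u $$ (i, k) * x k) = x i"
proof -
  have "(\<Sum>k<n. \<rho> u $$ (i, k) * x k) = (\<Sum>k<n. (if i = k then 1 else 0) * x k)"
    by (rule sum.cong) (use assms in \<open>simp_all add: rep_u\<close>)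
  then show ?thesis using sum_delta_left[OF assms] by simp
qed

text \<open>Averaging \<open>\<delta>\<^sub>c\<^sub>,\<^sub>i\<close> over \<open>G\<close> produces enough equivariant functions for the dual
  representation to make the standard pairing nondegenerate.\<close>
lemma dim_equivariant_funs_le_dual:
  assumes X: "finite X" and p: "\<And>g c. g \<in> G \<Longrightarrow> c \<in> X \<Longrightarrow> p g c \<in> X"
    and p_m: "\<And>g h c. g \<in> G \<Longrightarrow> h \<in> G \<Longrightarrow> c \<in> X \<Longrightarrow> p (m g h) c = p g (p h c)"
    and p_u: "\<And>c. c \<in> X \<Longrightarrow> p u c = c"
    and dual: "\<And>g i j. g \<in> G \<Longrightarrow> i < n \<Longrightarrow> j < n \<Longrightarrow> \<rho>' g $$ (i, j) = \<rho> (iv g) $$ (j, i)"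
  shows "V.dim (equivariant_funs G X p n \<rho>) \<le> V.dim (equivariant_funs G X p n \<rho>')"
proof (rule dim_le_pairing[where S = "X \<times> {..<n}"])
  show "finite (X \<times> {..<n})" using X by simp
  fix F assume F: "F \<in> equivariant_funs G X p n \<rho>"
    and orth: "\<And>w. w \<in> equivariant_funs G X p n \<rho>' \<Longrightarrow> (\<Sum>s\<in>X \<times> {..<n}. F s * w s) = 0"
  have "F (c0, i0) = 0" if c0: "c0 \<in> X" "i0 < n" for c0 i0
  proof -
    define w where "w = (\<lambda>(c, i). if c \<in> X \<and> i < n
        then \<Sum>g\<in>G. (if p g c = c0 then \<rho> g $$ (i0, i) else 0) else 0)"
    have "w \<in> equivariant_funs G X p n \<rho>'"
      unfolding equivariant_funs_def
    proof (intro CollectI conjI allI impI ballI)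
      fix c i assume "c \<notin> X \<or> n \<le> i"
      then show "w (c, i) = 0" by (auto simp: w_def)
    next
      fix h c i assume h: "h \<in> G" and c: "c \<in> X" and i: "i < n"
      have "w (p h c, i) = (\<Sum>g\<in>G. (if p (m g h) c = c0 then \<rho> (m (m g h) (iv h)) $$ (i0, i) else 0))"
      proof -
        have "m (m g h) (iv h) = g" if "g \<in> G" for g using that h by (simp add: m_assoc)
        then show ?thesis using h c i p by (auto simp: w_def p_m intro!: sum.cong)
      qed
      also have "\<dots> = (\<Sum>g\<in>G. (if p g c = c0 then \<rho> (m g (iv h)) $$ (i0, i) else 0))"
        by (rule sum_translate[OF h, where f = "\<lambda>g. if p g c = c0 then \<rho> (m g (iv h)) $$ (i0, i) else 0"])
      also have "\<dots> = (\<Sum>g\<in>G. \<Sum>j<n. (if p g c = c0 then \<rho> g $$ (i0, j) else 0) * \<rho> (iv h) $$ (j, i))"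
        by (intro sum.cong) (use h i c0 in \<open>auto simp: rep_entry\<close>)
      also have "\<dots> = (\<Sum>j<n. \<rho>' h $$ (i, j) * w (c, j))"
        by (subst sum.swap) (use h i c in \<open>simp add: w_def dual sum_distrib_left mult.commute\<close>)
      finally show "w (p h c, i) = (\<Sum>j<n. \<rho>' h $$ (i, j) * w (c, j))" .
    qed
    then have "0 = (\<Sum>s\<in>X \<times> {..<n}. F s * w s)" using orth by simp
    also have "\<dots> = (\<Sum>c\<in>X. \<Sum>i<n. F (c, i) * w (c, i))"
      by (simp add: sum.cartesian_product split_def)
    also have "\<dots> = (\<Sum>c\<in>X. \<Sum>i<n. \<Sum>g\<in>G. (if p g c = c0 then \<rho> g $$ (i0, i) * F (c, i) else 0))"
      by (intro sum.cong) (auto simp: w_def sum_distrib_left intro!: sum.cong)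
    also have "\<dots> = (\<Sum>g\<in>G. \<Sum>c\<in>X. \<Sum>i<n. (if p g c = c0 then \<rho> g $$ (i0, i) * F (c, i) else 0))"
      by (rule sum_rotate)
    \<comment> \<open>For each \<open>g\<close> only \<open>c = p (iv g) c0\<close> contributes, and
      equivariance of \<open>F\<close> turns its contribution into \<open>F (c0, i0)\<close>; the
      whole sum is the group order times that value.\<close>
    also have "\<dots> = (\<Sum>g\<in>G. \<Sum>c\<in>X. (if c = p (iv g) c0 then (\<Sum>i<n. \<rho> g $$ (i0, i) * F (c, i)) else 0))"
    proof (intro sum.cong refl)
      fix g c assume g: "g \<in> G" "c \<in> X"
      have "p g c = c0 \<longleftrightarrow> c = p (iv g) c0"
        using p_m[of "iv g" g c] p_m[of g "iv g" c0] g c0(1) p_u by auto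
      then show "(\<Sum>i<n. (if p g c = c0 then \<rho> g $$ (i0, i) * F (c, i) else 0))
          = (if c = p (iv g) c0 then (\<Sum>i<n. \<rho> g $$ (i0, i) * F (c, i)) else 0)" by simp
    qed
    also have "\<dots> = (\<Sum>g\<in>G. \<Sum>i<n. \<rho> g $$ (i0, i) * F (p (iv g) c0, i))"
      by (intro sum.cong) (use X p c0 in \<open>simp_all add: sum.delta\<close>)
    also have "\<dots> = (\<Sum>g\<in>G. F (c0, i0))"
    proof (intro sum.cong refl)
      fix g assume g: "g \<in> G"
      have "F (p g (p (iv g) c0), i0) = (\<Sum>i<n. \<rho> g $$ (i0, i) * F (p (iv g) c0, i))"
        using F g c0 p[of "iv g" c0] unfolding equivariant_funs_def by simp
      then show "(\<Sum>i<n. \<rho> g $$ (i0, i) * F (p (iv g) c0, i)) = F (c0, i0)"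
        using p_m[of g "iv g" c0] g c0(1) p_u by simp
    qed
    also have "\<dots> = of_nat (card G) * F (c0, i0)" by simp
    finally show "F (c0, i0) = 0" using cardG by simp
  qed
  then show "F = 0" using F by (auto simp: equivariant_funs_def fun_eq_iff not_less) (metis not_less)
qed (rule subspace_equivariant_funs equivariant_funs_support)+

end

section \<open>Composition multiplicities as dimensions of spaces of equivariant maps\<close>

locale fgrp_act = fgrp_rep G m u iv n \<rho> for G :: "'g set" and m u iv n and \<rho> :: "'g \<Rightarrow> 'k::field mat" +
  fixes a :: "'g \<Rightarrow> ('b \<Rightarrow> 'k) \<Rightarrow> ('b \<Rightarrow> 'k)" and V :: "('b \<Rightarrow> 'k) set"
  assumes subV: "V.subspace V" and finV: "fin_dim vscale V"
    and a_in: "g \<in> G \<Longrightarrow> v \<in> V \<Longrightarrow> a g v \<in> V"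
    and a_add: "g \<in> G \<Longrightarrow> v \<in> V \<Longrightarrow> w \<in> V \<Longrightarrow> a g (v + w) = a g v + a g w"
    and a_scale: "g \<in> G \<Longrightarrow> v \<in> V \<Longrightarrow> a g (vscale c v) = vscale c (a g v)"
    and a_m: "g \<in> G \<Longrightarrow> h \<in> G \<Longrightarrow> v \<in> V \<Longrightarrow> a (m g h) v = a g (a h v)"
    and a_u: "v \<in> V \<Longrightarrow> a u v = v"
begin

abbreviation "H \<equiv> homs G a n \<rho>"

text \<open>Maschke's theorem, phrased as extension of homomorphisms rather than existence of
  complements: compose \<open>\<psi>\<close> with a linear projection onto \<open>W1\<close> and
  average over \<open>G\<close>. On \<open>W1\<close> every term of the average already equals
  \<open>\<psi>\<close>.\<close>

lemma homs_extend:
  assumes W: "invsub G a W1" "invsub G a W2" "W1 \<subseteq> W2" "W2 \<subseteq> V" and \<psi>: "\<psi> \<in> H W1"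
  shows "\<exists>\<psi>'\<in>H W2. \<forall>v\<in>W1. \<forall>i. \<psi>' (v, i) = \<psi> (v, i)"
proof -
  have sub: "V.subspace W1" "V.subspace W2" using W by (auto simp: invsub_def fsub_iff_subspace)
  have inv: "\<And>g v. g \<in> G \<Longrightarrow> v \<in> W1 \<Longrightarrow> a g v \<in> W1" "\<And>g v. g \<in> G \<Longrightarrow> v \<in> W2 \<Longrightarrow> a g v \<in> W2"
    using W by (auto simp: invsub_def)
  obtain P where P: "range P \<subseteq> W1" "Vector_Spaces.linear vscale vscale P" "\<And>v. v \<in> W1 \<Longrightarrow> P v = v"
    using VV.linear_exists_left_inverse_on[OF V.linear_id sub(1)] by auto
  interpret P: Vector_Spaces.linear vscale vscale P by (rule P(2))
  have PW: "P v \<in> W1" for v using P(1) by blast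
  define \<chi> where "\<chi> v i = \<psi> (P v, i)" for v i
  have chi_add: "\<chi> (v + w) i = \<chi> v i + \<chi> w i" for v w i
    using \<psi> PW by (simp add: \<chi>_def P.add homs_def)
  have chi_scale: "\<chi> (vscale c v) i = c * \<chi> v i" for c v i
    using \<psi> PW by (simp add: \<chi>_def P.scale homs_def)
  define \<psi>' where "\<psi>' = (\<lambda>(v, i). if v \<in> W2 \<and> i < n then inverse (of_nat (card G)) *
     (\<Sum>g\<in>G. \<Sum>j<n. \<rho> (iv g) $$ (i, j) * \<chi> (a g v) j) else 0)"
  show ?thesis
  proof (intro bexI[of _ \<psi>'] ballI allI)
    fix v i assume v: "v \<in> W1"
    show "\<psi>' (v, i) = \<psi> (v, i)"
    proof (cases "i < n")
      case True
      have "(\<Sum>j<n. \<rho> (iv g) $$ (i, j) * \<chi> (a g v) j) = \<psi> (v, i)" if g: "g \<in> G" for g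
      proof -
        have "(\<Sum>j<n. \<rho> (iv g) $$ (i, j) * \<chi> (a g v) j)
            = (\<Sum>j<n. \<rho> (iv g) $$ (i, j) * (\<Sum>k<n. \<rho> g $$ (j, k) * \<psi> (v, k)))"
          using \<psi> g v P(3) inv(1) by (intro sum.cong) (auto simp: \<chi>_def homs_def)
        also have "\<dots> = \<psi> (v, i)" using g True by (simp add: rep_apply2 rep_apply_u)
        finally show ?thesis .
      qed
      then show ?thesis using v W(3) True cardG by (auto simp: \<psi>'_def)
    next
      case False
      then show ?thesis using \<psi> by (simp add: \<psi>'_def homs_def)
    qed
  next
    show "\<psi>' \<in> H W2"
      unfolding homs_def
    proof (intro CollectI conjI allI impI ballI)
      fix v i assume "v \<notin> W2 \<or> n \<le> i"
      then show "\<psi>' (v, i) = 0" by (auto simp: \<psi>'_def)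
    next
      fix v w i assume "v \<in> W2" "w \<in> W2"
      then show "\<psi>' (v + w, i) = \<psi>' (v, i) + \<psi>' (w, i)"
        using W(4) V.subspace_add[OF sub(2)]
        by (auto simp: \<psi>'_def a_add subset_iff chi_add algebra_simps sum.distrib)
    next
      fix c v i assume "v \<in> W2"
      then show "\<psi>' (vscale c v, i) = c * \<psi>' (v, i)"
        using W(4) V.subspace_scale[OF sub(2)]
        by (auto simp: \<psi>'_def a_scale subset_iff chi_scale sum_distrib_left mult.left_commute)
    next
      fix h v i assume h: "h \<in> G" and v: "v \<in> W2" and i: "i < n"
      have vV: "v \<in> V" using v W(4) by blast
      let ?f = "\<lambda>g. \<Sum>j<n. \<rho> (m h (iv g)) $$ (i, j) * \<chi> (a g v) j"
      have "(\<Sum>g\<in>G. \<Sum>j<n. \<rho> (iv g) $$ (i, j) * \<chi> (a g (a h v)) j) = (\<Sum>g\<in>G. ?f (m g h))"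
      proof (intro sum.cong refl)
        fix g j assume g: "g \<in> G"
        have "m h (iv (m g h)) = iv g" using g h by (simp add: iv_mul flip: m_assoc)
        then show "\<rho> (iv g) $$ (i, j) * \<chi> (a g (a h v)) j
            = \<rho> (m h (iv (m g h))) $$ (i, j) * \<chi> (a (m g h) v) j"
          using g h vV by (simp add: a_m)
      qed
      also have "\<dots> = (\<Sum>g\<in>G. ?f g)" by (rule sum_translate[OF h])
      also have "\<dots> = (\<Sum>g\<in>G. \<Sum>k<n. \<rho> h $$ (i, k) * (\<Sum>j<n. \<rho> (iv g) $$ (k, j) * \<chi> (a g v) j))"
        by (rule sum.cong[OF refl]) (use h i in \<open>simp add: rep_apply2\<close>)
      also have "\<dots> = (\<Sum>k<n. \<rho> h $$ (i, k) * (\<Sum>g\<in>G. \<Sum>j<n. \<rho> (iv g) $$ (k, j) * \<chi> (a g v) j))"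
        by (subst sum.swap) (simp add: sum_distrib_left)
      finally have "inverse (of_nat (card G)) *
          (\<Sum>g\<in>G. \<Sum>j<n. \<rho> (iv g) $$ (i, j) * \<chi> (a g (a h v)) j)
        = (\<Sum>k<n. \<rho> h $$ (i, k) * (inverse (of_nat (card G)) *
            (\<Sum>g\<in>G. \<Sum>j<n. \<rho> (iv g) $$ (k, j) * \<chi> (a g v) j)))"
        by (simp add: sum_distrib_left mult.left_commute)
      then show "\<psi>' (a h v, i) = (\<Sum>j<n. \<rho> h $$ (i, j) * \<psi>' (v, j))"
        using v i h inv(2) by (simp add: \<psi>'_def)
    qed
  qed
qed

lemma homs_0: "\<psi> \<in> H W \<Longrightarrow> 0 \<in> W \<Longrightarrow> \<psi> (0, i) = 0"
proof -
  assume "\<psi> \<in> H W" "0 \<in> W"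
  then have "\<psi> (vscale 0 0, i) = 0 * \<psi> (0, i)" unfolding homs_def by blast
  then show ?thesis by simp
qed

lemma homs_sum:
  assumes "\<psi> \<in> H W" "V.subspace W" "finite S" "\<And>s. s \<in> S \<Longrightarrow> f s \<in> W"
  shows "\<psi> (\<Sum>s\<in>S. vscale (c s) (f s), i) = (\<Sum>s\<in>S. c s * \<psi> (f s, i))"
  using assms(3,4)
proof (induction S rule: finite_induct)
  case empty
  show ?case unfolding sum.empty by (rule homs_0[OF assms(1) V.subspace_0[OF assms(2)]])
next
  case (insert x S)
  have "vscale (c x) (f x) \<in> W" "(\<Sum>s\<in>S. vscale (c s) (f s)) \<in> W"
    by (intro V.subspace_scale[OF assms(2)] V.subspace_sum[OF assms(2)] insert; simp)+
  then have "\<psi> (vscale (c x) (f x) + (\<Sum>s\<in>S. vscale (c s) (f s)), i)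
      = c x * \<psi> (f x, i) + (\<Sum>s\<in>S. c s * \<psi> (f s, i))"
    using assms(1) insert unfolding homs_def by simp
  then show ?case unfolding sum.insert[OF insert(1,2)] .
qed

lemma invsub_ker:
  assumes W: "invsub G a W" "W \<subseteq> V" and \<psi>: "\<psi> \<in> H W"
  shows "invsub G a {v \<in> W. \<forall>i. \<psi> (v, i) = 0}"
proof -
  have sub: "V.subspace W" using W by (auto simp: invsub_def fsub_iff_subspace)
  have "\<psi> (a g v, i) = 0" if "g \<in> G" "v \<in> W" "\<forall>i. \<psi> (v, i) = 0" for g v i
    using \<psi> that W(1) unfolding homs_def invsub_def by (cases "i < n") auto
  then show ?thesis using sub W(1) \<psi> homs_0[OF \<psi>]
    unfolding invsub_def fsub_def V.subspace_def by (auto simp: homs_def)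
qed


text \<open>The kernel is an invariant subspace between \<open>A\<close> and \<open>B\<close> and
  different from \<open>B\<close>; simplicity of the factor leaves only \<open>A\<close>.\<close>

lemma homs_ker_simple_step:
  assumes A: "invsub G a A" and B: "invsub G a B" "A \<subset> B" "B \<subseteq> V"
    and simple: "\<not> (\<exists>W. invsub G a W \<and> A \<subset> W \<and> W \<subset> B)"
    and \<psi>: "\<psi> \<in> H B" "\<forall>v\<in>A. \<forall>i. \<psi> (v, i) = 0" "\<psi> \<noteq> 0"
  shows "{v \<in> B. \<forall>i. \<psi> (v, i) = 0} = A"
proof -
  let ?W = "{v \<in> B. \<forall>i. \<psi> (v, i) = 0}"
  obtain v i where "\<psi> (v, i) \<noteq> 0" using \<psi>(3) by (auto simp: fun_eq_iff)
  then have "?W \<noteq> B" using \<psi>(1) unfolding homs_def by blast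
  moreover have "A \<subseteq> ?W" using \<psi>(2) B(2) by blast
  ultimately show ?thesis using simple invsub_ker[OF B(1,3) \<psi>(1)] by blast
qed

text \<open>Schur's lemma for the factor \<open>B/A\<close>. Surjectivity comes from the matrix
  units: the combination for position \<open>(p, q)\<close> sends a vector with nonzero coordinate
  \<open>q\<close> to a nonzero multiple of the unit vector \<open>p\<close>.\<close>

lemma factor_iso_of_hom:
  assumes A: "invsub G a A" and B: "invsub G a B" "A \<subset> B" "B \<subseteq> V"
    and simple: "\<not> (\<exists>W. invsub G a W \<and> A \<subset> W \<and> W \<subset> B)"
    and burnside: "matrix_units_in_span G n \<rho>"
    and \<psi>: "\<psi> \<in> H B" "\<forall>v\<in>A. \<forall>i. \<psi> (v, i) = 0" "\<psi> \<noteq> 0"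
  shows "factor_iso G a A B n \<rho>"
proof -
  have sub: "V.subspace B" using B by (auto simp: invsub_def fsub_iff_subspace)
  define \<phi> where "\<phi> v = vec n (\<lambda>i. \<psi> (v, i))" for v
  have phi0: "\<phi> v = 0\<^sub>v n \<longleftrightarrow> (\<forall>i. \<psi> (v, i) = 0)" for v
    using \<psi>(1) by (auto simp: \<phi>_def homs_def vec_eq_iff) (metis not_less)
  have ker: "{v \<in> B. \<phi> v = 0\<^sub>v n} = A"
    using homs_ker_simple_step[OF A B simple \<psi>] by (simp add: phi0)
  obtain v0 q where q: "\<psi> (v0, q) \<noteq> 0" using \<psi>(3) by (auto simp: fun_eq_iff)
  then have v0: "v0 \<in> B" "q < n" using \<psi>(1) unfolding homs_def by (auto simp: not_le[symmetric])
  have "y \<in> \<phi> ` B" if y: "y \<in> carrier_vec n" for y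
  proof -
    have "\<exists>c. \<forall>i<n. \<forall>j<n. (\<Sum>g\<in>G. c g * \<rho> g $$ (i, j)) = (if i = p \<and> j = q then 1 else 0)"
      if "p < n" for p using burnside that v0(2) unfolding matrix_units_in_span_def by blast
    then obtain c where c: "\<And>p i j. p < n \<Longrightarrow> i < n \<Longrightarrow> j < n \<Longrightarrow>
      (\<Sum>g\<in>G. c p g * \<rho> g $$ (i, j)) = (if i = p \<and> j = q then 1 else 0)" by metis
    define w where "w p = (\<Sum>g\<in>G. vscale (c p g) (a g v0))" for p
    have av0: "a g v0 \<in> B" if "g \<in> G" for g using B(1) that v0(1) by (auto simp: invsub_def)
    have wB: "w p \<in> B" for p
      unfolding w_def by (intro V.subspace_sum[OF sub] V.subspace_scale[OF sub] av0)
    have w: "\<psi> (w p, i) = (if i = p then \<psi> (v0, q) else 0)" if "p < n" "i < n" for p i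
    proof -
      have "\<psi> (w p, i) = (\<Sum>g\<in>G. c p g * \<psi> (a g v0, i))"
        unfolding w_def by (rule homs_sum[OF \<psi>(1) sub finG av0])
      also have "\<dots> = (\<Sum>g\<in>G. \<Sum>j<n. c p g * \<rho> g $$ (i, j) * \<psi> (v0, j))"
        by (rule sum.cong[OF refl])
          (use \<psi>(1) v0 that in \<open>simp add: homs_def sum_distrib_left mult.assoc\<close>)
      also have "\<dots> = (\<Sum>j<n. (\<Sum>g\<in>G. c p g * \<rho> g $$ (i, j)) * \<psi> (v0, j))"
        by (subst sum.swap) (simp add: sum_distrib_right)
      also have "\<dots> = (\<Sum>j<n. if j = q then (if i = p then \<psi> (v0, j) else 0) else 0)"
        by (intro sum.cong) (use that c in auto)
      also have "\<dots> = (if i = p then \<psi> (v0, q) else 0)" using v0(2) by simp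
      finally show ?thesis .
    qed
    define z where "z = (\<Sum>p<n. vscale (y $ p / \<psi> (v0, q)) (w p))"
    have zB: "z \<in> B"
      unfolding z_def by (intro V.subspace_sum[OF sub] V.subspace_scale[OF sub] wB)
    have "\<psi> (z, i) = y $ i" if i: "i < n" for i
    proof -
      have "\<psi> (z, i) = (\<Sum>p<n. y $ p / \<psi> (v0, q) * \<psi> (w p, i))"
        unfolding z_def by (rule homs_sum[OF \<psi>(1) sub finite_lessThan wB])
      also have "\<dots> = (\<Sum>p<n. if p = i then y $ p else 0)"
        by (intro sum.cong) (use i q in \<open>auto simp: w\<close>)
      also have "\<dots> = y $ i" using i by simp
      finally show ?thesis .
    qed
    then have "\<phi> z = y" using y unfolding \<phi>_def by (intro eq_vecI) auto
    then show ?thesis using zB by blast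
  qed
  then have surj: "\<phi> ` B = carrier_vec n" by (auto simp: \<phi>_def)
  have rho: "\<rho> g \<in> carrier_mat n n" if "g \<in> G" for g using rep that unfolding mrep_def by blast
  show ?thesis
    unfolding factor_iso_def
  proof (intro exI[of _ \<phi>] conjI ballI allI)
    fix g v assume g: "g \<in> G" and v: "v \<in> B"
    show "\<phi> (a g v) = \<rho> g *\<^sub>v \<phi> v"
      by (rule eq_vecI) (use rho[OF g] \<psi>(1) g v in
        \<open>auto simp: \<phi>_def homs_def scalar_prod_def lessThan_atLeast0\<close>)
  qed (use surj ker \<psi>(1) in \<open>auto simp: \<phi>_def homs_def intro!: eq_vecI\<close>)
qed

text \<open>Restriction from \<open>B\<close> to \<open>A\<close> is onto by Maschke, and its kernel
  consists of the maps on the simple factor \<open>B/A\<close>. That kernel has dimension at most 1,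
  since operators spanning the full matrix algebra commute with scalars only.\<close>

lemma dim_homs_simple_step:
  assumes A: "invsub G a A" and B: "invsub G a B" "A \<subset> B" "B \<subseteq> V"
    and simple: "\<not> (\<exists>W. invsub G a W \<and> A \<subset> W \<and> W \<subset> B)"
    and burnside: "matrix_units_in_span G n \<rho>" and n: "n > 0"
    and fin: "fin_dim vscale (H A)"
  shows "fin_dim vscale (H B) \<and>
    V.dim (H B) = V.dim (H A) + (if factor_iso G a A B n \<rho> then 1 else 0)"
proof -
  have sub: "V.subspace A" "V.subspace B" using A B by (auto simp: invsub_def fsub_iff_subspace)
  define r where "r \<psi> = (\<lambda>(v, i). if v \<in> A then \<psi> (v, i) else 0)"
    for \<psi> :: "('b \<Rightarrow> 'k) \<times> nat \<Rightarrow> 'k"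
  have r_in: "r \<psi> \<in> H A" if \<psi>: "\<psi> \<in> H B" for \<psi>
    unfolding homs_def
  proof (intro CollectI conjI allI impI ballI)
    fix v i assume "v \<notin> A \<or> n \<le> i" then show "r \<psi> (v, i) = 0" using \<psi> by (auto simp: r_def homs_def)
  next
    fix v w i assume vw: "v \<in> A" "w \<in> A"
    moreover have "v \<in> B" "w \<in> B" using vw B(2) by auto
    ultimately show "r \<psi> (v + w, i) = r \<psi> (v, i) + r \<psi> (w, i)"
      using \<psi> V.subspace_add[OF sub(1) vw] by (simp add: r_def homs_def)
  next
    fix c v i assume "v \<in> A"
    then show "r \<psi> (vscale c v, i) = c * r \<psi> (v, i)"
      using \<psi> B(2) V.subspace_scale[OF sub(1)] by (auto simp: r_def homs_def)
  next
    fix g v i assume "g \<in> G" "v \<in> A" "i < n"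
    then show "r \<psi> (a g v, i) = (\<Sum>j<n. \<rho> g $$ (i, j) * r \<psi> (v, j))"
      using \<psi> B(2) A by (auto simp: r_def homs_def invsub_def)
  qed
  have img: "r ` H B = H A"
  proof (intro equalityI subsetI)
    fix \<psi> assume \<psi>: "\<psi> \<in> H A"
    obtain \<psi>' where "\<psi>' \<in> H B" "\<forall>v\<in>A. \<forall>i. \<psi>' (v, i) = \<psi> (v, i)"
      using homs_extend[OF A B(1) _ B(3) \<psi>] B(2) by auto
    moreover from this have "r \<psi>' = \<psi>" using \<psi> by (auto simp: r_def homs_def fun_eq_iff)
    ultimately show "\<psi> \<in> r ` H B" by blast
  qed (use r_in in blast)
  define K where "K = {\<psi> \<in> H B. r \<psi> = 0}"
  have K_iff: "\<psi> \<in> K \<longleftrightarrow> \<psi> \<in> H B \<and> (\<forall>v\<in>A. \<forall>i. \<psi> (v, i) = 0)" for \<psi>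
    by (auto simp: K_def r_def fun_eq_iff)
  have K: "fin_dim vscale K \<and> V.dim K = (if factor_iso G a A B n \<rho> then 1 else 0)"
  proof (cases "factor_iso G a A B n \<rho>")
    case False
    then have "\<psi> = 0" if "\<psi> \<in> K" for \<psi>
      using factor_iso_of_hom[OF A B simple burnside, of \<psi>] that K_iff by blast
    moreover have "0 \<in> K" using V.subspace_0[OF subspace_homs] K_iff by auto
    ultimately have "K = {0}" by blast
    then show ?thesis using False fin_dim_singleton dim_zero by simp
  next
    case True
    then obtain \<phi> where \<phi>: "\<phi> ` B = carrier_vec n"
      "\<And>v w. v \<in> B \<Longrightarrow> w \<in> B \<Longrightarrow> \<phi> (v + w) = \<phi> v + \<phi> w"
      "\<And>c v. v \<in> B \<Longrightarrow> \<phi> (vscale c v) = c \<cdot>\<^sub>v \<phi> v" "{v \<in> B. \<phi> v = 0\<^sub>v n} = A"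
      "\<And>g v. g \<in> G \<Longrightarrow> v \<in> B \<Longrightarrow> \<phi> (a g v) = \<rho> g *\<^sub>v \<phi> v"
      unfolding factor_iso_def by (metis (no_types, lifting))
    have car: "\<phi> v \<in> carrier_vec n" if "v \<in> B" for v using \<phi>(1) that by blast
    have rho: "\<rho> g \<in> carrier_mat n n" if "g \<in> G" for g using rep that unfolding mrep_def by blast
    define \<psi>0 where "\<psi>0 = (\<lambda>(v, i). if v \<in> B \<and> i < n then \<phi> v $ i else 0)"
    have psi0: "\<psi>0 \<in> H B"
      unfolding homs_def
    proof (intro CollectI conjI allI impI ballI)
      fix v i assume "v \<notin> B \<or> n \<le> i" then show "\<psi>0 (v, i) = 0" by (auto simp: \<psi>0_def)
    next
      fix v w i assume vw: "v \<in> B" "w \<in> B"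
      then show "\<psi>0 (v + w, i) = \<psi>0 (v, i) + \<psi>0 (w, i)"
        using V.subspace_add[OF sub(2)] \<phi>(2) car[OF vw(1)] car[OF vw(2)] by (auto simp: \<psi>0_def)
    next
      fix c v i assume "v \<in> B"
      then show "\<psi>0 (vscale c v, i) = c * \<psi>0 (v, i)"
        using V.subspace_scale[OF sub(2)] \<phi>(3) car[of v] by (auto simp: \<psi>0_def)
    next
      fix g v i assume g: "g \<in> G" "v \<in> B" "i < n"
      then show "\<psi>0 (a g v, i) = (\<Sum>j<n. \<rho> g $$ (i, j) * \<psi>0 (v, j))"
        using B(1) \<phi>(5) car[of v] rho[of g]
        by (auto simp: \<psi>0_def invsub_def scalar_prod_def lessThan_atLeast0)
    qed
    have ker0: "v \<in> A \<longleftrightarrow> (\<forall>i. \<psi>0 (v, i) = 0)" if "v \<in> B" for v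
    proof -
      have "v \<in> A \<longleftrightarrow> \<phi> v = 0\<^sub>v n" using \<phi>(4) that by blast
      also have "\<dots> \<longleftrightarrow> (\<forall>i<n. \<phi> v $ i = 0)" using car[OF that] by (auto simp: vec_eq_iff)
      also have "\<dots> \<longleftrightarrow> (\<forall>i. \<psi>0 (v, i) = 0)" using that by (auto simp: \<psi>0_def)
      finally show ?thesis .
    qed
    have "unit_vec n 0 \<in> \<phi> ` B" using \<phi>(1) by simp
    then obtain v0 where v0: "v0 \<in> B" "\<phi> v0 = unit_vec n 0" by auto
    have p0: "\<psi>0 (v0, i) = (if i = 0 then 1 else 0)" for i using v0 n by (auto simp: \<psi>0_def)
    have v0A: "v0 \<notin> A" using ker0[OF v0(1)] p0[of 0] by auto
    obtain c where c: "\<And>i j. i < n \<Longrightarrow> j < n \<Longrightarrow>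
        (\<Sum>g\<in>G. c g * \<rho> g $$ (i, j)) = (if i = 0 \<and> j = 0 then 1 else 0)"
      using burnside[unfolded matrix_units_in_span_def, rule_format, OF n n] by auto
    \<comment> \<open>Image of \<open>v0\<close> under the matrix unit at \<open>(0, 0)\<close>.
      Every equivariant map sees at \<open>w\<close> only its coordinate 0 at \<open>v0\<close>; for
      \<open>\<psi>0\<close> this gives \<open>w - v0 \<in> A\<close>, so a map vanishing on
      \<open>A\<close> is determined by that one scalar.\<close>
    define w where "w = (\<Sum>g\<in>G. vscale (c g) (a g v0))"
    have av0: "a g v0 \<in> B" if "g \<in> G" for g using B(1) that v0(1) by (auto simp: invsub_def)
    have wB: "w \<in> B"
      unfolding w_def by (intro V.subspace_sum[OF sub(2)] V.subspace_scale[OF sub(2)] av0)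
    have hw: "\<psi> (w, i) = (if i = 0 then \<psi> (v0, 0) else 0)" if \<psi>: "\<psi> \<in> H B" for \<psi> i
    proof (cases "i < n")
      case True
      have "\<psi> (w, i) = (\<Sum>g\<in>G. c g * \<psi> (a g v0, i))"
        unfolding w_def by (rule homs_sum[OF \<psi> sub(2) finG av0])
      also have "\<dots> = (\<Sum>g\<in>G. \<Sum>j<n. c g * \<rho> g $$ (i, j) * \<psi> (v0, j))"
        by (rule sum.cong[OF refl])
          (use \<psi> v0 True in \<open>simp add: homs_def sum_distrib_left mult.assoc\<close>)
      also have "\<dots> = (\<Sum>j<n. (\<Sum>g\<in>G. c g * \<rho> g $$ (i, j)) * \<psi> (v0, j))"
        by (subst sum.swap) (simp add: sum_distrib_right)
      also have "\<dots> = (\<Sum>j<n. if j = 0 then (if i = 0 then \<psi> (v0, j) else 0) else 0)"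
        by (intro sum.cong) (use True c in auto)
      also have "\<dots> = (if i = 0 then \<psi> (v0, 0) else 0)" using n by simp
      finally show ?thesis .
    next
      case False
      then show ?thesis using \<psi> n by (auto simp: homs_def)
    qed
    have diff: "\<psi> (v - v', i) = \<psi> (v, i) - \<psi> (v', i)" if "\<psi> \<in> H B" "v \<in> B" "v' \<in> B" for \<psi> v v' i
    proof -
      have "\<psi> ((v - v') + v', i) = \<psi> (v - v', i) + \<psi> (v', i)"
        using that V.subspace_diff[OF sub(2)] unfolding homs_def by blast
      then show ?thesis by simp
    qed
    have wv0: "w - v0 \<in> A"
      using ker0[of "w - v0"] V.subspace_diff[OF sub(2) wB v0(1)] diff[OF psi0 wB v0(1)] hw[OF psi0] p0
      by simp
    have "\<psi> = vscale (\<psi> (v0, 0)) \<psi>0" if \<psi>: "\<psi> \<in> K" for \<psi>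
    proof -
      have \<psi>H: "\<psi> \<in> H B" using \<psi> K_iff by blast
      let ?\<eta> = "\<psi> - vscale (\<psi> (v0, 0)) \<psi>0"
      have eta: "?\<eta> \<in> H B" using V.subspace_diff V.subspace_scale subspace_homs \<psi>H psi0 by metis
      moreover have "\<forall>v\<in>A. \<forall>i. ?\<eta> (v, i) = 0"
        using \<psi> K_iff ker0 B(2) by (auto simp: vscale_def)
      moreover have "\<forall>i. ?\<eta> (v0, i) = 0"
      proof
        fix i
        have "\<psi> (w - v0, i) = 0" using \<psi> wv0 K_iff by blast
        then have "\<psi> (v0, i) = (if i = 0 then \<psi> (v0, 0) else 0)"
          using diff[OF \<psi>H wB v0(1)] hw[OF \<psi>H] by (metis eq_iff_diff_eq_0)
        then show "?\<eta> (v0, i) = 0" using p0 by (simp add: vscale_def)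
      qed
      ultimately have "?\<eta> = 0" using homs_ker_simple_step[OF A B simple, of ?\<eta>] v0(1) v0A by blast
      then show ?thesis by simp
    qed
    then have "K \<subseteq> V.span {\<psi>0}" using V.span_scale V.span_base by (metis insertI1 subsetI)
    moreover have "\<psi>0 \<in> K" using psi0 ker0 B(2) K_iff by blast
    moreover have "\<psi>0 \<noteq> 0" using p0[of 0] by (metis zero_fun_apply zero_neq_one)
    ultimately have "V.dim K = 1" using V.basis_card_eq_dim[of "{\<psi>0}" K] by simp
    moreover have "fin_dim vscale K" using \<open>K \<subseteq> V.span {\<psi>0}\<close> unfolding fin_dim_def by blast
    ultimately show ?thesis using True by simp
  qed
  have r_lin: "r (\<psi> + \<psi>') = r \<psi> + r \<psi>'" "r (vscale c \<psi>) = vscale c (r \<psi>)" for \<psi> \<psi>' c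
    by (auto simp: r_def fun_eq_iff vscale_def)
  have "fin_dim vscale (H B)" "V.dim (H B) = V.dim K + V.dim (r ` H B)"
    using VV.rank_nullity_on[OF subspace_homs[of G a n \<rho> B] r_lin] K fin img
    unfolding K_def[symmetric] by simp_all
  then show ?thesis using K img by simp
qed

text \<open>The series is built from the top: a proper invariant subspace of largest dimension
  leaves a simple factor, and induction on the dimension handles the subspace.\<close>

lemma comp_series_exists:
  assumes "invsub G a W" "W \<subseteq> V"
  shows "\<exists>Ws. comp_series G a W Ws"
  using assms
proof (induction "V.dim W" arbitrary: W rule: less_induct)
  case less
  have zero: "invsub G a {0}"
  proof -
    have "a g 0 = 0" if "g \<in> G" for g using a_scale[OF that V.subspace_0[OF subV], of 0] by simp
    then show ?thesis by (auto simp: invsub_def fsub_def)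
  qed
  have fin: "fin_dim vscale W" by (rule VS.fin_dim_subset[OF finV less(3)])
  have subs: "V.subspace U" if "invsub G a U" for U using that by (auto simp: invsub_def fsub_iff_subspace)
  show ?case
  proof (cases "W = {0}")
    case True
    then have "comp_series G a W [{0}]" using zero by (simp add: comp_series_def)
    then show ?thesis by blast
  next
    case False
    define S where "S = {U. invsub G a U \<and> U \<subset> W}"
    have lt: "V.dim U < V.dim W" if "U \<in> S" for U
      using that VS.dim_psubset_fin_dim[OF fin] subs less(2) unfolding S_def by blast
    have "{0} \<in> S" using False zero V.subspace_0[OF subs[OF less(2)]] unfolding S_def by blast
    then obtain U where U: "U \<in> S" "\<And>U'. U' \<in> S \<Longrightarrow> V.dim U' \<le> V.dim U"
      using ex_has_greatest_nat[of "\<lambda>U. U \<in> S" "{0}" V.dim "V.dim W"] lt by (metis less_imp_le)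
    have UW: "invsub G a U" "U \<subset> W" using U(1) by (auto simp: S_def)
    obtain Ws where Ws: "comp_series G a U Ws" using less(1)[OF lt[OF U(1)] UW(1)] UW less(3) by blast
    have none: "\<not> (\<exists>X. invsub G a X \<and> U \<subset> X \<and> X \<subset> W)"
    proof
      assume "\<exists>X. invsub G a X \<and> U \<subset> X \<and> X \<subset> W"
      then obtain X where X: "invsub G a X" "U \<subset> X" "X \<subset> W" by blast
      have "V.dim U < V.dim X"
        using VS.dim_psubset_fin_dim[OF VS.fin_dim_subset[OF fin] subs[OF UW(1)] subs[OF X(1)]] X by blast
      moreover have "V.dim X \<le> V.dim U" using U(2) X unfolding S_def by blast
      ultimately show False by simp
    qed
    have nth: "(Ws @ [W]) ! i = (if i < length Ws then Ws ! i else W)" if "i < length (Ws @ [W])" for i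
      using that by (simp add: nth_append)
    have last: "Ws ! (length Ws - 1) = U" "Ws \<noteq> []" using Ws by (auto simp: comp_series_def last_conv_nth)
    have "comp_series G a W (Ws @ [W])"
      unfolding comp_series_def
    proof (intro conjI allI impI)
      show "Ws @ [W] \<noteq> []" "hd (Ws @ [W]) = {0}" "last (Ws @ [W]) = W"
        using Ws by (auto simp: comp_series_def)
      fix i assume i: "i < length (Ws @ [W])"
      show "invsub G a ((Ws @ [W]) ! i)" using nth[OF i] Ws less(2) by (auto simp: comp_series_def)
    next
      fix i assume i: "Suc i < length (Ws @ [W])"
      have *: "(Ws @ [W]) ! i \<subset> (Ws @ [W]) ! Suc i \<and>
        \<not> (\<exists>X. invsub G a X \<and> (Ws @ [W]) ! i \<subset> X \<and> X \<subset> (Ws @ [W]) ! Suc i)"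
      proof (cases "Suc i < length Ws")
        case True
        then have e: "(Ws @ [W]) ! i = Ws ! i" "(Ws @ [W]) ! Suc i = Ws ! Suc i" by (simp_all add: nth_append)
        show ?thesis unfolding e using Ws True unfolding comp_series_def by blast
      next
        case False
        then have e: "i = length Ws - 1" "Suc i = length Ws" using i last(2) by auto
        then have e2: "(Ws @ [W]) ! i = U" "(Ws @ [W]) ! Suc i = W"
          using last nth_append[of Ws "[W]" i] by (auto simp: nth_append)
        show ?thesis unfolding e2 using UW(2) none by blast
      qed
      show "(Ws @ [W]) ! i \<subset> (Ws @ [W]) ! Suc i" using * by blast
      show "\<not> (\<exists>X. invsub G a X \<and> (Ws @ [W]) ! i \<subset> X \<and> X \<subset> (Ws @ [W]) ! Suc i)" using * by blast
    qed
    then show ?thesis by blast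
  qed
qed

text \<open>Each step of the series raises the dimension by 1 exactly when its factor is the given
  simple module. The count depends on the series, the dimension does not.\<close>

lemma comp_series_dim_homs:
  assumes burnside: "matrix_units_in_span G n \<rho>" and n: "n > 0"
    and W: "W \<subseteq> V" and Ws: "comp_series G a W Ws"
  shows "fin_dim vscale (H W) \<and>
    V.dim (H W) = card {i. Suc i < length Ws \<and> factor_iso G a (Ws ! i) (Ws ! Suc i) n \<rho>}"
proof -
  have ne: "Ws \<noteq> []" and hd: "Ws ! 0 = {0}" and last: "Ws ! (length Ws - 1) = W"
    using Ws by (auto simp: comp_series_def hd_conv_nth last_conv_nth)
  have inv: "invsub G a (Ws ! i)" if "i < length Ws" for i using Ws that by (auto simp: comp_series_def)
  have step: "Ws ! i \<subset> Ws ! Suc i"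
    "\<not> (\<exists>X. invsub G a X \<and> Ws ! i \<subset> X \<and> X \<subset> Ws ! Suc i)" if "Suc i < length Ws" for i
    using Ws that unfolding comp_series_def by blast+
  have in_V: "Ws ! i \<subseteq> V" if "i < length Ws" for i
  proof -
    have "i \<le> length Ws - 1" using that by simp
    then have "Ws ! i \<subseteq> W"
    proof (induction rule: inc_induct)
      case base
      then show ?case using last by simp
    next
      case (step k)
      then have "Ws ! k \<subset> Ws ! Suc k" using \<open>\<And>i. Suc i < length Ws \<Longrightarrow> Ws ! i \<subset> Ws ! Suc i\<close>[of k] by simp
      then show ?case using step by blast
    qed
    then show ?thesis using W by blast
  qed
  let ?S = "\<lambda>l. {i. i < l \<and> factor_iso G a (Ws ! i) (Ws ! Suc i) n \<rho>}"
  have "fin_dim vscale (H (Ws ! l)) \<and> V.dim (H (Ws ! l)) = card (?S l)" if "l < length Ws" for l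
    using that
  proof (induction l)
    case 0
    have "\<psi> = 0" if \<psi>: "\<psi> \<in> H {0}" for \<psi>
    proof
      fix vi :: "('b \<Rightarrow> 'k) \<times> nat"
      obtain v i where vi: "vi = (v, i)" by (cases vi)
      show "\<psi> vi = 0 vi"
      proof (cases "v = 0")
        case True
        then show ?thesis using homs_0[OF \<psi>, of i] vi by simp
      next
        case False
        then show ?thesis using \<psi> vi by (simp add: homs_def)
      qed
    qed
    then have "H {0} = {0}" using V.subspace_0[OF subspace_homs] by blast
    then show ?case using fin_dim_singleton dim_zero hd by simp
  next
    case (Suc l)
    have *: "fin_dim vscale (H (Ws ! Suc l)) \<and> V.dim (H (Ws ! Suc l))
      = V.dim (H (Ws ! l)) + (if factor_iso G a (Ws ! l) (Ws ! Suc l) n \<rho> then 1 else 0)"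
      by (rule dim_homs_simple_step[OF inv inv step(1) in_V step(2) burnside n]) (use Suc in auto)
    have "?S (Suc l) = (if factor_iso G a (Ws ! l) (Ws ! Suc l) n \<rho> then insert l (?S l) else ?S l)"
      by (auto simp: less_Suc_eq)
    then have "card (?S (Suc l)) = card (?S l) + (if factor_iso G a (Ws ! l) (Ws ! Suc l) n \<rho> then 1 else 0)"
      by simp
    then show ?case using * Suc by simp
  qed
  from this[of "length Ws - 1"] have "fin_dim vscale (H W) \<and> V.dim (H W) = card (?S (length Ws - 1))"
    unfolding last using ne by simp
  moreover have "?S (length Ws - 1) = {i. Suc i < length Ws \<and> factor_iso G a (Ws ! i) (Ws ! Suc i) n \<rho>}"
    using ne by auto
  ultimately show ?thesis by simp
qed

text \<open>\<open>multiplicity\<close> selects its count by choice; the existence of a series makes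
  the choice meaningful, and \<open>comp_series_dim_homs\<close> gives every candidate the same
  value.\<close>

lemma multiplicity_eq_dim_homs:
  assumes burnside: "matrix_units_in_span G n \<rho>" and n: "n > 0"
    and W: "invsub G a W" "W \<subseteq> V"
  shows "multiplicity G a W n \<rho> = V.dim (H W)"
proof -
  have "\<exists>c Ws. comp_series G a W Ws
       \<and> c = card {i. Suc i < length Ws \<and> factor_iso G a (Ws ! i) (Ws ! Suc i) n \<rho>}"
    using comp_series_exists[OF W] by blast
  from someI_ex[OF this] obtain Ws where "comp_series G a W Ws"
    "multiplicity G a W n \<rho> = card {i. Suc i < length Ws \<and> factor_iso G a (Ws ! i) (Ws ! Suc i) n \<rho>}"
    unfolding multiplicity_def by blast
  then show ?thesis using comp_series_dim_homs[OF burnside n W(2)] by simp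
qed

end

section \<open>Permutation modules and their submodules\<close>

locale fgrp_perm = fgrp_rep G m u iv n \<rho> for G :: "'g set" and m u iv n and \<rho> :: "'g \<Rightarrow> 'k::field mat" +
  fixes X :: "'b set" and p :: "'g \<Rightarrow> 'b \<Rightarrow> 'b"
  assumes finX: "finite X" and p_in: "g \<in> G \<Longrightarrow> c \<in> X \<Longrightarrow> p g c \<in> X"
    and p_m: "g \<in> G \<Longrightarrow> h \<in> G \<Longrightarrow> c \<in> X \<Longrightarrow> p (m g h) c = p g (p h c)"
    and p_u: "c \<in> X \<Longrightarrow> p u c = c"
begin

definition perm_act :: "'g \<Rightarrow> ('b \<Rightarrow> 'k) \<Rightarrow> ('b \<Rightarrow> 'k)" where
  "perm_act g v = (\<lambda>d. \<Sum>c \<in> {c \<in> X. p g c = d}. v c)"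

definition perm_space :: "('b \<Rightarrow> 'k) set" where
  "perm_space = {v. \<forall>c. c \<notin> X \<longrightarrow> v c = 0}"

lemma perm_act_if: "perm_act g v d = (\<Sum>c\<in>X. if p g c = d then v c else 0)"
  unfolding perm_act_def using finX by (simp add: sum.inter_filter)

lemma perm_act_delta:
  assumes "c \<in> X"
  shows "perm_act g (delta c) = delta (p g c)"
proof
  fix d
  have "perm_act g (delta c) d = (\<Sum>c'\<in>X. if c' = c then (if p g c = d then 1 else 0) else 0)"
    unfolding perm_act_if by (intro sum.cong) (auto simp: delta_def)
  then show "perm_act g (delta c) d = delta (p g c) d" using assms finX by (auto simp: delta_def)
qed

lemma subspace_perm_space: "V.subspace perm_space"
  by (auto simp: V.subspace_def perm_space_def vscale_def)

text \<open>Pushing \<open>v\<close> forward is adjoint to pulling \<open>f\<close> back. Both the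
  action law and the equivariance of induced maps are read off from this.\<close>

lemma sum_perm_act:
  assumes g: "g \<in> G"
  shows "(\<Sum>d\<in>X. perm_act g v d * f d) = (\<Sum>c\<in>X. v c * f (p g c))"
proof -
  have "(\<Sum>d\<in>X. perm_act g v d * f d) = (\<Sum>d\<in>X. \<Sum>c\<in>X. if p g c = d then v c * f d else 0)"
    unfolding perm_act_if sum_distrib_right by (intro sum.cong) auto
  also have "\<dots> = (\<Sum>c\<in>X. \<Sum>d\<in>X. if p g c = d then v c * f d else 0)" by (rule sum.swap)
  also have "\<dots> = (\<Sum>c\<in>X. v c * f (p g c))"
    by (intro sum.cong) (use finX p_in[OF g] in auto)
  finally show ?thesis .
qed

sublocale act: fgrp_act G m u iv n \<rho> perm_act perm_space
proof
  show "V.subspace perm_space" by (rule subspace_perm_space)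
  show "fin_dim vscale perm_space" unfolding perm_space_def by (rule fin_dim_finite_support[OF finX])
next
  fix g v assume g: "g \<in> G" and v: "v \<in> perm_space"
  have "perm_act g v d = 0" if "d \<notin> X" for d
    unfolding perm_act_if by (rule sum.neutral) (use p_in[OF g] that in auto)
  then show "perm_act g v \<in> perm_space" by (auto simp: perm_space_def)
next
  fix g v w show "perm_act g (v + w) = perm_act g v + perm_act g w"
    by (simp add: perm_act_def fun_eq_iff sum.distrib)
next
  fix g c v show "perm_act g (vscale c v) = vscale c (perm_act g v)"
    by (simp add: perm_act_def fun_eq_iff vscale_def sum_distrib_left)
next
  fix g h v assume g: "g \<in> G" and h: "h \<in> G" and v: "v \<in> perm_space"
  show "perm_act (m g h) v = perm_act g (perm_act h v)"
  proof
    fix d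
    have "perm_act g (perm_act h v) d = (\<Sum>c\<in>X. perm_act h v c * (if p g c = d then 1 else 0))"
      unfolding perm_act_if[of g] by (intro sum.cong) auto
    also have "\<dots> = (\<Sum>c\<in>X. v c * (if p g (p h c) = d then 1 else 0))" by (rule sum_perm_act[OF h])
    also have "\<dots> = perm_act (m g h) v d"
      unfolding perm_act_if[of "m g h"] by (intro sum.cong) (use g h p_m in auto)
    finally show "perm_act (m g h) v d = perm_act g (perm_act h v) d" by simp
  qed
next
  fix v assume v: "v \<in> perm_space"
  show "perm_act u v = v"
  proof
    fix d
    have "perm_act u v d = (\<Sum>c\<in>X. if c = d then v c else 0)"
      unfolding perm_act_if by (intro sum.cong) (use p_u in auto)
    also have "\<dots> = v d" using v finX by (auto simp: perm_space_def)
    finally show "perm_act u v d = v d" .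
  qed
qed

lemma delta_in_perm_space: "c \<in> X \<Longrightarrow> delta c \<in> perm_space"
  by (auto simp: perm_space_def delta_def)

text \<open>Rank-nullity for restricting equivariant maps from the permutation module to
  \<open>W\<close>. Restriction is onto by \<open>homs_extend\<close>, an extension to the whole
  module being determined by its values on the basis vectors \<open>delta c\<close>.\<close>

lemma dim_equivariant_funs_split:
  assumes W: "invsub G perm_act W" "W \<subseteq> perm_space"
  shows fin_dim_homs: "fin_dim vscale (homs G perm_act n \<rho> W)"
    and "V.dim (equivariant_funs G X p n \<rho>)
    = V.dim {F \<in> equivariant_funs G X p n \<rho>. \<forall>v\<in>W. \<forall>i. (\<Sum>c\<in>X. v c * F (c, i)) = 0}
      + V.dim (homs G perm_act n \<rho> W)"
proof -
  let ?E = "equivariant_funs G X p n \<rho>"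
  have sub: "V.subspace W" using W by (auto simp: invsub_def fsub_iff_subspace)
  define T where "T F = (\<lambda>(v, i). if v \<in> W then \<Sum>c\<in>X. v c * F (c, i) else 0)"
    for F :: "'b \<times> nat \<Rightarrow> 'k"
  have lin: "T (F + F') = T F + T F'" "T (vscale c F) = vscale c (T F)" for F F' c
    by (auto simp: T_def fun_eq_iff vscale_def distrib_left sum.distrib sum_distrib_left mult.left_commute)
  have "T F \<in> homs G perm_act n \<rho> W" if F: "F \<in> ?E" for F
    unfolding homs_def
  proof (intro CollectI conjI allI impI ballI)
    fix v i assume "v \<notin> W \<or> n \<le> i" then show "T F (v, i) = 0" using F by (auto simp: T_def equivariant_funs_def)
  next
    fix v w i assume "v \<in> W" "w \<in> W"
    then show "T F (v + w, i) = T F (v, i) + T F (w, i)"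
      using V.subspace_add[OF sub] by (simp add: T_def distrib_right sum.distrib)
  next
    fix c v i assume "v \<in> W"
    then show "T F (vscale c v, i) = c * T F (v, i)"
      using V.subspace_scale[OF sub] by (simp add: T_def vscale_def sum_distrib_left mult.assoc)
  next
    fix g v i assume g: "g \<in> G" and v: "v \<in> W" and i: "i < n"
    have "perm_act g v \<in> W" using W(1) g v by (auto simp: invsub_def)
    then have "T F (perm_act g v, i) = (\<Sum>c\<in>X. v c * F (p g c, i))"
      using sum_perm_act[OF g] by (simp add: T_def)
    also have "\<dots> = (\<Sum>c\<in>X. \<Sum>j<n. \<rho> g $$ (i, j) * (v c * F (c, j)))"
      by (rule sum.cong[OF refl])
        (use F g i in \<open>simp add: equivariant_funs_def sum_distrib_left mult.left_commute\<close>)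
    also have "\<dots> = (\<Sum>j<n. \<rho> g $$ (i, j) * T F (v, j))"
      by (subst sum.swap) (use v in \<open>simp add: T_def sum_distrib_left\<close>)
    finally show "T F (perm_act g v, i) = (\<Sum>j<n. \<rho> g $$ (i, j) * T F (v, j))" .
  qed
  moreover have "\<psi> \<in> T ` ?E" if \<psi>: "\<psi> \<in> homs G perm_act n \<rho> W" for \<psi>
  proof -
    have inv: "invsub G perm_act perm_space"
      unfolding invsub_def fsub_iff_subspace using subspace_perm_space act.a_in by blast
    obtain \<psi>' where \<psi>': "\<psi>' \<in> homs G perm_act n \<rho> perm_space" "\<forall>v\<in>W. \<forall>i. \<psi>' (v, i) = \<psi> (v, i)"
      using act.homs_extend[OF W(1) inv W(2) order_refl \<psi>] by blast
    define F where "F = (\<lambda>(c, i). if c \<in> X then \<psi>' (delta c, i) else 0)"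
    have "F \<in> ?E"
      using \<psi>'(1) p_in delta_in_perm_space perm_act_delta
      by (auto simp: equivariant_funs_def F_def homs_def simp flip: perm_act_delta)
    moreover have "T F = \<psi>"
    proof
      fix vi :: "('b \<Rightarrow> 'k) \<times> nat"
      obtain v i where vi: "vi = (v, i)" by (cases vi)
      show "T F vi = \<psi> vi"
      proof (cases "v \<in> W")
        case True
        then have v: "v \<in> perm_space" using W(2) by blast
        have "\<psi> (v, i) = \<psi>' (v, i)" using True \<psi>'(2) by simp
        also have "\<dots> = (\<Sum>c\<in>X. v c * \<psi>' (delta c, i))"
        proof -
          have e: "v = (\<Sum>c\<in>X. vscale (v c) (delta c))"
            by (rule finite_support_expand[OF finX]) (use v in \<open>auto simp: perm_space_def\<close>)
          have "\<psi>' (\<Sum>c\<in>X. vscale (v c) (delta c), i) = (\<Sum>c\<in>X. v c * \<psi>' (delta c, i))"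
            by (rule act.homs_sum[OF \<psi>'(1) subspace_perm_space finX delta_in_perm_space])
          then show ?thesis unfolding e[symmetric] .
        qed
        finally show ?thesis using True vi by (simp add: T_def F_def)
      next
        case False
        then show ?thesis using \<psi> vi by (simp add: T_def homs_def)
      qed
    qed
    ultimately show ?thesis by blast
  qed
  ultimately have img: "T ` ?E = homs G perm_act n \<rho> W" by blast
  have finE: "fin_dim vscale ?E" by (rule fin_dim_equivariant_funs[OF finX])
  obtain B where B: "finite B" "?E \<subseteq> V.span B" using finE unfolding fin_dim_def by blast
  interpret T: Vector_Spaces.linear vscale vscale T by standard (use lin in auto)
  have "T ` ?E \<subseteq> V.span (T ` B)" using B(2) T.span_image by blast
  then have finH: "fin_dim vscale (T ` ?E)" using B(1) unfolding fin_dim_def by blast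
  have K: "{F \<in> ?E. T F = 0} = {F \<in> ?E. \<forall>v\<in>W. \<forall>i. (\<Sum>c\<in>X. v c * F (c, i)) = 0}"
    by (auto simp: T_def fun_eq_iff)
  have "fin_dim vscale {F \<in> ?E. T F = 0}" by (rule VS.fin_dim_subset[OF finE]) blast
  from VV.rank_nullity_on(2)[OF subspace_equivariant_funs[of G X p n \<rho>] lin this finH]
  show "V.dim ?E = V.dim {F \<in> ?E. \<forall>v\<in>W. \<forall>i. (\<Sum>c\<in>X. v c * F (c, i)) = 0}
      + V.dim (homs G perm_act n \<rho> W)" unfolding K img .
  show "fin_dim vscale (homs G perm_act n \<rho> W)" using finH unfolding img .
qed

end

section \<open>Extensions of inflated modules\<close>

context fin_orthogroup
begin

lemma inflate_eq:
  "m \<in> M \<Longrightarrow> inflate M mul uu e n \<rho> m = (if J e \<subseteq> J m then \<rho> (e \<cdot> m \<cdot> e) else 0\<^sub>m n n)"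
  by (simp add: inflate_def sigma_J)

end

section \<open>Cocycles as matrix-valued functions\<close>

definition mat_coc :: "'a set \<Rightarrow> ('a \<Rightarrow> 'a \<Rightarrow> 'a) \<Rightarrow> nat \<Rightarrow> ('a \<Rightarrow> 'k::field mat) \<Rightarrow> nat \<Rightarrow> ('a \<Rightarrow> 'k mat)
    \<Rightarrow> ('a \<Rightarrow> 'k mat) \<Rightarrow> bool" where
  "mat_coc M mul s S t T z \<longleftrightarrow> (\<forall>x\<in>M. z x \<in> carrier_mat t s)
     \<and> (\<forall>x\<in>M. \<forall>y\<in>M. z (mul x y) = T x * z y + z x * S y)"

text \<open>Matrices of all sizes share one type, which is not a vector space; so dimensions are
  computed with zero-padded scalar functions and products with matrices. This map leads from the
  second picture to the first.\<close>

definition of_mat_fun :: "'a set \<Rightarrow> nat \<Rightarrow> nat \<Rightarrow> ('a \<Rightarrow> 'k::field mat) \<Rightarrow> ('a \<Rightarrow> nat \<Rightarrow> nat \<Rightarrow> 'k)" where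
  "of_mat_fun M t s z = (\<lambda>x i j. if x \<in> M \<and> i < t \<and> j < s then z x $$ (i, j) else 0)"

lemma mat_mult_entry:
  "A \<in> carrier_mat a b \<Longrightarrow> B \<in> carrier_mat b d \<Longrightarrow> i < a \<Longrightarrow> j < d \<Longrightarrow>
    (A * B) $$ (i, j) = (\<Sum>l<b. A $$ (i, l) * B $$ (l, j))"
  by (auto simp: scalar_prod_def lessThan_atLeast0)

lemma mat_rearrange:
  assumes "p \<in> carrier_mat t s" "q \<in> carrier_mat t s" "r \<in> carrier_mat t s"
    "w \<in> carrier_mat t s" "v \<in> carrier_mat t s"
  shows "(p + q) + (r - w) = (p + (r - v)) + (q + (v - w :: 'k::ring mat))"
  by (rule eq_matI) (use assms in \<open>auto simp: algebra_simps\<close>)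

lemma tomat_carrier [simp]: "tomat t s f \<in> carrier_mat t s"
  by (simp add: tomat_def)

lemma tomat_dim [simp]: "dim_row (tomat t s f) = t" "dim_col (tomat t s f) = s"
  by (simp_all add: tomat_def)

lemma tomat_index [simp]: "i < t \<Longrightarrow> j < s \<Longrightarrow> tomat t s f $$ (i, j) = f i j"
  by (simp add: tomat_def)

lemma tomat_of_mat_fun: "x \<in> M \<Longrightarrow> z x \<in> carrier_mat t s \<Longrightarrow> tomat t s (of_mat_fun M t s z x) = z x"
  by (intro eq_matI) (auto simp: tomat_def of_mat_fun_def)

lemma cocycles_iff:
  "Z \<in> cocycles M mul s S t T \<longleftrightarrow>
    Z = of_mat_fun M t s (\<lambda>x. tomat t s (Z x)) \<and> mat_coc M mul s S t T (\<lambda>x. tomat t s (Z x))"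
  (is "?L \<longleftrightarrow> ?E \<and> ?C")
proof
  assume L: ?L
  then have ?C by (simp add: cocycles_def mat_coc_def)
  moreover have ?E
  proof (intro ext)
    fix x i j
    show "Z x i j = of_mat_fun M t s (\<lambda>x. tomat t s (Z x)) x i j"
      using L by (auto simp: cocycles_def of_mat_fun_def not_less)
  qed
  ultimately show "?E \<and> ?C" by blast
next
  assume EC: "?E \<and> ?C"
  then have E: "Z x i j = of_mat_fun M t s (\<lambda>x. tomat t s (Z x)) x i j" for x i j by metis
  have "Z x i j = 0" if "x \<notin> M \<or> t \<le> i \<or> s \<le> j" for x i j
    using that by (subst E) (auto simp: of_mat_fun_def)
  then have "\<forall>x. x \<notin> M \<longrightarrow> Z x = (\<lambda>i j. 0)" "\<forall>x i j. t \<le> i \<or> s \<le> j \<longrightarrow> Z x i j = 0"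
    by (auto simp: fun_eq_iff)
  then show ?L using EC by (simp add: cocycles_def mat_coc_def)
qed

lemma of_mat_fun_cocycle:
  assumes closed: "\<And>x y. x \<in> M \<Longrightarrow> y \<in> M \<Longrightarrow> mul x y \<in> M" and z: "mat_coc M mul s S t T z"
  shows "of_mat_fun M t s z \<in> cocycles M mul s S t T"
proof -
  have eq: "tomat t s (of_mat_fun M t s z x) = z x" if "x \<in> M" for x
    by (rule tomat_of_mat_fun[OF that]) (use z that in \<open>simp add: mat_coc_def\<close>)
  have "mat_coc M mul s S t T (\<lambda>x. tomat t s (of_mat_fun M t s z x))"
    using z closed by (simp add: mat_coc_def eq)
  moreover have "of_mat_fun M t s z = of_mat_fun M t s (\<lambda>x. tomat t s (of_mat_fun M t s z x))"
    by (auto simp: of_mat_fun_def fun_eq_iff eq tomat_def)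
  ultimately show ?thesis using cocycles_iff[where mul = mul] by blast
qed

lemma coboundaries_iff:
  "Z \<in> coboundaries M s S t T \<longleftrightarrow>
    (\<exists>A\<in>carrier_mat t s. Z = of_mat_fun M t s (\<lambda>x. T x * A - A * S x))"
proof -
  have "of_mat_fun M t s (\<lambda>x. T x * A - A * S x) x
    = (if x \<in> M then (\<lambda>i j. if i < t \<and> j < s then (T x * A - A * S x) $$ (i,j) else 0)
            else (\<lambda>i j. 0))" for A x by (auto simp: of_mat_fun_def fun_eq_iff)
  then show ?thesis unfolding coboundaries_def mem_Collect_eq fun_eq_iff[of Z] by simp
qed

lemma subspace_cocycles:
  assumes S: "\<And>x. x \<in> M \<Longrightarrow> S x \<in> carrier_mat s s" and T: "\<And>x. x \<in> M \<Longrightarrow> T x \<in> carrier_mat t t"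
  shows "F.subspace (cocycles M mul s S t T)"
  unfolding F.subspace_def
proof (intro conjI ballI allI)
  have t0: "tomat t s 0 = 0\<^sub>m t s" by (intro eq_matI) (auto simp: tomat_def)
  have tp: "tomat t s (f + g) = tomat t s f + tomat t s g" for f g
    by (intro eq_matI) (auto simp: tomat_def)
  have ts: "tomat t s (\<lambda>i j. c * f i j) = c \<cdot>\<^sub>m tomat t s f" for c f
    by (intro eq_matI) (auto simp: tomat_def)
  have "T x * 0\<^sub>m t s + 0\<^sub>m t s * S y = 0\<^sub>m t s" if "x \<in> M" "y \<in> M" for x y
    using S[OF that(2)] T[OF that(1)] by simp
  then show "0 \<in> cocycles M mul s S t T" by (simp add: cocycles_def t0 fun_eq_iff)
  fix Z assume Z: "Z \<in> cocycles M mul s S t T"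
  {
    fix Z' assume Z': "Z' \<in> cocycles M mul s S t T"
    have "tomat t s (Z (mul x y) + Z' (mul x y)) = T x * tomat t s (Z y + Z' y) + tomat t s (Z x + Z' x) * S y"
      if xy: "x \<in> M" "y \<in> M" for x y
    proof -
      have "tomat t s (Z (mul x y) + Z' (mul x y)) = (T x * tomat t s (Z y) + tomat t s (Z x) * S y)
          + (T x * tomat t s (Z' y) + tomat t s (Z' x) * S y)"
        using Z Z' xy by (simp add: tp cocycles_def)
      also have "\<dots> = (T x * tomat t s (Z y) + T x * tomat t s (Z' y))
          + (tomat t s (Z x) * S y + tomat t s (Z' x) * S y)"
        using S[OF xy(2)] T[OF xy(1)]
        by (intro eq_matI) (auto simp: algebra_simps simp del: index_mult_mat(1))
      also have "\<dots> = T x * tomat t s (Z y + Z' y) + tomat t s (Z x + Z' x) * S y"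
        unfolding tp using S[OF xy(2)] T[OF xy(1)]
        by (simp add: mult_add_distrib_mat[of _ t t _ s] add_mult_distrib_mat[of _ t s _ _ s])
      finally show ?thesis .
    qed
    then show "Z + Z' \<in> cocycles M mul s S t T"
      using Z Z' by (simp add: cocycles_def fun_eq_iff)
  }
  fix c
  have "tomat t s (\<lambda>i j. c * Z (mul x y) i j)
      = T x * tomat t s (\<lambda>i j. c * Z y i j) + tomat t s (\<lambda>i j. c * Z x i j) * S y"
    if xy: "x \<in> M" "y \<in> M" for x y
  proof -
    have c1: "T x * tomat t s (Z y) \<in> carrier_mat t s" "tomat t s (Z x) * S y \<in> carrier_mat t s"
      using mult_carrier_mat[OF T[OF xy(1)] tomat_carrier] mult_carrier_mat[OF tomat_carrier S[OF xy(2)]] by auto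
    have "tomat t s (\<lambda>i j. c * Z (mul x y) i j) = c \<cdot>\<^sub>m (T x * tomat t s (Z y) + tomat t s (Z x) * S y)"
      using Z xy by (simp add: ts cocycles_def)
    also have "\<dots> = T x * (c \<cdot>\<^sub>m tomat t s (Z y)) + (c \<cdot>\<^sub>m tomat t s (Z x)) * S y"
      using S[OF xy(2)] T[OF xy(1)]
      by (simp add: add_smult_distrib_left_mat[OF c1] mult_smult_distrib[of _ t t _ s]
          mult_smult_assoc_mat[of _ t s _ s])
    finally show ?thesis by (simp add: ts)
  qed
  then show "fscale c Z \<in> cocycles M mul s S t T"
    using Z by (simp add: cocycles_def fscale_def fun_eq_iff)
qed

text \<open>Uncurrying turns cocycles into scalar functions supported on a finite set of
  triples.\<close>

lemma fin_dim_cocycles: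
  fixes T :: "'a \<Rightarrow> 'k::field mat"
  assumes fin: "finite M"
    and S: "\<And>x. x \<in> M \<Longrightarrow> S x \<in> carrier_mat s s" and T: "\<And>x. x \<in> M \<Longrightarrow> T x \<in> carrier_mat t t"
  shows "fin_dim fscale (cocycles M mul s S t T)"
proof (rule FV.dim_iso_on(1)[OF subspace_cocycles[OF S T],
      where f = "\<lambda>Z. \<lambda>(x, i, j). Z x i j"])
  let ?f = "\<lambda>Z. \<lambda>(x, i, j). Z x i j"
  have "?f ` cocycles M mul s S t T \<subseteq> {v. \<forall>y. y \<notin> M \<times> {..<t} \<times> {..<s} \<longrightarrow> v y = 0}"
    by (auto simp: cocycles_def not_less)
  then show "fin_dim vscale (?f ` cocycles M mul s S t T)"
    by (rule VS.fin_dim_subset[OF fin_dim_finite_support, rotated]) (use fin in simp)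
qed (auto simp: fun_eq_iff vscale_def fscale_def)

text \<open>Abstracts two inflated modules to the properties on which the extension arguments run:
  the action is zero off the elements above the given idempotent, and idempotents above it act as
  the identity.\<close>

locale rep_pair = fin_orthogroup M mul uu for M :: "'a set" and mul (infixl \<open>\<cdot>\<close> 70) and uu +
  fixes e f :: 'a and s t :: nat and S T :: "'a \<Rightarrow> 'k::field mat"
  assumes e: "idm e" and f: "idm f"
    and S_car [simp]: "x \<in> M \<Longrightarrow> S x \<in> carrier_mat s s" and T_car [simp]: "x \<in> M \<Longrightarrow> T x \<in> carrier_mat t t"
    and S_mul: "x \<in> M \<Longrightarrow> y \<in> M \<Longrightarrow> S (x \<cdot> y) = S x * S y"
    and T_mul: "x \<in> M \<Longrightarrow> y \<in> M \<Longrightarrow> T (x \<cdot> y) = T x * T y"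
    and S_0: "x \<in> M \<Longrightarrow> \<not> J e \<subseteq> J x \<Longrightarrow> S x = 0\<^sub>m s s" and T_0: "x \<in> M \<Longrightarrow> \<not> J f \<subseteq> J x \<Longrightarrow> T x = 0\<^sub>m t t"
    and S_1: "idm g \<Longrightarrow> J e \<subseteq> J g \<Longrightarrow> S g = 1\<^sub>m s" and T_1: "idm g \<Longrightarrow> J f \<subseteq> J g \<Longrightarrow> T g = 1\<^sub>m t"
begin

lemma T_dim [simp]: "x \<in> M \<Longrightarrow> dim_row (T x) = t" "x \<in> M \<Longrightarrow> dim_col (T x) = t"
  and S_dim [simp]: "x \<in> M \<Longrightarrow> dim_row (S x) = s" "x \<in> M \<Longrightarrow> dim_col (S x) = s"
  using T_car S_car by blast+

lemma T_mult_car [simp]: "x \<in> M \<Longrightarrow> A \<in> carrier_mat t s \<Longrightarrow> T x * A \<in> carrier_mat t s"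
  and mult_S_car [simp]: "x \<in> M \<Longrightarrow> A \<in> carrier_mat t s \<Longrightarrow> A * S x \<in> carrier_mat t s"
  using T_car S_car mult_carrier_mat by blast+

lemma ts_simps [simp]:
  "x \<in> M \<Longrightarrow> T x * 0\<^sub>m t s = 0\<^sub>m t s" "x \<in> M \<Longrightarrow> 0\<^sub>m t s * S x = 0\<^sub>m t s"
  "A \<in> carrier_mat t s \<Longrightarrow> 0\<^sub>m t t * A = 0\<^sub>m t s" "A \<in> carrier_mat t s \<Longrightarrow> A * 0\<^sub>m s s = 0\<^sub>m t s"
  "A \<in> carrier_mat t s \<Longrightarrow> 1\<^sub>m t * A = A" "A \<in> carrier_mat t s \<Longrightarrow> A * 1\<^sub>m s = A"
  "A \<in> carrier_mat t s \<Longrightarrow> A + 0\<^sub>m t s = A" "A \<in> carrier_mat t s \<Longrightarrow> 0\<^sub>m t s + A = A"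
  for A :: "'k mat"
  using T_car S_car by (auto intro: right_mult_zero_mat left_mult_zero_mat)

abbreviation "coc \<equiv> mat_coc M mul s S t T"
abbreviation "cob A \<equiv> (\<lambda>x. T x * A - A * S x)"

lemma eM [simp]: "e \<in> M" and fM [simp]: "f \<in> M"
  using e f by auto

lemma coc_car [simp]: "coc z \<Longrightarrow> x \<in> M \<Longrightarrow> z x \<in> carrier_mat t s"
  by (simp add: mat_coc_def)

lemma coc_mul: "coc z \<Longrightarrow> x \<in> M \<Longrightarrow> y \<in> M \<Longrightarrow> z (x \<cdot> y) = T x * z y + z x * S y"
  by (simp add: mat_coc_def)

lemma coc_dim [simp]: "coc z \<Longrightarrow> x \<in> M \<Longrightarrow> dim_row (z x) = t \<and> dim_col (z x) = s"
  using coc_car by blast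

lemma cob_car [simp]: "A \<in> carrier_mat t s \<Longrightarrow> x \<in> M \<Longrightarrow> cob A x \<in> carrier_mat t s"
  using S_car T_car by (metis minus_carrier_mat mult_carrier_mat)

lemma coc_add_cob:
  assumes z: "coc z" and A: "A \<in> carrier_mat t s"
  shows "coc (\<lambda>x. z x + cob A x)"
  unfolding mat_coc_def
proof (intro conjI ballI)
  fix x assume x: "x \<in> M"
  show "z x + cob A x \<in> carrier_mat t s" using z x A by simp
  fix y assume y: "y \<in> M"
  note [simp] = S_car[OF x] S_car[OF y] T_car[OF x] T_car[OF y] A coc_car[OF z x] coc_car[OF z y]
  have car: "T x * A \<in> carrier_mat t s" "A * S x \<in> carrier_mat t s"
    "T y * A \<in> carrier_mat t s" "A * S y \<in> carrier_mat t s" by (simp_all add: x y)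
  have "T x * (z y + cob A y) = T x * z y + (T x * (T y * A) - T x * (A * S y))"
    unfolding mult_add_distrib_mat[OF T_car[OF x] coc_car[OF z y] cob_car[OF A y]]
      mult_minus_distrib_mat[OF T_car[OF x] car(3,4)] ..
  moreover have "(z x + cob A x) * S y = z x * S y + (T x * A * S y - A * S x * S y)"
    unfolding add_mult_distrib_mat[OF coc_car[OF z x] cob_car[OF A x] S_car[OF y]]
      minus_mult_distrib_mat[OF car(1,2) S_car[OF y]] ..
  moreover have "T x * (A * S y) = T x * A * S y" "T x * (T y * A) = T x * T y * A" "A * S x * S y = A * (S x * S y)"
    by (simp_all add: assoc_mult_mat[of _ t t _ s _ s] assoc_mult_mat[of _ t t _ t _ s]
        assoc_mult_mat[of _ t s _ s _ s])
  moreover have ST: "T x * T y \<in> carrier_mat t t" "S x * S y \<in> carrier_mat s s"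
    using mult_carrier_mat T_car[OF x] T_car[OF y] S_car[OF x] S_car[OF y] by blast+
  moreover have "T x * z y \<in> carrier_mat t s" "z x * S y \<in> carrier_mat t s"
    "T x * T y * A \<in> carrier_mat t s" "T x * A * S y \<in> carrier_mat t s" "A * (S x * S y) \<in> carrier_mat t s"
    using mult_carrier_mat[OF A ST(2)] mult_carrier_mat[OF ST(1) A] x y z A by simp_all
  ultimately show "z (x \<cdot> y) + cob A (x \<cdot> y) = T x * (z y + cob A y) + (z x + cob A x) * S y"
    using coc_mul[OF z x y] S_mul[OF x y] T_mul[OF x y]
      mat_rearrange[of "T x * z y" t s "z x * S y" "T x * T y * A" "A * (S x * S y)" "T x * A * S y"] by simp
qed

lemma coc_zero: "coc (\<lambda>x. 0\<^sub>m t s)"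
  unfolding mat_coc_def
proof (intro conjI ballI)
  fix x y assume "x \<in> M" "y \<in> M"
  then show "0\<^sub>m t s = T x * 0\<^sub>m t s + 0\<^sub>m t s * S y" using S_car[of y] T_car[of x] by simp
qed simp

lemma coboundaries_subset: "coboundaries M s S t T \<subseteq> cocycles M mul s S t T"
proof
  fix Z assume "Z \<in> coboundaries M s S t T"
  then obtain A where A: "A \<in> carrier_mat t s" "Z = of_mat_fun M t s (cob A)"
    using coboundaries_iff[of Z M s S t T] by blast
  have "coc (\<lambda>x. 0\<^sub>m t s + cob A x)" by (rule coc_add_cob[OF coc_zero A(1)])
  then have "coc (cob A)" using A(1) by (simp add: mat_coc_def del: cob_car)
      (metis cob_car[OF A(1)] closed left_add_zero_mat)
  then show "Z \<in> cocycles M mul s S t T" using of_mat_fun_cocycle[where mul = mul, OF closed] A(2) by blast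
qed

text \<open>Normalisation ends with \<open>Z + cob A = 0\<close>, so the coboundary equal to
  \<open>Z\<close> is that of \<open>- A\<close>.\<close>

lemma coboundaryI:
  assumes Z: "Z \<in> cocycles M mul s S t T" and A: "A \<in> carrier_mat t s"
    and 0: "\<And>x. x \<in> M \<Longrightarrow> tomat t s (Z x) + cob A x = 0\<^sub>m t s"
  shows "Z \<in> coboundaries M s S t T"
proof -
  have "tomat t s (Z x) = cob (- A) x" if x: "x \<in> M" for x
  proof -
    have car: "T x * A \<in> carrier_mat t s" "A * S x \<in> carrier_mat t s" using A x by auto
    have neg: "T x * (- A) = - (T x * A)" "(- A) * S x = - (A * S x)"
      using A x by (simp_all add: uminus_mult_right_mat uminus_mult_left_mat carrier_matD[OF A])
    have "Z x i j + ((T x * A) $$ (i, j) - (A * S x) $$ (i, j)) = 0" if "i < t" "j < s" for i j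
    proof -
      have "(tomat t s (Z x) + cob A x) $$ (i, j) = 0" using 0[OF x] that by simp
      then show ?thesis using that x carrier_matD[OF A] by (simp del: index_mult_mat(1))
    qed
    then show ?thesis unfolding neg using car
      by (intro eq_matI) (auto simp: algebra_simps eq_neg_iff_add_eq_0 add_eq_0_iff simp del: index_mult_mat)
  qed
  then have "of_mat_fun M t s (\<lambda>x. tomat t s (Z x)) = of_mat_fun M t s (cob (- A))"
    by (auto simp: of_mat_fun_def fun_eq_iff simp del: tomat_index)
  then have "Z = of_mat_fun M t s (cob (- A))" using Z cocycles_iff[where mul = mul] by metis
  then show ?thesis using coboundaries_iff[of Z M s S t T] A by (metis uminus_carrier_mat)
qed

text \<open>Expand \<open>z\<close> on \<open>x = x (om x)\<close>: the factors \<open>T x\<close>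
  and \<open>S (om x)\<close> both vanish, since \<open>om x\<close> has the ideal of
  \<open>x\<close>.\<close>

lemma coc_vanish:
  assumes z: "coc z" and x: "x \<in> M" "\<not> J e \<subseteq> J x" "\<not> J f \<subseteq> J x"
  shows "z x = 0\<^sub>m t s"
proof -
  have "z x = z (x \<cdot> om x)" using omega_absorb[OF x(1)] by simp
  also have "\<dots> = T x * z (om x) + z x * S (om x)" using x by (simp add: coc_mul[OF z])
  also have "\<dots> = 0\<^sub>m t s"
    using x J_omega[OF x(1)] coc_car[OF z x(1)] coc_car[OF z omega_in[OF x(1)]] by (simp add: S_0 T_0)
  finally show ?thesis .
qed

text \<open>Here \<open>T e = 0\<close> and \<open>S e = 1\<close>, so the coboundary of
  \<open>A\<close> takes the value \<open>- A\<close> at \<open>e\<close>; hence the choice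
  \<open>A = z e\<close>.\<close>

lemma normalize:
  assumes z: "coc z" and n: "\<not> J f \<subseteq> J e"
  shows "coc (\<lambda>x. z x + cob (z e) x)" "z e + cob (z e) e = 0\<^sub>m t s"
proof -
  show "coc (\<lambda>x. z x + cob (z e) x)" by (rule coc_add_cob[OF z coc_car[OF z eM]])
  have "T e = 0\<^sub>m t t" "S e = 1\<^sub>m s" using n e by (simp_all add: T_0 S_1)
  then show "z e + cob (z e) e = 0\<^sub>m t s"
    using coc_car[OF z eM] by (intro eq_matI) auto
qed

end

locale normalized_coc = rep_pair M mul uu e f s t S T
  for M :: "'a set" and mul (infixl \<open>\<cdot>\<close> 70) and uu e f s t and S T :: "'a \<Rightarrow> 'k::field mat" +
  fixes z
  assumes z: "coc z" and ze: "z e = 0\<^sub>m t s" and nle: "\<not> J f \<subseteq> J e"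
begin

lemma T_low: "x \<in> M \<Longrightarrow> J x \<subseteq> J e \<Longrightarrow> T x = 0\<^sub>m t t"
  using T_0 nle by blast

lemma z_right_e: "x \<in> M \<Longrightarrow> z (x \<cdot> e) = z x"
  using coc_mul[OF z, of x e] S_1[OF e] T_car[of x] coc_car[OF z, of x] by (simp add: ze)

lemma z_left_e: "x \<in> M \<Longrightarrow> z (e \<cdot> x) = 0\<^sub>m t s"
  using coc_mul[OF z, of e x] T_low[of e] S_car[of x] coc_car[OF z, of x] by (simp add: ze)

end

context rep_pair
begin

text \<open>For \<open>x\<close> below \<open>e\<close> the product \<open>f x\<close> is above
  neither \<open>e\<close> nor \<open>f\<close>, so the normalised cocycle vanishes there. As
  \<open>T f = 1\<close> and \<open>z f = 0\<close>, expanding \<open>z (f y)\<close> with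
  \<open>y = x e\<close> returns \<open>z y = z x\<close>.\<close>

lemma no_arrows_incomparable:
  assumes inc: "\<not> J e \<subseteq> J f" "\<not> J f \<subseteq> J e"
  shows "cocycles M mul s S t T = coboundaries M s S t T"
proof (rule subset_antisym[OF subsetI coboundaries_subset])
  fix Z assume Z: "Z \<in> cocycles M mul s S t T"
  define z0 where "z0 x = tomat t s (Z x)" for x
  have z0: "coc z0" using Z cocycles_iff[where mul = mul] unfolding z0_def by blast
  define z where "z x = z0 x + cob (z0 e) x" for x
  interpret normalized_coc M mul uu e f s t S T z
    by standard (use normalize[OF z0 inc(2)] inc(2) in \<open>simp_all add: z_def[abs_def]\<close>)
  have fx0: "z (f \<cdot> x) = 0\<^sub>m t s" if x: "x \<in> M" "J x \<subseteq> J e" for x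
  proof (rule coc_vanish[OF z])
    show "\<not> J e \<subseteq> J (f \<cdot> x)" using J_le_mul_iff[of f x e] x inc by simp
    show "\<not> J f \<subseteq> J (f \<cdot> x)" using J_le_mul_iff[of f x f] x inc by auto
  qed (use x in simp)
  have zf: "z f = 0\<^sub>m t s" using fx0[of e] z_right_e[of f] by simp
  have "z x = 0\<^sub>m t s" if x: "x \<in> M" for x
  proof -
    let ?y = "x \<cdot> e"
    have y: "?y \<in> M" "J ?y \<subseteq> J e" using x J_mul2 by auto
    have "z (f \<cdot> ?y) = T f * z ?y + z f * S ?y" by (rule coc_mul[OF z]) (use y in auto)
    then have "z ?y = 0\<^sub>m t s"
      using fx0[OF y] zf T_1[OF f] coc_car[OF z y(1)] S_car[OF y(1)] by simp
    then show ?thesis using z_right_e[OF x] by simp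
  qed
  then show "Z \<in> coboundaries M s S t T"
    using coboundaryI[OF Z coc_car[OF z0 eM]] unfolding z_def z0_def by blast
qed

text \<open>Averaging makes the cocycle a coboundary on the maximal subgroup. After subtraction an
  element \<open>x\<close> above \<open>e\<close> has the value of \<open>e x e\<close>, which lies
  in the subgroup; elsewhere \<open>coc_vanish\<close> applies.\<close>

lemma no_arrows_equal:
  assumes eq: "J e = J f" and card: "of_nat (card (Gp M mul e)) \<noteq> (0::'k)"
  shows "cocycles M mul s S t T = coboundaries M s S t T"
proof (rule subset_antisym[OF subsetI coboundaries_subset])
  fix Z assume Z: "Z \<in> cocycles M mul s S t T"
  define z0 where "z0 x = tomat t s (Z x)" for x
  have z0: "coc z0" using Z cocycles_iff[where mul = mul] unfolding z0_def by blast
  let ?G = "Gp M mul e" and ?i = "ginv M mul e"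
  let ?B = "\<lambda>h. z0 h * S (?i h)"
  \<comment> \<open>Chosen so that \<open>A * S g = T g * A + z0 g\<close> for every
    \<open>g\<close> in the subgroup, which says that \<open>z0 + cob A\<close> is zero
    there.\<close>
  define A where "A = mat t s (\<lambda>(i, j). inverse (of_nat (card ?G)) * (\<Sum>h\<in>?G. ?B h $$ (i, j)))"
  have A: "A \<in> carrier_mat t s" by (simp add: A_def)
  have G: "g \<in> M" "?i g \<in> ?G" "?i g \<in> M" if "g \<in> ?G" for g using that e Gp_in by auto
  have SG: "S g * S (?i g) = 1\<^sub>m s" if "g \<in> ?G" for g
    using that S_mul[of g "?i g"] G ginv_right[OF e] S_1[OF e] by simp
  have B: "?B h \<in> carrier_mat t s" if "h \<in> ?G" for h
    using coc_car[OF z0 G(1)[OF that]] S_car[OF G(3)[OF that]] by simp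
  have key: "z0 g + cob A g = 0\<^sub>m t s" if g: "g \<in> ?G" for g
  proof -
    have gM: "g \<in> M" by (rule G(1)[OF g])
    note car = T_car[OF gM] S_car[OF gM] coc_car[OF z0 gM]
    have step: "?B (g \<cdot> h) * S g = T g * ?B h + z0 g" if h: "h \<in> ?G" for h
    proof -
      have hM: "h \<in> M" by (rule G(1)[OF h])
      note car' = T_car[OF hM] S_car[OF hM] coc_car[OF z0 hM] S_car[OF G(3)[OF h]] S_car[OF G(3)[OF g]]
      have "S (?i (g \<cdot> h)) * S g = S (?i h \<cdot> ?i g \<cdot> g)"
        using g h G ginv_mul[OF e g h] by (simp add: S_mul)
      also have "?i h \<cdot> ?i g \<cdot> g = ?i h \<cdot> (?i g \<cdot> g)" by (rule assoc) (use G g h in auto)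
      also have "\<dots> = ?i h" using ginv_left[OF e g] Gp_iff[OF e] G(2)[OF h] by simp
      finally have i: "S (?i (g \<cdot> h)) * S g = S (?i h)" .
      have gh: "g \<cdot> h \<in> ?G" using g h e by simp
      have "?B (g \<cdot> h) * S g = z0 (g \<cdot> h) * (S (?i (g \<cdot> h)) * S g)"
        by (rule assoc_mult_mat[of _ t s _ s _ s])
          (use coc_car[OF z0 G(1)[OF gh]] S_car[OF G(3)[OF gh]] car in auto)
      also have "\<dots> = (T g * z0 h + z0 g * S h) * S (?i h)"
        unfolding i using coc_mul[OF z0 gM hM] by simp
      also have "\<dots> = T g * z0 h * S (?i h) + z0 g * S h * S (?i h)"
        using car car' by (simp add: add_mult_distrib_mat[of _ t s _ _ s])
      also have "z0 g * S h * S (?i h) = z0 g * (S h * S (?i h))"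
        using car car' by (simp add: assoc_mult_mat[of _ t s _ s _ s])
      also have "\<dots> = z0 g" using SG[OF h] car by simp
      also have "T g * z0 h * S (?i h) = T g * ?B h"
        using car car' by (simp add: assoc_mult_mat[of _ t t _ s _ s])
      finally show ?thesis .
    qed
    have "(A * S g) $$ (i, j) = (T g * A + z0 g) $$ (i, j)" if ij: "i < t" "j < s" for i j
    proof -
      let ?c = "inverse (of_nat (card ?G)) :: 'k"
      have "(A * S g) $$ (i, j) = (\<Sum>l<s. ?c * (\<Sum>h\<in>?G. ?B h $$ (i, l)) * S g $$ (l, j))"
        using ij car A by (simp add: scalar_prod_def lessThan_atLeast0 A_def)
      also have "\<dots> = ?c * (\<Sum>h\<in>?G. \<Sum>l<s. ?B h $$ (i, l) * S g $$ (l, j))"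
        by (simp add: sum_distrib_left sum_distrib_right mult.assoc) (rule sum.swap)
      also have "\<dots> = ?c * (\<Sum>h\<in>?G. (?B h * S g) $$ (i, j))"
        using ij car B by (simp add: mat_mult_entry[of _ t s _ s])
      \<comment> \<open>Left translation by \<open>g\<close> reindexes the sum and so brings in the
        cocycle identity in the form of \<open>step\<close>.\<close>
      also have "(\<Sum>h\<in>?G. (?B h * S g) $$ (i, j)) = (\<Sum>h\<in>?G. (?B (g \<cdot> h) * S g) $$ (i, j))"
      proof (rule sum.reindex_bij_witness[symmetric, where i = "\<lambda>h. ?i g \<cdot> h" and j = "\<lambda>h. g \<cdot> h"])
        fix h assume h: "h \<in> ?G"
        have "g \<cdot> (?i g \<cdot> h) = (g \<cdot> ?i g) \<cdot> h" "?i g \<cdot> (g \<cdot> h) = (?i g \<cdot> g) \<cdot> h"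
          using g h G by (simp_all add: assoc)
        then show "g \<cdot> (?i g \<cdot> h) = h" "?i g \<cdot> (g \<cdot> h) = h"
          using ginv_left[OF e g] ginv_right[OF e g] h Gp_iff[OF e] by simp_all
      qed (use g e in auto)
      also have "\<dots> = (\<Sum>h\<in>?G. (T g * ?B h) $$ (i, j) + z0 g $$ (i, j))"
      proof (rule sum.cong[OF refl])
        fix h assume h: "h \<in> ?G"
        show "(?B (g \<cdot> h) * S g) $$ (i, j) = (T g * ?B h) $$ (i, j) + z0 g $$ (i, j)"
          unfolding step[OF h] using ij car B[OF h] by simp
      qed
      also have "\<dots> = (\<Sum>h\<in>?G. \<Sum>l<t. T g $$ (i, l) * ?B h $$ (l, j)) + of_nat (card ?G) * z0 g $$ (i, j)"
        using ij car B by (simp add: sum.distrib mat_mult_entry[of _ t t _ s])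
      also have "(\<Sum>h\<in>?G. \<Sum>l<t. T g $$ (i, l) * ?B h $$ (l, j))
          = (\<Sum>l<t. T g $$ (i, l) * (\<Sum>h\<in>?G. ?B h $$ (l, j)))"
        by (subst sum.swap) (simp add: sum_distrib_left)
      also have "?c * (\<dots> + of_nat (card ?G) * z0 g $$ (i, j))
          = (\<Sum>l<t. T g $$ (i, l) * (?c * (\<Sum>h\<in>?G. ?B h $$ (l, j)))) + z0 g $$ (i, j)"
        using card by (simp add: distrib_left sum_distrib_left mult.left_commute)
      also have "\<dots> = (T g * A + z0 g) $$ (i, j)"
        using ij car A by (simp add: scalar_prod_def lessThan_atLeast0 A_def)
      finally show ?thesis .
    qed
    then have "A * S g = T g * A + z0 g" using A car by (intro eq_matI) auto
    then show ?thesis using A car by (intro eq_matI) auto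
  qed
  define z where "z x = z0 x + cob A x" for x
  have z: "coc z" unfolding z_def by (rule coc_add_cob[OF z0 A])
  have zG: "z g = 0\<^sub>m t s" if "g \<in> ?G" for g using key[OF that] by (simp add: z_def)
  have ze: "z e = 0\<^sub>m t s" using zG e by simp
  have "z x = 0\<^sub>m t s" if x: "x \<in> M" for x
  proof (cases "J e \<subseteq> J x")
    case True
    have "z (x \<cdot> e) = z x"
      using coc_mul[OF z x eM] S_1[OF e] T_car[OF x] coc_car[OF z x] ze by simp
    moreover have "z (e \<cdot> (x \<cdot> e)) = z (x \<cdot> e)"
      using coc_mul[OF z eM, of "x \<cdot> e"] T_1[OF e] eq S_car[of "x \<cdot> e"] coc_car[OF z, of "x \<cdot> e"] x ze by simp
    moreover have "e \<cdot> (x \<cdot> e) \<in> ?G" using local_Gp[OF e x True] x by (simp add: assoc)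
    ultimately show ?thesis using zG by metis
  next
    case False
    then show ?thesis using coc_vanish[OF z x] eq by simp
  qed
  then show "Z \<in> coboundaries M s S t T"
    using coboundaryI[OF Z A] unfolding z_def z0_def by blast
qed

end

section \<open>The permutation module\<close>

locale idem_pair = fin_orthogroup M mul uu for M :: "'a set" and mul (infixl \<open>\<cdot>\<close> 70) and uu +
  fixes e f :: 'a
  assumes e: "idm e" and f: "idm f" and lt: "idem_less mul e f" and Jlt: "J e \<subset> J f"
begin

abbreviation "Ge \<equiv> Gp M mul e"
abbreviation "Gf \<equiv> Gp M mul f"
abbreviation "X \<equiv> TT M mul e f"
abbreviation "Q \<equiv> eqv M mul uu e f"
abbreviation "cl \<equiv> cls M mul uu e f"
abbreviation "ie \<equiv> ginv M mul e"
abbreviation "jf \<equiv> ginv M mul f"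

lemma eM [simp]: "e \<in> M" and fM [simp]: "f \<in> M"
  using e f by auto

lemma ee [simp]: "e \<cdot> e = e" and ff [simp]: "f \<cdot> f = f" and ef [simp]: "e \<cdot> f = e" and fe [simp]: "f \<cdot> e = e"
  using e f lt by (auto simp: idem_def idem_less_def)

text \<open>Since \<open>f\<close> lies above \<open>e\<close>, multiplication by \<open>f\<close>
  on the left does not change the ideal of an element of \<open>Lcl M mul e\<close>. So
  \<open>X\<close> is the part of \<open>f M e\<close> with the ideal of \<open>e\<close>, a
  description free of left ideals.\<close>

lemma X_iff: "x \<in> X \<longleftrightarrow> x \<in> M \<and> f \<cdot> x = x \<and> x \<cdot> e = x \<and> J x = J e"
proof
  assume "x \<in> X"
  then obtain y where y: "x = f \<cdot> y" "y \<in> M" "y \<cdot> e = y" "J y = J e" unfolding TT_def using Lcl_iff[OF e] by blast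
  have "J x = J e" using J_mul_eq(2)[of y f] y Jlt by auto
  moreover have "f \<cdot> (f \<cdot> y) = f \<cdot> y" using y by (simp flip: assoc)
  moreover have "f \<cdot> y \<cdot> e = f \<cdot> y" using y by (simp add: assoc)
  ultimately show "x \<in> M \<and> f \<cdot> x = x \<and> x \<cdot> e = x \<and> J x = J e" using y by auto
next
  assume "x \<in> M \<and> f \<cdot> x = x \<and> x \<cdot> e = x \<and> J x = J e"
  then have "x = f \<cdot> x" "x \<in> Lcl M mul e" using Lcl_iff[OF e] by auto
  then show "x \<in> X" unfolding TT_def by blast
qed

lemma X_I: "x \<in> M \<Longrightarrow> f \<cdot> x = x \<Longrightarrow> x \<cdot> e = x \<Longrightarrow> J x = J e \<Longrightarrow> x \<in> X"
  using X_iff by blast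

lemma X_in [simp]: "x \<in> X \<Longrightarrow> x \<in> M" and X_f [simp]: "x \<in> X \<Longrightarrow> f \<cdot> x = x"
  and X_e [simp]: "x \<in> X \<Longrightarrow> x \<cdot> e = x" and X_J: "x \<in> X \<Longrightarrow> J x = J e"
  using X_iff by blast+

lemma finite_X: "finite X"
  by (rule finite_subset[OF _ fin], rule subsetI, rule X_in)

lemma Ge_X: "g \<in> Ge \<Longrightarrow> g \<in> X"
proof -
  assume g: "g \<in> Ge"
  then have "f \<cdot> g = f \<cdot> (e \<cdot> g)" using Gp_iff[OF e] by simp
  also have "\<dots> = (f \<cdot> e) \<cdot> g" using g Gp_in[OF e] by (intro assoc[symmetric]) auto
  also have "\<dots> = g" using g Gp_iff[OF e] by simp
  finally show ?thesis using g Gp_iff[OF e, of g] by (intro X_I) auto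
qed

text \<open>On \<open>X\<close> one has \<open>e x = e x e\<close>. Together with
  \<open>Ge_X\<close> this makes \<open>x \<mapsto> e x\<close> a retraction of \<open>X\<close>
  onto the group \<open>Ge\<close>.\<close>

lemma eX: "x \<in> X \<Longrightarrow> e \<cdot> x \<in> Ge"
proof -
  assume x: "x \<in> X"
  have "e \<cdot> x \<cdot> e \<in> Ge" by (rule local_Gp[OF e]) (use x X_J in auto)
  then show ?thesis using x by (simp add: assoc)
qed

lemma fme_X: "m \<in> M \<Longrightarrow> J e \<subseteq> J m \<Longrightarrow> f \<cdot> m \<cdot> e \<in> X"
proof -
  assume m: "m \<in> M" "J e \<subseteq> J m"
  have "J (f \<cdot> m \<cdot> e) = J e"
    using J_mul_eq(2)[of e "f \<cdot> m"] J_le_mul_iff[of f m e] m Jlt by auto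
  moreover have "f \<cdot> (f \<cdot> m \<cdot> e) = (f \<cdot> f) \<cdot> m \<cdot> e" "f \<cdot> m \<cdot> e \<cdot> e = f \<cdot> m \<cdot> (e \<cdot> e)"
    using m by (simp_all add: assoc del: ff ee)
  ultimately show ?thesis using m by (intro X_I) simp_all
qed

text \<open>\<open>m \<mapsto> e m e\<close> is multiplicative above \<open>J e\<close>, and \<open>x = x e\<close> on \<open>X\<close>.\<close>
lemma e_mul_e:
  assumes m: "m \<in> M" "J e \<subseteq> J m" and x: "x \<in> M" "x \<cdot> e = x" "J x = J e"
  shows "e \<cdot> (m \<cdot> x) = e \<cdot> (m \<cdot> (e \<cdot> x))"
proof -
  have "e \<cdot> m \<cdot> x \<cdot> e = (e \<cdot> m \<cdot> e) \<cdot> (e \<cdot> x \<cdot> e)" by (rule local_hom[OF e]) (use assms in auto)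
  also have "\<dots> = e \<cdot> m \<cdot> (e \<cdot> e) \<cdot> (x \<cdot> e)" using m x by (simp add: assoc del: ee)
  finally show ?thesis using m x by (simp add: assoc)
qed

lemma J_Gf: "g \<in> Gf \<Longrightarrow> J e \<subseteq> J g"
  using Gp_iff[OF f] Jlt by auto

lemma J_Ge: "g \<in> Ge \<Longrightarrow> J g = J e"
  using Gp_iff[OF e] by auto

lemma Gf_in [simp]: "g \<in> Gf \<Longrightarrow> g \<in> M" and Ge_in [simp]: "h \<in> Ge \<Longrightarrow> h \<in> M"
  using Gp_in e f by auto

lemma Gf_f [simp]: "g \<in> Gf \<Longrightarrow> f \<cdot> g = g" "g \<in> Gf \<Longrightarrow> g \<cdot> f = g"
  and Ge_e [simp]: "h \<in> Ge \<Longrightarrow> e \<cdot> h = h" "h \<in> Ge \<Longrightarrow> h \<cdot> e = h"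
  using Gp_iff[OF e, of h] Gp_iff[OF f, of g] by blast+

lemma gxh_X:
  assumes g: "g \<in> Gf" and x: "x \<in> X" and h: "h \<in> Ge"
  shows "g \<cdot> x \<cdot> h \<in> X"
proof -
  have "J (g \<cdot> x) = J e" using J_mul_eq(2)[of x g] g x J_Gf X_J by auto
  then have "J (g \<cdot> x \<cdot> h) = J e" using J_mul_eq(1)[of "g \<cdot> x" h] J_Ge[OF h] g x h by auto
  moreover have "f \<cdot> (g \<cdot> x \<cdot> h) = (f \<cdot> g) \<cdot> x \<cdot> h" using g x h by (simp add: assoc del: Gf_f)
  moreover have "g \<cdot> x \<cdot> h \<cdot> e = g \<cdot> x \<cdot> (h \<cdot> e)" using g x h by (simp add: assoc)
  ultimately show ?thesis using g x h by (intro X_I) simp_all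
qed

lemma equiv_Q: "equiv X Q"
proof -
  let ?R = "genrel M mul uu e f \<inter> (X \<times> X)"
  have "sym ((?R \<union> ?R\<inverse>)\<^sup>*)" by (rule sym_rtrancl) (auto simp: sym_def)
  then have "sym Q" unfolding eqv_def Let_def sym_def by blast
  moreover have "trans Q" unfolding eqv_def Let_def trans_def by (auto intro: rtrancl_trans)
  moreover have "refl_on X Q" unfolding eqv_def Let_def refl_on_def by blast
  moreover have "Q \<subseteq> X \<times> X" unfolding eqv_def Let_def by blast
  ultimately show ?thesis by (auto simp: equiv_def)
qed

lemma cl_eq_iff: "x \<in> X \<Longrightarrow> y \<in> X \<Longrightarrow> cl x = cl y \<longleftrightarrow> (x, y) \<in> Q"
  unfolding cls_def by (rule eq_equiv_class_iff[OF equiv_Q])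

lemma genrel_Q: "(x, y) \<in> genrel M mul uu e f \<Longrightarrow> x \<in> X \<Longrightarrow> y \<in> X \<Longrightarrow> (x, y) \<in> Q"
  unfolding eqv_def Let_def by blast

text \<open>Needed because \<open>eqv\<close> intersects the generating relation with
  \<open>X \<times> X\<close>: no pair of kind (a) is lost by this.\<close>

lemma gen_a_in:
  assumes m: "m \<in> M" "J e \<subseteq> J m" and x: "x \<in> M" "x \<cdot> e = x" "J x = J e"
  shows "f \<cdot> (m \<cdot> x) \<in> X" "f \<cdot> (m \<cdot> f \<cdot> x) \<in> X"
proof -
  have "f \<cdot> (m \<cdot> x) \<cdot> e \<in> X" by (rule fme_X) (use J_le_mul_iff[of m x e] m x in auto)
  then show "f \<cdot> (m \<cdot> x) \<in> X" using m x by (simp add: assoc)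
  have "J e \<subseteq> J (m \<cdot> f \<cdot> x)" using J_le_mul_iff[of "m \<cdot> f" x e] J_le_mul_iff[of m f e] m x Jlt by auto
  then have "f \<cdot> (m \<cdot> f \<cdot> x) \<cdot> e \<in> X" by (rule fme_X[rotated]) (use m x in auto)
  then show "f \<cdot> (m \<cdot> f \<cdot> x) \<in> X" using m x by (simp add: assoc)
qed

lemma gen_a:
  assumes m: "m \<in> M" "J e \<subseteq> J m" and x: "x \<in> M" "x \<cdot> e = x" "J x = J e"
  shows "cl (f \<cdot> (m \<cdot> x)) = cl (f \<cdot> (m \<cdot> f \<cdot> x))"
proof -
  have "(f \<cdot> (m \<cdot> x), f \<cdot> (m \<cdot> f \<cdot> x)) \<in> genrel M mul uu e f"
    unfolding genrel_def using m x Lcl_iff[OF e] sigma_J by blast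
  then show ?thesis using genrel_Q cl_eq_iff gen_a_in[OF assms] by blast
qed

lemma gen_b:
  assumes x: "x \<in> X" "x' \<in> X" "e \<cdot> x = e \<cdot> x'"
    and d: "idm d" "f \<cdot> d = d" "d \<cdot> f = d" "J e \<subset> J d" "d \<noteq> f" "d \<cdot> x = x" "d \<cdot> x' = x'"
  shows "cl x = cl x'"
proof -
  have "(x, x') \<in> genrel M mul uu e f"
  proof -
    have "idm d \<and> d \<in> corner M mul f \<and> J e \<subset> sigma M mul uu d \<and> d \<noteq> f \<and> d \<cdot> x = x \<and> d \<cdot> x' = x'"
      using d sigma_J[of d] corner_iff[OF f] by simp
    then show ?thesis unfolding genrel_def using x by blast
  qed
  then show ?thesis using genrel_Q cl_eq_iff x by blast
qed

text \<open>The universal property of the equivalence, since invariance under generating pairs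
  survives symmetric and transitive closure. It is applied to translated classes, to
  \<open>e x\<close> and to normalised cocycles.\<close>

lemma Q_const:
  assumes Q: "(x, y) \<in> Q"
    and a: "\<And>m x. m \<in> M \<Longrightarrow> J e \<subseteq> J m \<Longrightarrow> x \<in> M \<Longrightarrow> x \<cdot> e = x \<Longrightarrow> J x = J e \<Longrightarrow>
      h (f \<cdot> (m \<cdot> x)) = h (f \<cdot> (m \<cdot> f \<cdot> x))"
    and b: "\<And>x x' d. x \<in> X \<Longrightarrow> x' \<in> X \<Longrightarrow> e \<cdot> x = e \<cdot> x' \<Longrightarrow> idm d \<Longrightarrow> f \<cdot> d = d \<Longrightarrow> d \<cdot> f = d \<Longrightarrow>
      J e \<subset> J d \<Longrightarrow> d \<noteq> f \<Longrightarrow> d \<cdot> x = x \<Longrightarrow> d \<cdot> x' = x' \<Longrightarrow> h x = h x'"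
  shows "h x = h y"
proof -
  have gen: "h x = h y" if "(x, y) \<in> genrel M mul uu e f" for x y
  proof -
    from that consider
      (a) m z where "m \<in> M" "z \<in> Lcl M mul e" "J e \<subseteq> sigma M mul uu m"
        "x = f \<cdot> (m \<cdot> z)" "y = f \<cdot> (m \<cdot> f \<cdot> z)"
    | (b) d where "x \<in> X" "y \<in> X" "e \<cdot> x = e \<cdot> y" "idm d" "d \<in> corner M mul f"
        "J e \<subset> sigma M mul uu d" "d \<noteq> f" "d \<cdot> x = x" "d \<cdot> y = y"
      unfolding genrel_def by blast
    then show ?thesis
    proof cases
      case a
      then show ?thesis using assms(2)[of m z] Lcl_iff[OF e] sigma_J by auto
    next
      case b
      then show ?thesis using assms(3)[of x y d] corner_iff[OF f] sigma_J by auto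
    qed
  qed
  let ?R = "genrel M mul uu e f \<inter> (X \<times> X)"
  have "(x, y) \<in> (?R \<union> ?R\<inverse>)\<^sup>*" using Q unfolding eqv_def Let_def by blast
  then show ?thesis
  proof (induction rule: rtrancl_induct)
    case (step y z)
    then show ?case using gen by fastforce
  qed simp
qed

text \<open>Makes the action of \<open>Gf \<times> Ge\<close> on classes well defined. In a pair of
  kind (a), \<open>g\<close> commutes past \<open>f\<close> and is absorbed by \<open>m\<close>,
  while \<open>h\<close> is absorbed by \<open>x\<close>; in a pair of kind (b) the idempotent is
  conjugated by \<open>g\<close>.\<close>

lemma cl_translate:
  assumes g: "g \<in> Gf" and h: "h \<in> Ge" and xy: "x \<in> X" "y \<in> X" "cl x = cl y"
  shows "cl (g \<cdot> x \<cdot> h) = cl (g \<cdot> y \<cdot> h)"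
proof (rule Q_const[where h = "\<lambda>x. cl (g \<cdot> x \<cdot> h)"])
  show "(x, y) \<in> Q" using xy cl_eq_iff by blast
next
  fix m x assume m: "m \<in> M" "J e \<subseteq> J m" and x: "x \<in> M" "x \<cdot> e = x" "J x = J e"
  note M = g h Gf_in[OF g] Ge_in[OF h] m(1) x(1)
  have "g \<cdot> (f \<cdot> (m \<cdot> x)) \<cdot> h = (g \<cdot> f) \<cdot> (m \<cdot> (x \<cdot> h))" using M by (simp add: assoc del: Gf_f)
  also have "\<dots> = (f \<cdot> g) \<cdot> (m \<cdot> (x \<cdot> h))" using g by simp
  also have "\<dots> = f \<cdot> ((g \<cdot> m) \<cdot> (x \<cdot> h))" using M by (simp add: assoc del: Gf_f)
  finally have 1: "g \<cdot> (f \<cdot> (m \<cdot> x)) \<cdot> h = f \<cdot> ((g \<cdot> m) \<cdot> (x \<cdot> h))" .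
  have "g \<cdot> (f \<cdot> (m \<cdot> f \<cdot> x)) \<cdot> h = (g \<cdot> f) \<cdot> (m \<cdot> (f \<cdot> (x \<cdot> h)))" using M by (simp add: assoc del: Gf_f)
  also have "\<dots> = (f \<cdot> g) \<cdot> (m \<cdot> (f \<cdot> (x \<cdot> h)))" using g by simp
  also have "\<dots> = f \<cdot> ((g \<cdot> m) \<cdot> f \<cdot> (x \<cdot> h))" using M by (simp add: assoc del: Gf_f)
  finally have 2: "g \<cdot> (f \<cdot> (m \<cdot> f \<cdot> x)) \<cdot> h = f \<cdot> ((g \<cdot> m) \<cdot> f \<cdot> (x \<cdot> h))" .
  show "cl (g \<cdot> (f \<cdot> (m \<cdot> x)) \<cdot> h) = cl (g \<cdot> (f \<cdot> (m \<cdot> f \<cdot> x)) \<cdot> h)"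
    unfolding 1 2
  proof (rule gen_a)
    show "J e \<subseteq> J (g \<cdot> m)" using J_le_mul_iff[of g m e] M m J_Gf[OF g] by auto
    show "J (x \<cdot> h) = J e" using J_mul_eq(1)[of x h] M x J_Ge[OF h] by auto
    show "x \<cdot> h \<cdot> e = x \<cdot> h" using M by (simp add: assoc)
  qed (use M in auto)
next
  fix x x' d assume x: "x \<in> X" "x' \<in> X" "e \<cdot> x = e \<cdot> x'"
    and d: "idm d" "f \<cdot> d = d" "d \<cdot> f = d" "J e \<subset> J d" "d \<noteq> f" "d \<cdot> x = x" "d \<cdot> x' = x'"
  let ?g = "jf g"
  have g': "?g \<in> Gf" "g \<cdot> ?g = f" "?g \<cdot> g = f" using ginv[OF f g] f by auto
  \<comment> \<open>The conjugate fixes the translates of everything that \<open>d\<close> fixes;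
    conjugating back shows that it still lies strictly above \<open>e\<close> and differs from
    \<open>f\<close>.\<close>
  let ?d = "g \<cdot> d \<cdot> ?g"
  have M: "g \<in> M" "h \<in> M" "?g \<in> M" "d \<in> M" using g h g' d by auto
  have dx: "?d \<cdot> (g \<cdot> y \<cdot> h) = g \<cdot> y \<cdot> h" if "y \<in> X" "d \<cdot> y = y" for y
  proof -
    have "?d \<cdot> (g \<cdot> y \<cdot> h) = g \<cdot> (d \<cdot> (?g \<cdot> g)) \<cdot> y \<cdot> h" using M that by (simp add: assoc)
    also have "\<dots> = g \<cdot> (d \<cdot> y) \<cdot> h" unfolding g'(3) d(3) using M that(1) by (simp add: assoc)
    finally show ?thesis using that by simp
  qed
  have ed: "e \<cdot> (g \<cdot> y \<cdot> h) = e \<cdot> (g \<cdot> (e \<cdot> y)) \<cdot> h" if "y \<in> X" for y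
    using e_mul_e[OF M(1) J_Gf[OF g], of y] that X_J M by (simp flip: assoc)
  show "cl (g \<cdot> x \<cdot> h) = cl (g \<cdot> x' \<cdot> h)"
  proof (rule gen_b[of _ _ ?d])
    show "g \<cdot> x \<cdot> h \<in> X" "g \<cdot> x' \<cdot> h \<in> X" using gxh_X g h x by auto
    show "e \<cdot> (g \<cdot> x \<cdot> h) = e \<cdot> (g \<cdot> x' \<cdot> h)" using ed x by simp
    have "?d \<cdot> ?d = g \<cdot> (d \<cdot> (?g \<cdot> g) \<cdot> d) \<cdot> ?g" using M by (simp add: assoc)
    also have "\<dots> = ?d" unfolding g'(3) d(3) using d(1) by (simp add: idem_def)
    finally show "idm ?d" using M by (simp add: idem_def)
    have "f \<cdot> ?d = (f \<cdot> g) \<cdot> d \<cdot> ?g" using M by (simp add: assoc)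
    then show "f \<cdot> ?d = ?d" using g by simp
    have "?d \<cdot> f = g \<cdot> d \<cdot> (?g \<cdot> f)" using M by (simp add: assoc)
    then show "?d \<cdot> f = ?d" using g' by simp
    have "?g \<cdot> ?d \<cdot> g = (?g \<cdot> g) \<cdot> d \<cdot> (?g \<cdot> g)" using M by (simp add: assoc)
    also have "\<dots> = d" unfolding g'(3) using d by simp
    finally have bk: "?g \<cdot> ?d \<cdot> g = d" .
    have "J d \<subseteq> J ?d" by (rule J_leI[of ?g _ g]) (use M bk in auto)
    then show "J e \<subset> J ?d" using d(4) by blast
    show "?d \<noteq> f"
    proof
      assume "?d = f"
      then have "d = (?g \<cdot> f) \<cdot> g" using bk by simp
      then show False using g' d(5) by simp
    qed
  qed (use dx x d in auto)
qed

lemma cl_in [simp]: "x \<in> X \<Longrightarrow> cl x \<in> X // Q"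
  unfolding cls_def by (rule quotientI)

lemma class_some:
  assumes "c \<in> X // Q"
  shows "(SOME x. x \<in> c) \<in> X" "cl (SOME x. x \<in> c) = c"
proof -
  obtain x where x: "x \<in> X" "c = Q `` {x}" using assms by (rule quotientE)
  have "x \<in> c" using x equiv_class_self[OF equiv_Q] by simp
  then have s: "(SOME x. x \<in> c) \<in> c" by (rule someI)
  then show 1: "(SOME x. x \<in> c) \<in> X" using x equiv_Q by (auto simp: equiv_def)
  have "(x, SOME x. x \<in> c) \<in> Q" using s x by auto
  then have "cl (SOME x. x \<in> c) = cl x" using cl_eq_iff[OF x(1) 1] by simp
  also have "cl x = c" unfolding cls_def by (rule x(2)[symmetric])
  finally show "cl (SOME x. x \<in> c) = c" .
qed

abbreviation "GG \<equiv> Gf \<times> Ge"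
abbreviation "mG \<equiv> \<lambda>g h. (fst g \<cdot> fst h, snd g \<cdot> snd h)"
abbreviation "iG \<equiv> \<lambda>g. (jf (fst g), ie (snd g))"
abbreviation "pG \<equiv> clsmap M mul uu e f"

text \<open>\<open>clsmap\<close> evaluates at a chosen representative; by
  \<open>cl_translate\<close> the choice does not matter.\<close>

lemma clsmap_cl:
  assumes g: "gh \<in> GG" and x: "x \<in> X"
  shows "pG gh (cl x) = cl (fst gh \<cdot> x \<cdot> ie (snd gh))"
  unfolding clsmap_def
  by (rule cl_translate) (use g x class_some[OF cl_in[OF x]] ginv_in[OF e] in auto)

lemma fgrp_GG: "fgrp GG mG (f, e) iG"
proof
  show "finite GG" using finite_Gp e f by simp
qed (use e f ginv in \<open>auto simp: assoc ginv_mul ginv_ginv mem_Times_iff\<close>)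

lemma e_gxh:
  assumes g: "g \<in> Gf" and x: "x \<in> X" and h: "h \<in> Ge"
  shows "e \<cdot> (g \<cdot> x \<cdot> h) = e \<cdot> (g \<cdot> (e \<cdot> x) \<cdot> h)"
proof -
  have "e \<cdot> (g \<cdot> x \<cdot> h) = e \<cdot> (g \<cdot> x) \<cdot> h" using g x h by (simp add: assoc)
  also have "e \<cdot> (g \<cdot> x) = e \<cdot> (g \<cdot> (e \<cdot> x))" by (rule e_mul_e) (use g x J_Gf X_J in auto)
  finally show ?thesis using g x h by (simp add: assoc)
qed

text \<open>Multiplication by \<open>e\<close> on the left turns the generating pairs into
  equalities: kind (a) by \<open>e_mul_e\<close>, kind (b) by definition. So the retraction onto
  \<open>Ge\<close> descends to classes, and distinct elements of \<open>Ge\<close> have distinct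
  classes.\<close>

lemma cl_eq_e:
  assumes "x \<in> X" "y \<in> X" "cl x = cl y"
  shows "e \<cdot> x = e \<cdot> y"
proof (rule Q_const[where h = "\<lambda>x. e \<cdot> x"])
  show "(x, y) \<in> Q" using assms cl_eq_iff by blast
next
  fix m x assume m: "m \<in> M" "J e \<subseteq> J m" and x: "x \<in> M" "x \<cdot> e = x" "J x = J e"
  have fx: "f \<cdot> x \<in> M" "f \<cdot> x \<cdot> e = f \<cdot> x" "J (f \<cdot> x) = J e"
    using x J_mul_eq(2)[of x f] Jlt by (auto simp: assoc)
  have "e \<cdot> (f \<cdot> (m \<cdot> f \<cdot> x)) = (e \<cdot> f) \<cdot> (m \<cdot> (f \<cdot> x))" using m x by (simp add: assoc del: ef)
  also have "\<dots> = e \<cdot> (m \<cdot> (f \<cdot> x))" by simp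
  also have "\<dots> = e \<cdot> (m \<cdot> (e \<cdot> (f \<cdot> x)))" by (rule e_mul_e[OF m fx])
  also have "e \<cdot> (f \<cdot> x) = e \<cdot> x" using x assoc[of e f x] by simp
  also have "e \<cdot> (m \<cdot> (e \<cdot> x)) = e \<cdot> (m \<cdot> x)" by (rule e_mul_e[OF m x, symmetric])
  also have "\<dots> = e \<cdot> (f \<cdot> (m \<cdot> x))" using m x assoc[of e f "m \<cdot> x"] by simp
  finally show "e \<cdot> (f \<cdot> (m \<cdot> x)) = e \<cdot> (f \<cdot> (m \<cdot> f \<cdot> x))" by simp
qed

definition dd :: "'a \<Rightarrow> ('a set \<Rightarrow> 'k::field)" where
  "dd x = delta (cl x) - delta (cl (e \<cdot> x))"

end

locale idem_pair_rep = idem_pair M mul uu e f for M :: "'a set" and mul (infixl \<open>\<cdot>\<close> 70) and uu e f +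
  fixes n and \<rho> :: "'a \<times> 'a \<Rightarrow> 'k::field mat"
  assumes rho: "mrep (Gp M mul f \<times> Gp M mul e) (\<lambda>g h. (mul (fst g) (fst h), mul (snd g) (snd h))) (f, e) n \<rho>"
    and cG: "of_nat (card (Gp M mul e)) \<noteq> (0::'k)" "of_nat (card (Gp M mul f)) \<noteq> (0::'k)"
begin

sublocale fgrp_perm GG mG "(f, e)" iG n \<rho> "X // Q" pG
proof (intro fgrp_perm.intro fgrp_rep.intro fgrp_rep_axioms.intro fgrp_perm_axioms.intro)
  show "fgrp GG mG (f, e) iG" by (rule fgrp_GG)
  show "of_nat (card GG) \<noteq> (0::'k)" using cG by (simp add: card_cartesian_product)
  show "mrep GG mG (f, e) n \<rho>" by (rule rho)
  show "finite (X // Q)" 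
    by (rule finite_quotient[OF finite_X]) (use equiv_Q in \<open>simp add: equiv_def\<close>)
next
  fix g c assume g: "g \<in> GG" and c: "c \<in> X // Q"
  obtain x where x: "x \<in> X" "c = cl x" using class_some[OF c] by metis
  show "pG g c \<in> X // Q"
    unfolding x(2) clsmap_cl[OF g x(1)] by (rule cl_in, rule gxh_X) (use g x e ginv_in in auto)
  fix h assume h: "h \<in> GG"
  have hX: "fst h \<cdot> x \<cdot> ie (snd h) \<in> X" by (rule gxh_X) (use h x e ginv_in in auto)
  have gh: "mG g h \<in> GG" using g h e f by auto
  have M: "fst g \<in> M" "fst h \<in> M" "ie (snd g) \<in> M" "ie (snd h) \<in> M" "x \<in> M"
    using g h x ginv_in[OF e] by (auto simp: mem_Times_iff)
  have "fst (mG g h) \<cdot> x \<cdot> ie (snd (mG g h)) = fst g \<cdot> (fst h \<cdot> x \<cdot> ie (snd h)) \<cdot> ie (snd g)"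
    using g h M ginv_mul[OF e, of "snd g" "snd h"] by (simp add: assoc mem_Times_iff)
  then show "pG (mG g h) c = pG g (pG h c)"
    unfolding x(2) clsmap_cl[OF gh x(1)] clsmap_cl[OF h x(1)] clsmap_cl[OF g hX] by simp
next
  fix c assume c: "c \<in> X // Q"
  obtain x where x: "x \<in> X" "c = cl x" using class_some[OF c] by metis
  show "pG (f, e) c = c" unfolding x(2) by (subst clsmap_cl) (use x e f ginv_one in auto)
qed

abbreviation "VX \<equiv> VXY M mul uu e f :: ('a set \<Rightarrow> 'k) set"

lemma perm_act_eq: "perm_act = act M mul uu e f"
  by (intro ext) (simp add: perm_act_def act_def)

lemma VX_span: "VX = V.span (dd ` X)"
proof -
  let ?D = "{delta (cl x) - delta (cl (e \<cdot> x)) | x. x \<in> X - Ge} :: ('a set \<Rightarrow> 'k) set"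
  have VX: "VX = V.span ?D" unfolding VXY_def ..
  have "dd x \<in> V.span ?D" if "x \<in> X" for x
  proof (cases "x \<in> Ge")
    case True
    then show ?thesis by (simp add: dd_def V.span_zero)
  next
    case False
    then show ?thesis using that unfolding dd_def by (intro V.span_base) blast
  qed
  then have "V.span (dd ` X) \<subseteq> V.span ?D" by (intro V.span_minimal) auto
  moreover have "V.span ?D \<subseteq> V.span (dd ` X)" by (rule V.span_mono) (auto simp: dd_def)
  ultimately show ?thesis using VX by simp
qed

lemma dd_VX: "x \<in> X \<Longrightarrow> dd x \<in> VX"
  unfolding VX_span by (rule V.span_base) blast

lemma dd_diff: "x \<in> X \<Longrightarrow> y \<in> X \<Longrightarrow> e \<cdot> x = e \<cdot> y \<Longrightarrow> dd x - dd y = delta (cl x) - delta (cl y)"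
  by (simp add: dd_def)

text \<open>The translate of \<open>e x\<close> need not lie in \<open>Ge\<close>, so the image need
  not be a single vector \<open>dd\<close>. By \<open>e_gxh\<close> both translates have the same
  product with \<open>e\<close>, whose class cancels in the difference.\<close>

lemma act_dd:
  assumes g: "g \<in> GG" and x: "x \<in> X"
  shows "perm_act g (dd x) = dd (fst g \<cdot> x \<cdot> ie (snd g)) - dd (fst g \<cdot> (e \<cdot> x) \<cdot> ie (snd g))"
proof -
  have i: "fst g \<in> Gf" "ie (snd g) \<in> Ge" using g ginv_in[OF e] by (auto simp: mem_Times_iff)
  have exX: "e \<cdot> x \<in> X" using Ge_X eX x by blast
  have "perm_act g (dd x) = perm_act g (delta (cl x)) - perm_act g (delta (cl (e \<cdot> x)))"
    by (simp add: dd_def perm_act_def sum_subtractf fun_eq_iff)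
  also have "\<dots> = delta (cl (fst g \<cdot> x \<cdot> ie (snd g))) - delta (cl (fst g \<cdot> (e \<cdot> x) \<cdot> ie (snd g)))"
    by (simp add: perm_act_delta[OF cl_in] x exX clsmap_cl[OF g])
  also have "\<dots> = dd (fst g \<cdot> x \<cdot> ie (snd g)) - dd (fst g \<cdot> (e \<cdot> x) \<cdot> ie (snd g))"
    by (rule dd_diff[OF gxh_X[OF i(1) x i(2)] gxh_X[OF i(1) exX i(2)] e_gxh[OF i(1) x i(2)], symmetric])
  finally show ?thesis .
qed

lemma VX_sub: "VX \<subseteq> perm_space"
  unfolding VX_span
proof (rule V.span_minimal[OF _ subspace_perm_space], rule subsetI)
  fix v :: "'a set \<Rightarrow> 'k" assume "v \<in> dd ` X"
  then obtain x where x: "x \<in> X" "v = delta (cl x) - delta (cl (e \<cdot> x))" by (auto simp: dd_def)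
  then show "v \<in> perm_space"
    using V.subspace_diff[OF subspace_perm_space] delta_in_perm_space cl_in Ge_X eX by metis
qed

lemma VX_induct:
  assumes v: "v \<in> VX" and base: "\<And>x. x \<in> X \<Longrightarrow> P (dd x)"
    and add: "\<And>v w. v \<in> VX \<Longrightarrow> w \<in> VX \<Longrightarrow> P v \<Longrightarrow> P w \<Longrightarrow> P (v + w)"
    and scale: "\<And>c v. v \<in> VX \<Longrightarrow> P v \<Longrightarrow> P (vscale c v)" and zero: "P 0"
  shows "P v"
proof -
  have "VX \<subseteq> {v \<in> VX. P v}"
  proof (subst VX_span, rule V.span_minimal)
    show "dd ` X \<subseteq> {v \<in> VX. P v}" using base dd_VX by auto
    have "V.subspace VX" unfolding VX_span by (rule V.subspace_span)
    then show "V.subspace {v \<in> VX. P v}" using add scale zero unfolding V.subspace_def by auto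
  qed
  then show ?thesis using v by blast
qed

lemma invsub_VX: "invsub GG perm_act VX"
proof -
  have sub: "V.subspace VX" unfolding VX_span by (rule V.subspace_span)
  have "perm_act g v \<in> VX" if g: "g \<in> GG" and v: "v \<in> VX" for g v
    using v
  proof (rule VX_induct)
    fix x assume x: "x \<in> X"
    have "fst g \<in> Gf" "ie (snd g) \<in> Ge" using g ginv_in[OF e] by (auto simp: mem_Times_iff)
    then show "perm_act g (dd x) \<in> VX"
      unfolding act_dd[OF g x] using V.subspace_diff[OF sub] dd_VX gxh_X x Ge_X eX by metis
  next
    fix v w assume "v \<in> VX" "w \<in> VX" "perm_act g v \<in> VX" "perm_act g w \<in> VX"
    then show "perm_act g (v + w) \<in> VX" 
      using act.a_add[OF g subsetD[OF VX_sub] subsetD[OF VX_sub]] V.subspace_add[OF sub] by simp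
  next
    fix c v assume "v \<in> VX" "perm_act g v \<in> VX"
    then show "perm_act g (vscale c v) \<in> VX" 
      using act.a_scale[OF g subsetD[OF VX_sub]] V.subspace_scale[OF sub] by simp
  next
    have "perm_act g 0 = 0" by (simp add: perm_act_def fun_eq_iff)
    then show "perm_act g 0 \<in> VX" using V.subspace_0[OF sub] by simp
  qed
  then show ?thesis using sub unfolding invsub_def fsub_iff_subspace by blast
qed

end

section \<open>Extensions and homomorphisms from the permutation module\<close>

context fin_orthogroup
begin

text \<open>A product is above \<open>e\<close> exactly when both factors are, so the zero values
  are consistent; above \<open>e\<close>, \<open>local_hom\<close> gives multiplicativity and
  \<open>local_Gp_idm\<close> the action of idempotents.\<close>

lemma rep_pair_inflate:
  fixes U W :: "'a \<Rightarrow> 'k::field mat"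
  assumes e: "idm e" and f: "idm f"
    and U: "mrep (Gp M mul e) mul e s U" and W: "mrep (Gp M mul f) mul f t W"
  shows "rep_pair M mul uu e f s t (inflate M mul uu e s U) (inflate M mul uu f t W)"
proof -
  have *: "(x \<in> M \<longrightarrow> inflate M mul uu e s U x \<in> carrier_mat s s)
     \<and> (x \<in> M \<longrightarrow> y \<in> M \<longrightarrow> inflate M mul uu e s U (x \<cdot> y) = inflate M mul uu e s U x * inflate M mul uu e s U y)
     \<and> (x \<in> M \<longrightarrow> \<not> J e \<subseteq> J x \<longrightarrow> inflate M mul uu e s U x = 0\<^sub>m s s)
     \<and> (idm x \<longrightarrow> J e \<subseteq> J x \<longrightarrow> inflate M mul uu e s U x = 1\<^sub>m s)"
    if e: "idm e" and U: "mrep (Gp M mul e) mul e s U" for e s x y and U :: "'a \<Rightarrow> 'k mat"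
  proof (intro conjI impI)
    have car: "U (e \<cdot> x \<cdot> e) \<in> carrier_mat s s" if "x \<in> M" "J e \<subseteq> J x" for x
      using U local_Gp[OF e that] unfolding mrep_def by blast
    show c: "inflate M mul uu e s U x \<in> carrier_mat s s" if "x \<in> M" for x
      using car that by (simp add: inflate_eq)
    show "inflate M mul uu e s U (x \<cdot> y) = inflate M mul uu e s U x * inflate M mul uu e s U y"
      if x: "x \<in> M" and y: "y \<in> M"
    proof (cases "J e \<subseteq> J x \<and> J e \<subseteq> J y")
      case True
      have "e \<cdot> (x \<cdot> y) \<cdot> e = (e \<cdot> x \<cdot> e) \<cdot> (e \<cdot> y \<cdot> e)"
        using local_hom[OF e x y] True x y e by (simp add: assoc)
      moreover have "e \<cdot> x \<cdot> e \<in> Gp M mul e" "e \<cdot> y \<cdot> e \<in> Gp M mul e" using True local_Gp[OF e] x y by auto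
      ultimately show ?thesis
        using U True x y e J_le_mul_iff[of x y e] by (simp add: inflate_eq mrep_def)
    next
      case False
      then have xy: "inflate M mul uu e s U (x \<cdot> y) = 0\<^sub>m s s"
        using x y e J_le_mul_iff[of x y e] by (auto simp: inflate_eq)
      show ?thesis
      proof (cases "J e \<subseteq> J x")
        case True
        then have "inflate M mul uu e s U y = 0\<^sub>m s s" using False y by (simp add: inflate_eq)
        then show ?thesis using xy right_mult_zero_mat[OF c[OF x]] by simp
      next
        case False
        then have "inflate M mul uu e s U x = 0\<^sub>m s s" using x by (simp add: inflate_eq)
        then show ?thesis using xy left_mult_zero_mat[OF c[OF y]] by simp
      qed
    qed
    show "inflate M mul uu e s U x = 0\<^sub>m s s" if "x \<in> M" "\<not> J e \<subseteq> J x"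
      using that by (simp add: inflate_eq)
    show "inflate M mul uu e s U x = 1\<^sub>m s" if "idm x" "J e \<subseteq> J x"
      using that local_Gp_idm[OF e] U by (simp add: inflate_eq mrep_def)
  qed
  show ?thesis
    by standard (use *[OF e U] *[OF f W] e f in blast)+
qed

end

section \<open>Kronecker products in row-major coordinates\<close>

lemma sum_div_mod:
  fixes F :: "nat \<Rightarrow> nat \<Rightarrow> 'k::comm_monoid_add"
  shows "(\<Sum>k<a * b. F (k div b) (k mod b)) = (\<Sum>i<a. \<Sum>j<b. F i j)"
proof -
  have "(\<Sum>k<a * b. F (k div b) (k mod b)) = (\<Sum>i<a. sum (\<lambda>k. F (k div b) (k mod b)) {i * b..<i * b + b})"
    by (rule sum.nat_group[symmetric])
  also have "\<dots> = (\<Sum>i<a. \<Sum>j<b. F i j)"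
  proof (rule sum.cong[OF refl])
    fix i
    show "sum (\<lambda>k. F (k div b) (k mod b)) {i * b..<i * b + b} = (\<Sum>j<b. F i j)"
      by (rule sum.reindex_bij_witness[where i = "\<lambda>j. i * b + j" and j = "\<lambda>k. k - i * b"])
        (auto simp: div_nat_eqI modulo_nat_def algebra_simps)
  qed
  finally show ?thesis .
qed

lemma sum_delta_mult:
  fixes h :: "'b \<Rightarrow> 'k::field"
  assumes "finite A" "a \<in> A"
  shows "(\<Sum>c\<in>A. delta a c * h c) = h a"
proof -
  have "(\<Sum>c\<in>A. delta a c * h c) = (\<Sum>c\<in>A. if c = a then h c else 0)"
    by (rule sum.cong) (auto simp: delta_def)
  then show ?thesis using assms by simp
qed

lemma index_less: "i < a \<Longrightarrow> j < b \<Longrightarrow> i * b + j < a * (b::nat)"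
proof -
  assume ij: "i < a" "j < b"
  have "i * b + j < Suc i * b" using ij by simp
  also have "\<dots> \<le> a * b" using ij by (intro mult_le_mono1) simp
  finally show ?thesis .
qed

lemma div_mod_less: "k < a * b \<Longrightarrow> k div b < a" "k < a * b \<Longrightarrow> k mod b < (b::nat)"
  by (auto simp: less_mult_imp_div_less) (metis mod_less_divisor mult_0_right neq0_conv not_less0)

lemma kron_index:
  "A \<in> carrier_mat a a \<Longrightarrow> B \<in> carrier_mat b b \<Longrightarrow> i < a * b \<Longrightarrow> j < a * b \<Longrightarrow>
    kron A B $$ (i, j) = A $$ (i div b, j div b) * B $$ (i mod b, j mod b)"
  by (auto simp: kron_def)

lemma kron_carrier: "A \<in> carrier_mat a a \<Longrightarrow> B \<in> carrier_mat b b \<Longrightarrow> kron A B \<in> carrier_mat (a * b) (a * b)"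
  by (auto simp: kron_def)

text \<open>Row-major flattening sends position \<open>(i, j)\<close> to \<open>i * b + j\<close>.
  This is the identification of V \<otimes> U* with the matrices of linear maps from U to V, on
  which the two groups act from the two sides.\<close>

lemma kron_vec:
  fixes A B z :: "'k::field mat"
  assumes A: "A \<in> carrier_mat a a" and B: "B \<in> carrier_mat b b" and z: "z \<in> carrier_mat a b" and k: "k < a * b"
  shows "(\<Sum>l<a * b. kron A (transpose_mat B) $$ (k, l) * z $$ (l div b, l mod b))
    = (A * z * B) $$ (k div b, k mod b)"
proof -
  note dm = div_mod_less[OF k]
  have "(\<Sum>l<a * b. kron A (transpose_mat B) $$ (k, l) * z $$ (l div b, l mod b))
    = (\<Sum>l<a * b. A $$ (k div b, l div b) * B $$ (l mod b, k mod b) * z $$ (l div b, l mod b))"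
    by (rule sum.cong[OF refl])
      (use A B k dm div_mod_less in \<open>auto simp: kron_index[of A a "transpose_mat B" b]\<close>)
  also have "\<dots> = (\<Sum>i<a. \<Sum>j<b. A $$ (k div b, i) * B $$ (j, k mod b) * z $$ (i, j))"
    by (rule sum_div_mod)
  also have "\<dots> = (\<Sum>j<b. (\<Sum>i<a. A $$ (k div b, i) * z $$ (i, j)) * B $$ (j, k mod b))"
    by (subst sum.swap) (simp add: sum_distrib_right sum_distrib_left mult_ac)
  also have "\<dots> = (\<Sum>j<b. (A * z) $$ (k div b, j) * B $$ (j, k mod b))"
    by (rule sum.cong[OF refl]) (simp add: mat_mult_entry[OF A z dm(1)])
  also have "\<dots> = (A * z * B) $$ (k div b, k mod b)"
    by (rule mat_mult_entry[OF mult_carrier_mat[OF A z] B dm, symmetric])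
  finally show ?thesis .
qed

lemma kron_mult:
  fixes A B C D :: "'k::field mat"
  assumes A: "A \<in> carrier_mat a a" and C: "C \<in> carrier_mat a a" and B: "B \<in> carrier_mat b b" and D: "D \<in> carrier_mat b b"
  shows "kron (A * C) (B * D) = kron A B * kron C D"
proof (rule eq_matI)
  note AC = mult_carrier_mat[OF A C] and BD = mult_carrier_mat[OF B D]
  have AB: "kron A B \<in> carrier_mat (a * b) (a * b)" and CD: "kron C D \<in> carrier_mat (a * b) (a * b)"
    using kron_carrier A B C D by auto
  fix i j assume "i < dim_row (kron A B * kron C D)" "j < dim_col (kron A B * kron C D)"
  then have ij: "i < a * b" "j < a * b" using AB CD by auto
  note dm = div_mod_less[OF ij(1)] div_mod_less[OF ij(2)]
  have "(kron A B * kron C D) $$ (i, j) = (\<Sum>l<a * b. kron A B $$ (i, l) * kron C D $$ (l, j))"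
    by (rule mat_mult_entry[OF AB CD ij])
  also have "\<dots> = (\<Sum>l<a * b. (A $$ (i div b, l div b) * C $$ (l div b, j div b))
      * (B $$ (i mod b, l mod b) * D $$ (l mod b, j mod b)))"
    by (rule sum.cong[OF refl]) (use ij A B C D in \<open>simp add: kron_index[of _ a _ b] mult_ac\<close>)
  also have "\<dots> = (\<Sum>p<a. \<Sum>q<b. (A $$ (i div b, p) * C $$ (p, j div b)) * (B $$ (i mod b, q) * D $$ (q, j mod b)))"
    by (rule sum_div_mod)
  also have "\<dots> = (A * C) $$ (i div b, j div b) * (B * D) $$ (i mod b, j mod b)"
    by (simp add: mat_mult_entry[OF A C dm(1,3)] mat_mult_entry[OF B D dm(2,4)] sum_product)
  also have "\<dots> = kron (A * C) (B * D) $$ (i, j)" by (rule kron_index[OF AC BD ij, symmetric])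
  finally show "kron (A * C) (B * D) $$ (i, j) = (kron A B * kron C D) $$ (i, j)" by simp
qed (use A B C D in \<open>auto simp: kron_def\<close>)

lemma kron_one: "kron (1\<^sub>m a) (1\<^sub>m b) = (1\<^sub>m (a * b) :: 'k::field mat)"
proof (rule eq_matI)
  fix i j assume "i < dim_row (1\<^sub>m (a * b) :: 'k mat)" "j < dim_col (1\<^sub>m (a * b) :: 'k mat)"
  then have ij: "i < a * b" "j < a * b" by auto
  have "i = j" if "i div b = j div b" "i mod b = j mod b" using that by (metis mult_div_mod_eq)
  then show "kron (1\<^sub>m a) (1\<^sub>m b) $$ (i, j) = (1\<^sub>m (a * b) :: 'k mat) $$ (i, j)"
    using ij div_mod_less[OF ij(1)] div_mod_less[OF ij(2)] kron_index[OF one_carrier_mat one_carrier_mat ij] by auto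
qed (auto simp: kron_def)

context idem_pair
begin

lemma mrep_tensor_dual:
  assumes U: "mrep Ge mul e nu U" and W: "mrep Gf mul f nv (W :: 'a \<Rightarrow> 'k::field mat)"
  shows "mrep GG mG (f, e) (nv * nu) (tensor_dual M mul e W U)"
proof -
  have Uc: "transpose_mat (U (ie h)) \<in> carrier_mat nu nu" if "h \<in> Ge" for h
    using U that ginv_in[OF e] unfolding mrep_def by auto
  have Wc: "W g \<in> carrier_mat nv nv" if "g \<in> Gf" for g using W that unfolding mrep_def by auto
  have "tensor_dual M mul e W U (mG g h) = tensor_dual M mul e W U g * tensor_dual M mul e W U h"
    if "g \<in> GG" "h \<in> GG" for g h
  proof -
    obtain g1 g2 h1 h2 where gh: "g = (g1, g2)" "h = (h1, h2)" by (cases g, cases h)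
    have in': "g1 \<in> Gf" "g2 \<in> Ge" "h1 \<in> Gf" "h2 \<in> Ge" using that gh by auto
    have "U (ie h2) \<in> carrier_mat nu nu" "U (ie g2) \<in> carrier_mat nu nu"
      using U in' ginv_in[OF e] unfolding mrep_def by auto
    then have "transpose_mat (U (ie (g2 \<cdot> h2))) = transpose_mat (U (ie g2)) * transpose_mat (U (ie h2))"
      using U in' ginv_mul[OF e] ginv_in[OF e] transpose_mult[of "U (ie h2)" nu nu "U (ie g2)" nu]
      unfolding mrep_def by simp
    moreover have "W (g1 \<cdot> h1) = W g1 * W h1" using W in' unfolding mrep_def by blast
    ultimately show ?thesis
      unfolding tensor_dual_def gh using kron_mult[OF Wc Wc Uc Uc] in' by simp
  qed
  moreover have "tensor_dual M mul e W U (f, e) = 1\<^sub>m (nv * nu)"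
    using U W ginv_one[OF e] by (simp add: tensor_dual_def mrep_def kron_one)
  ultimately show ?thesis using kron_carrier[OF Wc Uc] by (auto simp: mrep_def tensor_dual_def)
qed

end

section \<open>Cocycles against equivariant maps on the span of the differences of classes\<close>

locale idem_pair_reps = idem_pair M mul uu e f for M :: "'a set" and mul (infixl \<open>\<cdot>\<close> 70) and uu e f +
  fixes nu nv :: nat and U W :: "'a \<Rightarrow> 'k::field mat"
  assumes U: "mrep (Gp M mul e) mul e nu U" and W: "mrep (Gp M mul f) mul f nv W"
    and cG: "of_nat (card (Gp M mul e)) \<noteq> (0::'k)" "of_nat (card (Gp M mul f)) \<noteq> (0::'k)"
begin

abbreviation "S \<equiv> inflate M mul uu e nu U"
abbreviation "T \<equiv> inflate M mul uu f nv W"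
abbreviation "rho \<equiv> tensor_dual M mul e W U"

sublocale R: rep_pair M mul uu e f nu nv S T
  by (rule rep_pair_inflate[OF e f U W])

sublocale P: idem_pair_rep M mul uu e f "nv * nu" rho
  by (intro idem_pair_rep.intro idem_pair_rep_axioms.intro idem_pair_axioms cG mrep_tensor_dual[OF U W])

abbreviation "VX \<equiv> P.VX"
abbreviation "HX \<equiv> homs GG P.perm_act (nv * nu) rho VX"
abbreviation "cocs \<equiv> cocycles M mul nu S nv T"
abbreviation "rp c \<equiv> SOME x. x \<in> c"

lemma Jfe: "\<not> J f \<subseteq> J e"
  using Jlt by blast

lemma S_Ge: "h \<in> Ge \<Longrightarrow> S h = U h"
  using J_Ge by (simp add: inflate_eq)

lemma T_Gf:
  assumes "g \<in> Gf"
  shows "T g = W g"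
proof -
  have g: "g \<in> M" "J g = J f" "f \<cdot> g \<cdot> f = g" using Gp_iff[OF f, of g] assms by auto
  show ?thesis unfolding inflate_eq[OF g(1)] g(2,3) by simp
qed

lemma T_X: "x \<in> M \<Longrightarrow> J x = J e \<Longrightarrow> T x = 0\<^sub>m nv nv"
  using R.T_0 Jfe by simp

lemma S_ex: "x \<in> M \<Longrightarrow> S (e \<cdot> x) = S x"
  using R.S_mul[of e x] R.S_1[OF e] R.S_car[of x] by simp

lemma sum_dd: "x \<in> X \<Longrightarrow> (\<Sum>c\<in>X // Q. dd x c * h c) = h (cl x) - (h (cl (e \<cdot> x)) :: 'k)"
proof -
  assume x: "x \<in> X"
  then have "cl x \<in> X // Q" "cl (e \<cdot> x) \<in> X // Q" using cl_in Ge_X eX by blast+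
  then have "(\<Sum>c\<in>X // Q. delta (cl x) c * h c) = h (cl x)"
    "(\<Sum>c\<in>X // Q. delta (cl (e \<cdot> x)) c * h c) = h (cl (e \<cdot> x))"
    using sum_delta_mult[OF P.finX] by blast+
  then show ?thesis by (simp add: dd_def left_diff_distrib sum_subtractf)
qed

context
  fixes z assumes z: "R.coc z" and ze: "z e = 0\<^sub>m nv nu"
begin

lemma norm_loc: "normalized_coc M mul uu e f nu nv S T z"
  by (intro normalized_coc.intro normalized_coc_axioms.intro R.rep_pair_axioms z ze Jfe)

lemma nz_f: "z f = 0\<^sub>m nv nu"
  using normalized_coc.z_right_e[OF norm_loc, of f] ze by simp

lemma nz_fx: "x \<in> M \<Longrightarrow> z (f \<cdot> x) = z x"
  using R.coc_mul[OF z, of f x] R.T_1[OF f] nz_f z by simp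

lemma nz_xf: "x \<in> M \<Longrightarrow> z (x \<cdot> f) = z x"
  using R.coc_mul[OF z, of x f] R.S_1[OF f] Jlt nz_f z by simp

text \<open>For kind (a), \<open>z\<close> is unchanged by \<open>f\<close> on either side and
  \<open>T (m f) = T m\<close>, so both products expand to the same sum. For kind (b),
  \<open>d\<close> is strictly below \<open>f\<close>, hence \<open>T d = 0\<close>, and
  \<open>z y = z d * S (e y)\<close> depends on \<open>e y\<close> only.\<close>

lemma nz_const:
  assumes "x \<in> X" "y \<in> X" "cl x = cl y"
  shows "z x = z y"
proof (rule Q_const[where h = z])
  show "(x, y) \<in> Q" using assms cl_eq_iff by blast
next
  fix m x assume m: "m \<in> M" and x: "x \<in> M"
  have "T (m \<cdot> f) = T m" using R.T_mul[OF m fM] R.T_1[OF f] R.T_car[OF m] by simp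
  then show "z (f \<cdot> (m \<cdot> x)) = z (f \<cdot> (m \<cdot> f \<cdot> x))"
    using m x R.coc_mul[OF z m x] R.coc_mul[OF z _ x, of "m \<cdot> f"] by (simp add: nz_fx nz_xf)
next
  fix x x' d assume x: "x \<in> X" "x' \<in> X" "e \<cdot> x = e \<cdot> x'"
    and d: "idm d" "f \<cdot> d = d" "d \<cdot> f = d" "J e \<subset> J d" "d \<noteq> f" "d \<cdot> x = x" "d \<cdot> x' = x'"
  have "J d \<noteq> J f" using idm_J_minimal[OF f d(1-3)] d(5) by blast
  moreover have "J d \<subseteq> J f" using J_mul1[of f d] d(1,2) by simp
  ultimately have Td: "T d = 0\<^sub>m nv nv" using R.T_0[of d] d(1) by auto
  have *: "z y = z d * S (e \<cdot> y)" if y: "y \<in> X" "d \<cdot> y = y" for y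
  proof -
    have dM: "d \<in> M" using d(1) by simp
    have "z y = T d * z y + z d * S y" using R.coc_mul[OF z dM, of y] y by simp
    then show ?thesis using Td y dM z S_ex[of y] by simp
  qed
  show "z x = z x'" using *[OF x(1) d(6)] *[OF x(2) d(7)] x(3) by simp
qed

lemma nz_vanish:
  assumes 0: "\<And>x. x \<in> X \<Longrightarrow> z x = 0\<^sub>m nv nu" and m: "m \<in> M"
  shows "z m = 0\<^sub>m nv nu"
proof (cases "J e \<subseteq> J m")
  case True
  have "z m = z (f \<cdot> m \<cdot> e)"
    using m nz_fx[of "m \<cdot> e"] normalized_coc.z_right_e[OF norm_loc m] by (simp add: assoc)
  then show ?thesis using 0[OF fme_X[OF m True]] by simp
next
  case False
  then show ?thesis using R.coc_vanish[OF z m] Jlt by blast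
qed

text \<open>Expanding \<open>z (g x h)\<close> leaves, besides the wanted term,
  \<open>z g * S x * U h\<close>, which depends on \<open>x\<close> only through \<open>e x\<close>.
  The value at \<open>g (e x) h\<close> consists of that term alone because
  \<open>z (e x) = 0\<close>.\<close>

lemma nz_gxh:
  assumes g: "g \<in> Gf" and x: "x \<in> X" and h: "h \<in> Ge" and ij: "i < nv" "j < nu"
  shows "z (g \<cdot> x \<cdot> h) $$ (i, j) - z (g \<cdot> (e \<cdot> x) \<cdot> h) $$ (i, j) = (W g * z x * U h) $$ (i, j)"
proof -
  have M: "g \<in> M" "x \<in> M" "h \<in> M" using g x h by auto
  have split: "z (g \<cdot> y \<cdot> h) = (W g * z y + z g * S y) * U h" if y: "y \<in> M" "J y = J e" for y
  proof -
    have "J (g \<cdot> y) = J e" using J_mul_eq(2)[of y g] y M J_Gf[OF g] by auto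
    then have "z (g \<cdot> y \<cdot> h) = z (g \<cdot> y) * S h"
      using R.coc_mul[OF z, of "g \<cdot> y" h] T_X[of "g \<cdot> y"] M y z by simp
    then show ?thesis using R.coc_mul[OF z M(1) y(1)] S_Ge[OF h] T_Gf[OF g] by simp
  qed
  have Uh: "U h \<in> carrier_mat nu nu" using S_Ge[OF h] R.S_car[OF M(3)] by simp
  have Wg: "W g \<in> carrier_mat nv nv" using T_Gf[OF g] R.T_car[OF M(1)] by simp
  have zx: "z x \<in> carrier_mat nv nu" and zg: "z g * S x \<in> carrier_mat nv nu" using M z by simp_all
  have A: "W g * z x \<in> carrier_mat nv nu" using mult_carrier_mat[OF Wg zx] .
  have 1: "z (g \<cdot> x \<cdot> h) = W g * z x * U h + z g * S x * U h"
    unfolding split[OF M(2) X_J[OF x]] by (rule add_mult_distrib_mat[OF A zg Uh])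
  have 2: "z (g \<cdot> (e \<cdot> x) \<cdot> h) = z g * S x * U h"
  proof -
    have "J (e \<cdot> x) = J e" using J_Ge eX[OF x] by blast
    moreover have "W g * 0\<^sub>m nv nu = 0\<^sub>m nv nu" by (rule right_mult_zero_mat[OF Wg])
    ultimately show ?thesis
      using split[of "e \<cdot> x"] normalized_coc.z_left_e[OF norm_loc M(2)] S_ex[OF M(2)] M zg by simp
  qed
  show ?thesis
    unfolding 1 2 using ij carrier_matD[OF mult_carrier_mat[OF zg Uh]] by (subst index_add_mat(1)) simp_all
qed

end

text \<open>By \<open>nz_props\<close> this is the normalised cocycle at a representative.
  Subtracting the value at \<open>e x\<close> does the work of normalising, and the expression is
  visibly linear in \<open>Z\<close>.\<close>

definition diff_at :: "('a \<Rightarrow> nat \<Rightarrow> nat \<Rightarrow> 'k) \<Rightarrow> 'a set \<Rightarrow> nat \<Rightarrow> nat \<Rightarrow> 'k" where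
  "diff_at Z c i j = Z (rp c) i j - Z (e \<cdot> rp c) i j"

definition to_hom :: "('a \<Rightarrow> nat \<Rightarrow> nat \<Rightarrow> 'k) \<Rightarrow> ('a set \<Rightarrow> 'k) \<times> nat \<Rightarrow> 'k" where
  "to_hom Z = (\<lambda>(v, k). if v \<in> VX \<and> k < nv * nu
     then \<Sum>c\<in>X // Q. v c * diff_at Z c (k div nu) (k mod nu) else 0)"

definition nz :: "('a \<Rightarrow> nat \<Rightarrow> nat \<Rightarrow> 'k) \<Rightarrow> 'a \<Rightarrow> 'k mat" where
  "nz Z x = tomat nv nu (Z x) + (T x * tomat nv nu (Z e) - tomat nv nu (Z e) * S x)"

lemma nz_props:
  assumes Z: "Z \<in> cocs"
  shows "R.coc (nz Z)" "nz Z e = 0\<^sub>m nv nu"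
    and "x \<in> X \<Longrightarrow> i < nv \<Longrightarrow> j < nu \<Longrightarrow> nz Z x $$ (i, j) = Z x i j - Z (e \<cdot> x) i j"
proof -
  have c: "R.coc (\<lambda>x. tomat nv nu (Z x))" using Z cocycles_iff[where mul = mul] by blast
  show "R.coc (nz Z)" "nz Z e = 0\<^sub>m nv nu" using R.normalize[OF c Jfe] unfolding nz_def[abs_def] by auto
  assume x: "x \<in> X" and ij: "i < nv" "j < nu"
  have xM: "x \<in> M" using x by simp
  have "tomat nv nu (Z (e \<cdot> x)) = tomat nv nu (Z e) * S x"
    using R.coc_mul[OF c eM xM] T_X[OF eM] xM by simp
  then have "Z (e \<cdot> x) i j = (tomat nv nu (Z e) * S x) $$ (i, j)" using ij by (metis tomat_index)
  moreover have "T x = 0\<^sub>m nv nv" using T_X xM X_J[OF x] by blast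
  moreover have "tomat nv nu (Z e) * S x \<in> carrier_mat nv nu" using xM by simp
  ultimately show "nz Z x $$ (i, j) = Z x i j - Z (e \<cdot> x) i j"
    using ij xM by (simp add: nz_def del: index_mult_mat(1))
qed

lemma diff_at_cl:
  assumes Z: "Z \<in> cocs" and x: "x \<in> X" and ij: "i < nv" "j < nu"
  shows "diff_at Z (cl x) i j = nz Z x $$ (i, j)"
proof -
  note s = class_some[OF cl_in[OF x]]
  have "diff_at Z (cl x) i j = nz Z (rp (cl x)) $$ (i, j)"
    unfolding diff_at_def using nz_props(3)[OF Z s(1) ij] by simp
  also have "nz Z (rp (cl x)) = nz Z x" by (rule nz_const[OF nz_props(1,2)[OF Z] s(1) x s(2)])
  finally show ?thesis .
qed

lemma to_hom_dd:
  assumes Z: "Z \<in> cocs" and x: "x \<in> X" and k: "k < nv * nu"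
  shows "to_hom Z (dd x, k) = nz Z x $$ (k div nu, k mod nu)"
proof -
  note dm = div_mod_less[OF k]
  have "nz Z (e \<cdot> x) = 0\<^sub>m nv nu"
    using normalized_coc.z_left_e[OF norm_loc[OF nz_props(1,2)[OF Z]], of x] x by simp
  then show ?thesis
    using P.dd_VX[OF x] k sum_dd[OF x] diff_at_cl[OF Z x dm] diff_at_cl[OF Z Ge_X[OF eX[OF x]] dm] dm
    by (simp add: to_hom_def)
qed

lemma subspace_VX: "V.subspace VX"
  unfolding P.VX_span by (rule V.subspace_span)

lemma to_hom_add: "v \<in> VX \<Longrightarrow> w \<in> VX \<Longrightarrow> to_hom Z (v + w, k) = to_hom Z (v, k) + to_hom Z (w, k)"
  using V.subspace_add[OF subspace_VX] by (simp add: to_hom_def distrib_right sum.distrib)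

lemma to_hom_scale: "v \<in> VX \<Longrightarrow> to_hom Z (vscale c v, k) = c * to_hom Z (v, k)"
  using V.subspace_scale[OF subspace_VX] by (simp add: to_hom_def vscale_def sum_distrib_left mult.assoc)

text \<open>Equivariance is checked on the spanning vectors \<open>dd x\<close>: the difference in
  \<open>act_dd\<close> matches the one in \<open>nz_gxh\<close>, and \<open>kron_vec\<close>
  rewrites the two-sided product as the action of \<open>rho\<close>.\<close>

lemma to_hom_in:
  assumes Z: "Z \<in> cocs"
  shows "to_hom Z \<in> HX"
  unfolding homs_def
proof (intro CollectI conjI allI impI ballI)
  fix v :: "'a set \<Rightarrow> 'k" and k assume "v \<notin> VX \<or> nv * nu \<le> k"
  then show "to_hom Z (v, k) = 0" by (auto simp: to_hom_def)
next
  fix g v k assume g: "g \<in> GG" and v: "v \<in> VX" and k: "k < nv * nu"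
  have g': "fst g \<in> Gf" "ie (snd g) \<in> Ge" "snd g \<in> Ge" using g ginv_in[OF e] by (auto simp: mem_Times_iff)
  note dm = div_mod_less[OF k]
  show "to_hom Z (P.perm_act g v, k) = (\<Sum>l<nv * nu. rho g $$ (k, l) * to_hom Z (v, l))"
    using v
  proof (rule P.VX_induct)
    fix x assume x: "x \<in> X"
    let ?y = "fst g \<cdot> x \<cdot> ie (snd g)" and ?y' = "fst g \<cdot> (e \<cdot> x) \<cdot> ie (snd g)"
    have yX: "?y \<in> X" "?y' \<in> X" using gxh_X[OF g'(1) _ g'(2)] x Ge_X eX by blast+
    have dif: "to_hom Z (v - w, k) = to_hom Z (v, k) - to_hom Z (w, k)" if "v \<in> VX" "w \<in> VX" for v w
      using that to_hom_add[of "v - w" w Z k] V.subspace_diff[OF subspace_VX] by simp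
    have "to_hom Z (P.perm_act g (dd x), k) = to_hom Z (dd ?y, k) - to_hom Z (dd ?y', k)"
      unfolding P.act_dd[OF g x] by (rule dif[OF P.dd_VX[OF yX(1)] P.dd_VX[OF yX(2)]])
    also have "\<dots> = (W (fst g) * nz Z x * U (ie (snd g))) $$ (k div nu, k mod nu)"
      unfolding to_hom_dd[OF Z yX(1) k] to_hom_dd[OF Z yX(2) k]
      by (rule nz_gxh[OF nz_props(1,2)[OF Z] g'(1) x g'(2) dm])
    also have "\<dots> = (\<Sum>l<nv * nu. rho g $$ (k, l) * nz Z x $$ (l div nu, l mod nu))"
    proof -
      have "W (fst g) \<in> carrier_mat nv nv" "U (ie (snd g)) \<in> carrier_mat nu nu"
        using U W g' unfolding mrep_def by auto
      note car = this
      have "nz Z x \<in> carrier_mat nv nu" using R.coc_car[OF nz_props(1)[OF Z]] x by simp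
      from kron_vec[OF car this k, symmetric] show ?thesis unfolding tensor_dual_def split_def .
    qed
    also have "\<dots> = (\<Sum>l<nv * nu. rho g $$ (k, l) * to_hom Z (dd x, l))"
      by (rule sum.cong[OF refl]) (simp add: to_hom_dd[OF Z x])
    finally show "to_hom Z (P.perm_act g (dd x), k) = (\<Sum>l<nv * nu. rho g $$ (k, l) * to_hom Z (dd x, l))" .
  next
    have inv: "P.perm_act g v \<in> VX" if "v \<in> VX" for v using P.invsub_VX g that by (auto simp: invsub_def)
    note sub = subsetD[OF P.VX_sub]
    {
      fix v w assume "v \<in> VX" "w \<in> VX"
        "to_hom Z (P.perm_act g v, k) = (\<Sum>l<nv * nu. rho g $$ (k, l) * to_hom Z (v, l))"
        "to_hom Z (P.perm_act g w, k) = (\<Sum>l<nv * nu. rho g $$ (k, l) * to_hom Z (w, l))"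
      then show "to_hom Z (P.perm_act g (v + w), k) = (\<Sum>l<nv * nu. rho g $$ (k, l) * to_hom Z (v + w, l))"
        using P.act.a_add[OF g sub sub] inv by (simp add: to_hom_add distrib_left sum.distrib)
    }
    fix c v assume "v \<in> VX"
      "to_hom Z (P.perm_act g v, k) = (\<Sum>l<nv * nu. rho g $$ (k, l) * to_hom Z (v, l))"
    then show "to_hom Z (P.perm_act g (vscale c v), k)
        = (\<Sum>l<nv * nu. rho g $$ (k, l) * to_hom Z (vscale c v, l))"
      using P.act.a_scale[OF g sub] inv by (simp add: to_hom_scale sum_distrib_left mult.left_commute)
  next
    have "P.perm_act g 0 = 0" by (simp add: P.perm_act_def fun_eq_iff)
    moreover have "to_hom Z (0, l) = 0" for l by (simp add: to_hom_def zero_fun_def)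
    ultimately show "to_hom Z (P.perm_act g 0, k) = (\<Sum>l<nv * nu. rho g $$ (k, l) * to_hom Z (0, l))"
      by (simp del: zero_fun_apply)
  qed
qed (simp_all add: to_hom_add to_hom_scale)

text \<open>If the map is zero, the normalised cocycle vanishes on \<open>X\<close> and hence
  everywhere. Conversely, on \<open>X\<close> one has \<open>T x = 0\<close> and
  \<open>S x = S (e x)\<close>, so a coboundary takes equal values at \<open>x\<close> and
  \<open>e x\<close>.\<close>

lemma to_hom_ker:
  assumes Z: "Z \<in> cocs"
  shows "to_hom Z = 0 \<longleftrightarrow> Z \<in> coboundaries M nu S nv T"
proof
  assume 0: "to_hom Z = 0"
  have "nz Z x = 0\<^sub>m nv nu" if x: "x \<in> X" for x
  proof (rule eq_matI)
    fix i j assume "i < dim_row (0\<^sub>m nv nu :: 'k mat)" "j < dim_col (0\<^sub>m nv nu :: 'k mat)"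
    then have ij: "i < nv" "j < nu" by auto
    note k = index_less[OF ij]
    have "nz Z x $$ ((i * nu + j) div nu, (i * nu + j) mod nu) = 0"
      using to_hom_dd[OF Z x k] 0 by simp
    then show "nz Z x $$ (i, j) = 0\<^sub>m nv nu $$ (i, j)" using ij by simp
  qed (use R.coc_dim[OF nz_props(1)[OF Z]] x in auto)
  then have "nz Z m = 0\<^sub>m nv nu" if "m \<in> M" for m using nz_vanish[OF nz_props(1,2)[OF Z]] that by blast
  then show "Z \<in> coboundaries M nu S nv T"
    using R.coboundaryI[OF Z tomat_carrier] unfolding nz_def by blast
next
  assume "Z \<in> coboundaries M nu S nv T"
  then obtain A where A: "A \<in> carrier_mat nv nu" "Z = of_mat_fun M nv nu (\<lambda>x. T x * A - A * S x)"
    using coboundaries_iff[of Z M nu S nv T] by blast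
  have "diff_at Z c i j = 0" if c: "c \<in> X // Q" for c i j
  proof -
    have x: "rp c \<in> X" by (rule class_some(1)[OF c])
    have "J (e \<cdot> rp c) = J e" using J_Ge eX[OF x] by blast
    then have "T (e \<cdot> rp c) = T (rp c)" "S (e \<cdot> rp c) = S (rp c)"
      using T_X[of "e \<cdot> rp c"] T_X[of "rp c"] X_J[OF x] S_ex[of "rp c"] x by auto
    then show ?thesis unfolding diff_at_def A(2) of_mat_fun_def using x by simp
  qed
  then show "to_hom Z = 0" by (auto simp: to_hom_def fun_eq_iff)
qed

context
  fixes \<psi> assumes \<psi>: "\<psi> \<in> HX"
begin

text \<open>The value of \<open>\<psi>\<close> at \<open>dd x\<close>, unflattened to a matrix; it
  is to become the restriction to \<open>X\<close> of a normalised cocycle.\<close>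

definition mu :: "'a \<Rightarrow> 'k mat" where
  "mu x = mat nv nu (\<lambda>(i, j). \<psi> (dd x, i * nu + j))"

lemma mu_car [simp]: "mu x \<in> carrier_mat nv nu"
  by (simp add: mu_def)

lemma mu_dim [simp]: "dim_row (mu x) = nv" "dim_col (mu x) = nu"
  by (simp_all add: mu_def)

lemma mu_entry: "k < nv * nu \<Longrightarrow> mu x $$ (k div nu, k mod nu) = \<psi> (dd x, k)"
  using div_mod_less[of k nv nu] by (simp add: mu_def)

lemma psi_diff: "v \<in> VX \<Longrightarrow> w \<in> VX \<Longrightarrow> \<psi> (v - w, k) = \<psi> (v, k) - \<psi> (w, k)"
proof -
  assume vw: "v \<in> VX" "w \<in> VX"
  have "\<psi> ((v - w) + w, k) = \<psi> (v - w, k) + \<psi> (w, k)"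
    using \<psi> vw V.subspace_diff[OF subspace_VX] unfolding homs_def by blast
  then show ?thesis by simp
qed

lemma mu_act:
  assumes g: "g \<in> Gf" and h: "h \<in> Ge" and x: "x \<in> X"
  shows "mu (g \<cdot> x \<cdot> h) - mu (g \<cdot> (e \<cdot> x) \<cdot> h) = W g * mu x * U h"
proof (rule eq_matI)
  have Wg: "W g \<in> carrier_mat nv nv" and Uh: "U h \<in> carrier_mat nu nu"
    using U W g h unfolding mrep_def by auto
  have car: "W g * mu x * U h \<in> carrier_mat nv nu"
    by (rule mult_carrier_mat[OF mult_carrier_mat[OF Wg mu_car] Uh])
  then show "dim_row (mu (g \<cdot> x \<cdot> h) - mu (g \<cdot> (e \<cdot> x) \<cdot> h)) = dim_row (W g * mu x * U h)"
    "dim_col (mu (g \<cdot> x \<cdot> h) - mu (g \<cdot> (e \<cdot> x) \<cdot> h)) = dim_col (W g * mu x * U h)"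
    by (simp_all add: carrier_matD del: index_mult_mat)
  fix i j assume "i < dim_row (W g * mu x * U h)" "j < dim_col (W g * mu x * U h)"
  then have ij: "i < nv" "j < nu" using car by (simp_all add: carrier_matD del: index_mult_mat)
  let ?k = "i * nu + j"
  have k: "?k < nv * nu" by (rule index_less[OF ij])
  have dm: "?k div nu = i" "?k mod nu = j" using ij by auto
  have gh: "(g, ie h) \<in> GG" using g h ginv_in[OF e] by auto
  have yX: "g \<cdot> x \<cdot> h \<in> X" "g \<cdot> (e \<cdot> x) \<cdot> h \<in> X" using gxh_X[OF g _ h] x Ge_X eX by blast+
  have "(mu (g \<cdot> x \<cdot> h) - mu (g \<cdot> (e \<cdot> x) \<cdot> h)) $$ (i, j)
    = \<psi> (dd (g \<cdot> x \<cdot> h), ?k) - \<psi> (dd (g \<cdot> (e \<cdot> x) \<cdot> h), ?k)"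
    using ij by (simp add: mu_def)
  also have "\<dots> = \<psi> (P.perm_act (g, ie h) (dd x), ?k)"
    unfolding P.act_dd[OF gh x] fst_conv snd_conv ginv_ginv[OF e h]
    by (rule psi_diff[OF P.dd_VX[OF yX(1)] P.dd_VX[OF yX(2)], symmetric])
  also have "\<dots> = (\<Sum>l<nv * nu. rho (g, ie h) $$ (?k, l) * \<psi> (dd x, l))"
    using \<psi> gh k P.dd_VX[OF x] unfolding homs_def by blast
  also have "\<dots> = (\<Sum>l<nv * nu. rho (g, ie h) $$ (?k, l) * mu x $$ (l div nu, l mod nu))"
    by (rule sum.cong[OF refl]) (simp add: mu_entry)
  also have "\<dots> = (W g * mu x * U h) $$ (?k div nu, ?k mod nu)"
    unfolding tensor_dual_def split_def fst_conv snd_conv ginv_ginv[OF e h] by (rule kron_vec[OF Wg Uh mu_car k])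
  finally show "(mu (g \<cdot> x \<cdot> h) - mu (g \<cdot> (e \<cdot> x) \<cdot> h)) $$ (i, j) = (W g * mu x * U h) $$ (i, j)"
    unfolding dm .
qed

lemma mu_Ge: "x \<in> Ge \<Longrightarrow> mu x = 0\<^sub>m nv nu"
proof -
  assume x: "x \<in> Ge"
  have "dd x = (0 :: 'a set \<Rightarrow> 'k)" using x by (simp add: dd_def)
  then have "\<psi> (dd x, k) = 0" for k using P.act.homs_0[OF \<psi> V.subspace_0[OF subspace_VX]] by simp
  then show ?thesis by (intro eq_matI) (auto simp: mu_def)
qed

text \<open>The case \<open>g = f\<close> of \<open>mu_act\<close>, in which the correction term
  lies in \<open>Ge\<close> and so has value 0.\<close>

lemma mu_right:
  assumes x: "x \<in> X" and h: "h \<in> Ge"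
  shows "mu (x \<cdot> h) = mu x * U h"
proof -
  have "f \<cdot> (e \<cdot> x) \<cdot> h \<in> Ge" using Ge_X[OF eX[OF x]] Gp_mul[OF e eX[OF x] h] by simp
  then have "mu (f \<cdot> x \<cdot> h) - 0\<^sub>m nv nu = W f * mu x * U h" using mu_act[OF Gp_one[OF f] h x] mu_Ge by simp
  moreover have "W f = 1\<^sub>m nv" using W unfolding mrep_def by blast
  moreover have "mu (x \<cdot> h) - 0\<^sub>m nv nu = mu (x \<cdot> h)" by (intro eq_matI) auto
  ultimately show ?thesis using x left_mult_one_mat[OF mu_car] by simp
qed

text \<open>Extends \<open>mu_act\<close> from \<open>Gf\<close> to all elements above
  \<open>e\<close>. If \<open>m\<close> is not above \<open>f\<close>, then \<open>T m = 0\<close>,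
  and \<open>f m f y\<close> has to be equivalent to \<open>f m f (e y)\<close>: the two are equal
  when \<open>f m f\<close> has the ideal of \<open>e\<close>, and otherwise form a pair of kind
  (b).\<close>

lemma mu_key:
  assumes m: "m \<in> M" "J e \<subseteq> J m" and y: "y \<in> X"
  shows "mu (f \<cdot> m \<cdot> f \<cdot> y) - mu (f \<cdot> m \<cdot> f \<cdot> (e \<cdot> y)) = T m * mu y"
proof (cases "J f \<subseteq> J m")
  case True
  let ?g = "f \<cdot> m \<cdot> f"
  have g: "?g \<in> Gf" by (rule local_Gp[OF f m(1) True])
  have "U e = 1\<^sub>m nu" using U unfolding mrep_def by blast
  moreover have "W ?g \<in> carrier_mat nv nv" using W g unfolding mrep_def by blast
  moreover have "?g \<cdot> y \<cdot> e = ?g \<cdot> y" "?g \<cdot> (e \<cdot> y) \<cdot> e = ?g \<cdot> (e \<cdot> y)"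
    using y m by (simp_all add: assoc)
  moreover have "T m = W ?g" using m True by (simp add: inflate_eq)
  ultimately show ?thesis
    using mu_act[OF g Gp_one[OF e] y] right_mult_one_mat[OF mult_carrier_mat[OF _ mu_car]] by simp
next
  case False
  let ?g = "f \<cdot> m \<cdot> f"
  have gM: "?g \<in> M" using m by simp
  have ey: "e \<cdot> y \<in> Ge" by (rule eX[OF y])
  have Jg: "J e \<subseteq> J ?g" using J_le_mul_iff[of "f \<cdot> m" f e] J_le_mul_iff[of f m e] m Jlt by auto
  have gX: "?g \<cdot> z \<in> X" if z: "z \<in> X" for z
  proof -
    have "f \<cdot> (?g \<cdot> z) \<cdot> e \<in> X"
      by (rule fme_X) (use gM z J_le_mul_iff[of ?g z e] Jg X_J in auto)
    moreover have "f \<cdot> (?g \<cdot> z) \<cdot> e = (f \<cdot> f) \<cdot> m \<cdot> f \<cdot> (z \<cdot> e)" using m z by (simp add: assoc del: ff X_e X_f)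
    ultimately show ?thesis using m z by (simp add: assoc)
  qed
  have gy: "?g \<cdot> y \<in> X" "?g \<cdot> (e \<cdot> y) \<in> X" using gX y Ge_X[OF ey] by auto
  have ee: "e \<cdot> (?g \<cdot> y) = e \<cdot> (?g \<cdot> (e \<cdot> y))" by (rule e_mul_e[OF gM Jg]) (use y X_J in auto)
  have "cl (?g \<cdot> y) = cl (?g \<cdot> (e \<cdot> y))"
  proof (cases "J ?g = J e")
    case True
    have "?g \<cdot> e \<cdot> y = ?g \<cdot> y" by (rule rect_mul[OF e gM _ True]) (use y X_J in auto)
    then show ?thesis using gM y by (simp add: assoc)
  next
    case False
    \<comment> \<open>The idempotent demanded by relation (b): it fixes every product
      \<open>?g z\<close>, and it is not \<open>f\<close> because its ideal is contained in that of
      \<open>m\<close>.\<close>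
    let ?d = "om ?g"
    have "?g \<in> corner M mul f" using m by (simp add: corner_iff[OF f] assoc) (simp flip: assoc)
    then have "?d \<in> corner M mul f" using omega_power[OF gM] corner_pw[OF f] by metis
    then have d: "f \<cdot> ?d = ?d" "?d \<cdot> f = ?d" using corner_iff[OF f] by auto
    have Jd: "J ?d = J ?g" by (rule J_omega[OF gM])
    have "J ?g \<subseteq> J m" using J_mul1[of "f \<cdot> m" f] J_mul2[of f m] m by auto
    then have "?d \<noteq> f" using \<open>\<not> J f \<subseteq> J m\<close> Jd by metis
    moreover have "?d \<cdot> (?g \<cdot> z) = ?g \<cdot> z" if "z \<in> M" for z
      using omega_absorb(1)[OF gM] gM that assoc[of ?d ?g z] by simp
    moreover have "J e \<subset> J ?d" using Jd Jg False by blast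
    ultimately show ?thesis using gen_b[OF gy ee _ d] gM y by simp
  qed
  then have "dd (?g \<cdot> y) = (dd (?g \<cdot> (e \<cdot> y)) :: 'a set \<Rightarrow> 'k)" using ee by (simp add: dd_def)
  then have "mu (?g \<cdot> y) = mu (?g \<cdot> (e \<cdot> y))" by (simp add: mu_def)
  moreover have "T m * mu y = 0\<^sub>m nv nu" using R.T_0[OF m(1) False] by simp
  ultimately show ?thesis by (intro eq_matI) auto
qed

definition from_hom :: "'a \<Rightarrow> 'k mat" where
  "from_hom m = (if J e \<subseteq> J m then mu (f \<cdot> m \<cdot> e) else 0\<^sub>m nv nu)"

text \<open>Relation (a) inserts \<open>f\<close> between the factors and replaces
  \<open>f m n e\<close> by \<open>f m f (n e)\<close>. Then \<open>mu_key\<close> splits off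
  \<open>T m * mu (f n e)\<close>, and the remainder is the right translate of \<open>f m e\<close>
  by \<open>e n e\<close>.\<close>

lemma from_hom_coc: "R.coc from_hom"
  unfolding mat_coc_def
proof (intro conjI ballI)
  fix m n assume m: "m \<in> M" and n: "n \<in> M"
  show "from_hom (m \<cdot> n) = T m * from_hom n + from_hom m * S n"
  proof (cases "J e \<subseteq> J m \<and> J e \<subseteq> J n")
    case False
    then have "from_hom (m \<cdot> n) = 0\<^sub>m nv nu" using J_le_mul_iff[of m n e] m n by (auto simp: from_hom_def)
    moreover have "T m * from_hom n + from_hom m * S n = 0\<^sub>m nv nu"
    proof (cases "J e \<subseteq> J n")
      case True
      then have "\<not> J e \<subseteq> J m" using False by blast
      then show ?thesis using R.T_0[OF m] Jlt n by (auto simp: from_hom_def)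
    next
      case n0: False
      have "from_hom m \<in> carrier_mat nv nu" by (simp add: from_hom_def)
      then show ?thesis using R.S_0[OF n n0] n0 m by (simp add: from_hom_def)
    qed
    ultimately show ?thesis by simp
  next
    case True
    then have Jmn: "J e \<subseteq> J (m \<cdot> n)" using J_le_mul_iff[of m n e] m n by auto
    let ?x = "n \<cdot> e"
    let ?y = "f \<cdot> n \<cdot> e"
    have h: "e \<cdot> n \<cdot> e \<in> Ge" using local_Gp[OF e n] True by blast
    have x: "?x \<in> M" "?x \<cdot> e = ?x" "J ?x = J e"
      using n J_mul_eq(2)[of e n] True by (auto simp: assoc)
    have yX: "?y \<in> X" by (rule fme_X) (use n True in auto)
    have mX: "f \<cdot> m \<cdot> e \<in> X" by (rule fme_X) (use m True in auto)
    have ex: "e \<cdot> ?y = e \<cdot> n \<cdot> e" using n assoc[of e f "n \<cdot> e"] by (simp add: assoc)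
    have A: "f \<cdot> m \<cdot> f \<cdot> ?y = f \<cdot> (m \<cdot> f \<cdot> ?x)" using m n assoc[of f f "n \<cdot> e"] by (simp add: assoc)
    have mnX: "f \<cdot> (m \<cdot> ?x) \<in> X" "f \<cdot> (m \<cdot> f \<cdot> ?x) \<in> X" using gen_a_in[OF m _ x] True by auto
    have c: "cl (f \<cdot> (m \<cdot> ?x)) = cl (f \<cdot> (m \<cdot> f \<cdot> ?x))" by (rule gen_a[OF m _ x]) (use True in simp)
    have "dd (f \<cdot> (m \<cdot> ?x)) = (dd (f \<cdot> (m \<cdot> f \<cdot> ?x)) :: 'a set \<Rightarrow> 'k)"
      unfolding dd_def c cl_eq_e[OF mnX c] ..
    then have 1: "mu (f \<cdot> (m \<cdot> n) \<cdot> e) = mu (f \<cdot> m \<cdot> f \<cdot> ?y)" using m n A by (simp add: mu_def assoc)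
    have "f \<cdot> m \<cdot> f \<cdot> (e \<cdot> ?y) = f \<cdot> m \<cdot> (f \<cdot> e) \<cdot> (n \<cdot> e)" unfolding ex using m n by (simp add: assoc del: fe)
    also have "\<dots> = f \<cdot> m \<cdot> (e \<cdot> e) \<cdot> (n \<cdot> e)" by simp
    also have "\<dots> = (f \<cdot> m \<cdot> e) \<cdot> (e \<cdot> n \<cdot> e)" using m n by (simp add: assoc del: ee)
    finally have 2: "mu (f \<cdot> m \<cdot> f \<cdot> (e \<cdot> ?y)) = mu (f \<cdot> m \<cdot> e) * U (e \<cdot> n \<cdot> e)"
      using mu_right[OF mX h] by simp
    have "mu (f \<cdot> m \<cdot> f \<cdot> ?y) = (mu (f \<cdot> m \<cdot> f \<cdot> ?y) - mu (f \<cdot> m \<cdot> f \<cdot> (e \<cdot> ?y))) + mu (f \<cdot> m \<cdot> f \<cdot> (e \<cdot> ?y))"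
      by (intro eq_matI) auto
    also have "\<dots> = T m * mu ?y + mu (f \<cdot> m \<cdot> e) * U (e \<cdot> n \<cdot> e)"
      by (subst mu_key[OF m conjunct1[OF True] yX], subst 2, rule refl)
    finally show ?thesis using 1 True Jmn n by (simp add: from_hom_def inflate_eq)
  qed
qed (simp add: from_hom_def)

text \<open>The cocycle \<open>from_hom\<close> vanishes at \<open>e x\<close>, so nothing is
  subtracted in \<open>diff_at\<close>, and the value on \<open>dd x\<close> is
  \<open>mu x\<close>.\<close>

lemma to_hom_surj: "\<exists>Z\<in>cocs. to_hom Z = \<psi>"
proof
  let ?Z = "of_mat_fun M nv nu from_hom"
  show Z: "?Z \<in> cocs" by (rule of_mat_fun_cocycle[where mul = mul, OF closed from_hom_coc])
  have dd: "to_hom ?Z (dd x, k) = \<psi> (dd x, k)" if x: "x \<in> X" for x k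
  proof (cases "k < nv * nu")
    case True
    note dm = div_mod_less[OF True]
    have ex: "e \<cdot> x \<in> Ge" by (rule eX[OF x])
    have fh: "from_hom x = mu x" "from_hom (e \<cdot> x) = 0\<^sub>m nv nu"
      using x X_J[OF x] mu_Ge[OF ex] Ge_X[OF ex] J_Ge[OF ex] by (simp_all add: from_hom_def)
    have "to_hom ?Z (dd x, k) = nz ?Z x $$ (k div nu, k mod nu)" by (rule to_hom_dd[OF Z x True])
    also have "\<dots> = mu x $$ (k div nu, k mod nu)"
      using nz_props(3)[OF Z x dm] dm x fh by (simp add: of_mat_fun_def)
    finally show ?thesis using mu_entry[OF True] by simp
  next
    case False
    then show ?thesis using \<psi> P.dd_VX[OF x] by (simp add: to_hom_def homs_def)
  qed
  have "to_hom ?Z (v, k) = \<psi> (v, k)" if "v \<in> VX" for v k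
    using that
  proof (rule P.VX_induct)
    fix v w assume "v \<in> VX" "w \<in> VX" "to_hom ?Z (v, k) = \<psi> (v, k)" "to_hom ?Z (w, k) = \<psi> (w, k)"
    then show "to_hom ?Z (v + w, k) = \<psi> (v + w, k)" using \<psi> by (simp add: to_hom_add homs_def)
  next
    fix c v assume "v \<in> VX" "to_hom ?Z (v, k) = \<psi> (v, k)"
    then show "to_hom ?Z (vscale c v, k) = \<psi> (vscale c v, k)" using \<psi> by (simp add: to_hom_scale homs_def)
  next
    show "to_hom ?Z (0, k) = \<psi> (0, k)"
      using P.act.homs_0[OF \<psi> V.subspace_0[OF subspace_VX]] by (simp add: to_hom_def zero_fun_def)
  qed (rule dd)
  moreover have "to_hom ?Z (v, k) = \<psi> (v, k)" if "v \<notin> VX" for v k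
    using that \<psi> by (simp add: to_hom_def homs_def)
  ultimately show "to_hom ?Z = \<psi>" by (auto simp: fun_eq_iff)
qed

end

text \<open>Rank-nullity for \<open>to_hom\<close> writes the dimension of the cocycles as a sum, so
  the subtraction of natural numbers in \<open>arrows\<close> is exact.\<close>

theorem arrows_eq_dim_homs: "arrows M mul nu S nv T = V.dim HX"
proof -
  have lin: "to_hom (Z + Z') = to_hom Z + to_hom Z'" "to_hom (fscale c Z) = vscale c (to_hom Z)" for Z Z' c
    by (auto simp: to_hom_def diff_at_def fscale_def vscale_def fun_eq_iff algebra_simps
        sum.distrib sum_subtractf sum_distrib_left)
  have img: "to_hom ` cocs = HX" using to_hom_in to_hom_surj by blast
  have ker: "{Z \<in> cocs. to_hom Z = 0} = coboundaries M nu S nv T"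
    using to_hom_ker R.coboundaries_subset by blast
  interpret FS: vspace fscale by standard
  have "fin_dim fscale cocs" by (rule fin_dim_cocycles[OF fin R.S_car R.T_car])
  then have finK: "fin_dim fscale {Z \<in> cocs. to_hom Z = 0}" by (rule FS.fin_dim_subset) blast
  have finI: "fin_dim vscale (to_hom ` cocs)"
    unfolding img by (rule P.fin_dim_homs[OF P.invsub_VX P.VX_sub])
  have "F.dim cocs = F.dim (coboundaries M nu S nv T) + V.dim HX"
    using FV.rank_nullity_on(2)[OF subspace_cocycles[OF R.S_car R.T_car] lin finK finI] unfolding ker img .
  then show ?thesis unfolding arrows_def by simp
qed

end

section \<open>Splitting fields\<close>

lemma matrix_units_in_spanD:
  assumes "matrix_units_in_span G n \<rho>" "p < n" "q < n"
  obtains c where "\<And>i j. i < n \<Longrightarrow> j < n \<Longrightarrow>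
    (\<Sum>g\<in>G. c g * \<rho> g $$ (i, j)) = (if i = p \<and> j = q then 1 else 0)"
  using assms(1)[unfolded matrix_units_in_span_def, rule_format, OF assms(2,3)] by auto

context fin_orthogroup
begin

definition algmat :: "nat \<Rightarrow> ('a \<Rightarrow> 'k::field mat) \<Rightarrow> ('a \<Rightarrow> 'k) \<Rightarrow> 'k mat" where
  "algmat n S a = mat n n (\<lambda>(i, j). \<Sum>m\<in>M. a m * S m $$ (i, j))"

lemma algmat_car [simp]: "algmat n S a \<in> carrier_mat n n"
  and algmat_dim [simp]: "dim_row (algmat n S a) = n" "dim_col (algmat n S a) = n"
  and algmat_entry: "i < n \<Longrightarrow> j < n \<Longrightarrow> algmat n S a $$ (i, j) = (\<Sum>m\<in>M. a m * S m $$ (i, j))"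
  by (simp_all add: algmat_def)

lemma algmat_add: "algmat n S (a + b) = algmat n S a + algmat n S b"
  by (rule eq_matI) (auto simp: algmat_entry distrib_right sum.distrib)

lemma algmat_scale: "algmat n S (\<lambda>x. c * a x) = c \<cdot>\<^sub>m algmat n S a"
  by (rule eq_matI) (auto simp: algmat_entry sum_distrib_left mult.assoc)

lemma algmat_delta:
  assumes "x \<in> M" "S x \<in> carrier_mat n n"
  shows "algmat n S (delta x) = S x"
proof (rule eq_matI)
  fix i j assume "i < dim_row (S x)" "j < dim_col (S x)"
  then show "algmat n S (delta x) $$ (i, j) = S x $$ (i, j)"
    using assms sum_delta_mult[OF fin assms(1), of "\<lambda>m. S m $$ (i, j)"] by (auto simp: algmat_entry)
qed (use assms in auto)

lemma algmat_sum_entry: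
  assumes "finite I" "i < n" "j < n"
  shows "algmat n S (\<lambda>x. \<Sum>s\<in>I. c s * g s x) $$ (i, j) = (\<Sum>s\<in>I. c s * algmat n S (g s) $$ (i, j))"
  using assms(2,3)
  by (simp add: algmat_entry sum_distrib_right sum_distrib_left mult.assoc) (rule sum.swap)

lemma algmat_conv:
  assumes S: "\<And>x. x \<in> M \<Longrightarrow> S x \<in> carrier_mat n n" "\<And>x y. x \<in> M \<Longrightarrow> y \<in> M \<Longrightarrow> S (x \<cdot> y) = S x * S y"
  shows "algmat n S (conv M mul a b) = algmat n S a * algmat n S b"
proof (rule eq_matI)
  fix i j assume "i < dim_row (algmat n S a * algmat n S b)" "j < dim_col (algmat n S a * algmat n S b)"
  then have ij: "i < n" "j < n" by auto
  let ?h = "\<lambda>p. a (fst p) * b (snd p) * S (fst p \<cdot> snd p) $$ (i, j)"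
  have "algmat n S (conv M mul a b) $$ (i, j)
      = (\<Sum>z\<in>M. \<Sum>p\<in>{p \<in> M \<times> M. fst p \<cdot> snd p = z}. ?h p)"
    unfolding algmat_entry[OF ij] conv_def sum_distrib_right
    by (intro sum.cong) auto
  also have "\<dots> = (\<Sum>p\<in>M \<times> M. ?h p)"
    by (rule sum.group) (use fin in auto)
  also have "\<dots> = (\<Sum>p\<in>M \<times> M. \<Sum>l<n. (a (fst p) * S (fst p) $$ (i, l)) * (b (snd p) * S (snd p) $$ (l, j)))"
  proof (rule sum.cong[OF refl])
    fix p assume p: "p \<in> M \<times> M"
    then have pM: "fst p \<in> M" "snd p \<in> M" by auto
    have "S (fst p \<cdot> snd p) $$ (i, j) = (\<Sum>l<n. S (fst p) $$ (i, l) * S (snd p) $$ (l, j))"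
      unfolding S(2)[OF pM] by (rule mat_mult_entry[OF S(1)[OF pM(1)] S(1)[OF pM(2)] ij])
    then show "?h p = (\<Sum>l<n. (a (fst p) * S (fst p) $$ (i, l)) * (b (snd p) * S (snd p) $$ (l, j)))"
      by (simp add: sum_distrib_left mult_ac)
  qed
  also have "\<dots> = (\<Sum>x\<in>M. \<Sum>y\<in>M. \<Sum>l<n. (a x * S x $$ (i, l)) * (b y * S y $$ (l, j)))"
    by (subst (2) sum.cartesian_product) (simp add: split_def)
  also have "\<dots> = (\<Sum>l<n. \<Sum>x\<in>M. \<Sum>y\<in>M. (a x * S x $$ (i, l)) * (b y * S y $$ (l, j)))"
    by (rule sum_rotate)
  also have "\<dots> = (\<Sum>l<n. algmat n S a $$ (i, l) * algmat n S b $$ (l, j))"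
    by (rule sum.cong[OF refl]) (simp add: algmat_entry ij sum_product)
  also have "\<dots> = (algmat n S a * algmat n S b) $$ (i, j)"
    by (rule mat_mult_entry[OF algmat_car algmat_car ij, symmetric])
  finally show "algmat n S (conv M mul a b) $$ (i, j) = (algmat n S a * algmat n S b) $$ (i, j)" .
qed auto

lemma malg_add: "a \<in> malg M \<Longrightarrow> b \<in> malg M \<Longrightarrow> a + b \<in> malg M"
  and malg_scale: "a \<in> malg M \<Longrightarrow> (\<lambda>x. c * a x) \<in> malg M"
  and malg_zero: "0 \<in> malg M"
  and malg_delta: "x \<in> M \<Longrightarrow> delta x \<in> malg M"
  by (auto simp: malg_def delta_def)

lemma malg_conv: "a \<in> malg M \<Longrightarrow> b \<in> malg M \<Longrightarrow> conv M mul a b \<in> malg M"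
proof -
  have "conv M mul a b z = 0" if "z \<notin> M" for z
    unfolding conv_def by (rule sum.neutral) (use that in auto)
  then show ?thesis by (simp add: malg_def)
qed

lemma malg_left_ideal: "left_ideal M mul (malg M)"
  unfolding left_ideal_def using malg_add malg_scale malg_zero malg_conv by blast

end

locale irrep_inflated = fin_orthogroup M mul uu for M :: "'a set" and mul (infixl \<open>\<cdot>\<close> 70) and uu +
  fixes e :: 'a and n :: nat and U :: "'a \<Rightarrow> 'k::field mat"
  assumes e: "idm e" and irr: "irrep (Gp M mul e) mul e n U"
begin

abbreviation "S \<equiv> inflate M mul uu e n U"
abbreviation "R \<equiv> algmat n S"

lemma mrepU: "mrep (Gp M mul e) mul e n U"
  using irr unfolding irrep_def by blast

interpretation rep_pair M mul uu e e n n S S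
  by (rule rep_pair_inflate[OF e e mrepU mrepU])

lemma R_conv: "R (conv M mul a b) = R a * R b"
  by (rule algmat_conv[OF S_car S_mul])

lemma R_uu: "R (delta uu) = 1\<^sub>m n"
proof -
  have "idm uu" by (simp add: idem_def)
  moreover have "J e \<subseteq> J uu" using J_mul1[of uu e] by simp
  ultimately show ?thesis using algmat_delta[of uu S n] S_1 by simp
qed

lemma R_Gp: "g \<in> Gp M mul e \<Longrightarrow> R (delta g) = U g"
proof -
  assume "g \<in> Gp M mul e"
  then have g: "g \<in> M" "J g = J e" "e \<cdot> g \<cdot> e = g" using Gp_iff[OF e, of g] by auto
  have "S g = U g" unfolding inflate_eq[OF g(1)] g(2,3) by simp
  then show ?thesis using algmat_delta[of g S n] S_car[of g] g(1) by simp
qed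

text \<open>A left ideal absorbs the elements \<open>delta g\<close> of the group, so its orbit of
  \<open>v\<close> is an invariant subspace, and irreducibility leaves two possibilities.\<close>

lemma ideal_image:
  assumes I: "left_ideal M mul I" and v: "v \<in> carrier_vec n"
  shows "(\<lambda>a. R a *\<^sub>v v) ` I = {0\<^sub>v n} \<or> (\<lambda>a. R a *\<^sub>v v) ` I = carrier_vec n"
proof -
  let ?W = "(\<lambda>a. R a *\<^sub>v v) ` I"
  have Rv: "R a *\<^sub>v v \<in> carrier_vec n" for a by (rule mult_mat_vec_carrier[OF algmat_car v])
  have z: "R 0 *\<^sub>v v = 0\<^sub>v n"
    using v by (intro eq_vecI) (auto simp: algmat_def scalar_prod_def)
  have "inv_subspace (Gp M mul e) n U ?W"
    unfolding inv_subspace_def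
  proof (intro conjI ballI allI)
    show "?W \<subseteq> carrier_vec n" using Rv by blast
    show "0\<^sub>v n \<in> ?W" using I z unfolding left_ideal_def by (metis image_eqI)
  next
    fix x y assume "x \<in> ?W" "y \<in> ?W"
    then obtain a b where ab: "a \<in> I" "b \<in> I" "x = R a *\<^sub>v v" "y = R b *\<^sub>v v" by blast
    have "x + y = R (a + b) *\<^sub>v v"
      unfolding ab algmat_add by (rule add_mult_distrib_mat_vec[OF algmat_car algmat_car v, symmetric])
    then show "x + y \<in> ?W" using I ab unfolding left_ideal_def by blast
  next
    fix c x assume "x \<in> ?W"
    then obtain a where a: "a \<in> I" "x = R a *\<^sub>v v" by blast
    have "c \<cdot>\<^sub>v x = R (\<lambda>x. c * a x) *\<^sub>v v"
      unfolding a algmat_scale using v by (intro eq_vecI) (auto simp: smult_scalar_prod_distrib[of _ n])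
    moreover have "(\<lambda>x. c * a x) \<in> I" using I a unfolding left_ideal_def by blast
    ultimately show "c \<cdot>\<^sub>v x \<in> ?W" by blast
  next
    fix g x assume g: "g \<in> Gp M mul e" and "x \<in> ?W"
    then obtain a where a: "a \<in> I" "x = R a *\<^sub>v v" by blast
    have "U g *\<^sub>v x = R (conv M mul (delta g) a) *\<^sub>v v"
      unfolding a R_conv R_Gp[OF g, symmetric]
      by (rule assoc_mult_mat_vec[OF algmat_car algmat_car v, symmetric])
    moreover have "conv M mul (delta g) a \<in> I"
      using I a malg_delta[OF Gp_in[OF e g]] unfolding left_ideal_def by blast
    ultimately show "U g *\<^sub>v x \<in> ?W" by blast
  qed
  then show ?thesis using irr unfolding irrep_def by blast
qed

lemma transitive:
  assumes v: "v \<in> carrier_vec n" "v \<noteq> 0\<^sub>v n" and w: "w \<in> carrier_vec n"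
  shows "\<exists>a\<in>malg M. R a *\<^sub>v v = w"
proof -
  have "R (delta uu) *\<^sub>v v = v" using R_uu v by simp
  then have "v \<in> (\<lambda>a. R a *\<^sub>v v) ` malg M" using malg_delta[OF uu_in] by (metis image_eqI)
  then have "(\<lambda>a. R a *\<^sub>v v) ` malg M = carrier_vec n"
    using ideal_image[OF malg_left_ideal v(1)] v(2) by blast
  then have "w \<in> (\<lambda>a. R a *\<^sub>v v) ` malg M" using w by simp
  then show ?thesis by blast
qed

text \<open>For nonzero \<open>v\<close> the annihilator of \<open>v\<close> is a maximal left
  ideal, because a larger left ideal already moves \<open>v\<close> onto the whole space. The
  radical lies in all these annihilators.\<close>

lemma rad_zero:
  assumes a: "a \<in> rad M mul"
  shows "R a = 0\<^sub>m n n"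
proof -
  have "R a *\<^sub>v v = 0\<^sub>v n" if v: "v \<in> carrier_vec n" for v
  proof (cases "v = 0\<^sub>v n")
    case True
    then show ?thesis by (intro eq_vecI) auto
  next
    case False
    have Rv: "R a *\<^sub>v v \<in> carrier_vec n" for a by (rule mult_mat_vec_carrier[OF algmat_car v])
    have add: "R (a + b) *\<^sub>v v = R a *\<^sub>v v + R b *\<^sub>v v" for a b
      unfolding algmat_add by (rule add_mult_distrib_mat_vec[OF algmat_car algmat_car v])
    have scale: "R (\<lambda>x. c * a x) *\<^sub>v v = c \<cdot>\<^sub>v (R a *\<^sub>v v)" for a c
      unfolding algmat_scale using v by (intro eq_vecI) (auto simp: smult_scalar_prod_distrib[of _ n])
    have conv: "R (conv M mul a b) *\<^sub>v v = R a *\<^sub>v (R b *\<^sub>v v)" for a b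
      unfolding R_conv by (rule assoc_mult_mat_vec[OF algmat_car algmat_car v])
    let ?I = "{a \<in> malg M. R a *\<^sub>v v = 0\<^sub>v n}"
    have R0: "R a *\<^sub>v 0\<^sub>v n = 0\<^sub>v n" for a by (intro eq_vecI) auto
    have z: "R 0 *\<^sub>v v = 0\<^sub>v n" using v by (intro eq_vecI) (auto simp: algmat_def scalar_prod_def)
    have I: "left_ideal M mul ?I"
      unfolding left_ideal_def
      using malg_add malg_scale malg_zero malg_conv add scale conv z R0 by auto
    have "R (delta uu) *\<^sub>v v = v" using R_uu v by simp
    then have "delta uu \<notin> ?I" using False by auto
    then have ne: "?I \<noteq> malg M" using malg_delta[OF uu_in] by blast
    have "K = ?I \<or> K = malg M" if K: "left_ideal M mul K" "?I \<subseteq> K" for K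
    proof (cases "(\<lambda>a. R a *\<^sub>v v) ` K = {0\<^sub>v n}")
      case True
      then show ?thesis using K unfolding left_ideal_def by blast
    next
      case False
      then have all: "(\<lambda>a. R a *\<^sub>v v) ` K = carrier_vec n" using ideal_image[OF K(1) v] by blast
      have "b \<in> K" if b: "b \<in> malg M" for b
      proof -
        have "R b *\<^sub>v v \<in> (\<lambda>a. R a *\<^sub>v v) ` K" using all Rv by simp
        then obtain c where c: "c \<in> K" "R c *\<^sub>v v = R b *\<^sub>v v" by auto
        have cM: "c \<in> malg M" using c K(1) unfolding left_ideal_def by blast
        \<comment> \<open>The difference of \<open>b\<close> and \<open>c\<close> annihilates
          \<open>v\<close> and therefore belongs to \<open>K\<close>; adding \<open>c\<close>
          returns \<open>b\<close>.\<close>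
        have "R (b + (\<lambda>x. - 1 * c x)) *\<^sub>v v = 0\<^sub>v n"
          unfolding add scale c(2) using Rv[of b] by (intro eq_vecI) auto
        then have "b + (\<lambda>x. - 1 * c x) \<in> K"
          using K(2) malg_add[OF b malg_scale[OF cM]] by blast
        then have e1: "(b + (\<lambda>x. - 1 * c x)) + c \<in> K" using K(1) c(1) unfolding left_ideal_def by blast
        have e2: "(b + (\<lambda>x. - 1 * c x)) + c = b" by (simp add: fun_eq_iff)
        show ?thesis using e1 unfolding e2 .
      qed
      then show ?thesis using K(1) unfolding left_ideal_def by blast
    qed
    then have "max_left_ideal M mul ?I" unfolding max_left_ideal_def using I ne by blast
    then show ?thesis using a unfolding rad_def by blast
  qed
  then have *: "R a *\<^sub>v unit_vec n j = 0\<^sub>v n" if "j < n" for j using that by simp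
  show ?thesis
  proof (rule eq_matI)
    fix i j assume "i < dim_row (0\<^sub>m n n :: 'k mat)" "j < dim_col (0\<^sub>m n n :: 'k mat)"
    then have ij: "i < n" "j < n" by auto
    have "(R a *\<^sub>v unit_vec n j) $ i = R a $$ (i, j)" using ij by simp
    then show "R a $$ (i, j) = 0\<^sub>m n n $$ (i, j)" using *[OF ij(2)] ij by simp
  qed auto
qed

text \<open>Let \<open>\<epsilon>\<close> be the matrix units of a block acting nontrivially. Then \<open>R \<epsilon>\<^sub>i\<^sub>i\<close> has rank one
  with image spanned by \<open>v\<close>, so every rank one map factors as \<open>R a \<circ> R \<epsilon>\<^sub>i\<^sub>j\<close>, combined over \<open>j\<close>.\<close>
lemma algebra_matrix_unit:
  fixes N :: nat and r :: "nat \<Rightarrow> nat" and P :: "nat \<Rightarrow> ('a \<Rightarrow> 'k) \<Rightarrow> 'k mat"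
  assumes car: "\<And>b a. b < N \<Longrightarrow> a \<in> malg M \<Longrightarrow> P b a \<in> carrier_mat (r b) (r b)"
    and add: "\<And>b x y. b < N \<Longrightarrow> x \<in> malg M \<Longrightarrow> y \<in> malg M \<Longrightarrow> P b (x + y) = P b x + P b y"
    and scale: "\<And>b c x. b < N \<Longrightarrow> x \<in> malg M \<Longrightarrow> P b (\<lambda>m. c * x m) = c \<cdot>\<^sub>m P b x"
    and mult: "\<And>b x y. b < N \<Longrightarrow> x \<in> malg M \<Longrightarrow> y \<in> malg M \<Longrightarrow> P b (conv M mul x y) = P b x * P b y"
    and one: "\<And>b. b < N \<Longrightarrow> P b (delta uu) = 1\<^sub>m (r b)"
    and surj: "\<And>A. (\<And>b. b < N \<Longrightarrow> A b \<in> carrier_mat (r b) (r b)) \<Longrightarrow> \<exists>x\<in>malg M. \<forall>b<N. P b x = A b"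
    and ker: "\<And>x. x \<in> malg M \<Longrightarrow> (\<And>b. b < N \<Longrightarrow> P b x = 0\<^sub>m (r b) (r b)) \<Longrightarrow> x \<in> rad M mul"
    and pq: "p < n" "q < n"
  shows "\<exists>x\<in>malg M. \<forall>i<n. \<forall>j<n. R x $$ (i, j) = (if i = p \<and> j = q then 1 else 0)"
proof -
  \<comment> \<open>The action factors through the semisimple quotient: an element whose components
    are all zero lies in the radical and acts as zero.\<close>
  have eqR: "R x = R y" if xy: "x \<in> malg M" "y \<in> malg M" "\<And>b. b < N \<Longrightarrow> P b x = P b y" for x y
  proof -
    let ?z = "x + (\<lambda>m. - 1 * y m)"
    have "?z \<in> rad M mul"
    proof (rule ker)
      show "?z \<in> malg M" by (intro malg_add malg_scale xy)
      fix b assume b: "b < N"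
      have "P b ?z = P b y + (- 1) \<cdot>\<^sub>m P b y" 
        unfolding add[OF b xy(1) malg_scale[OF xy(2)]] scale[OF b xy(2)] xy(3)[OF b] ..
      then show "P b ?z = 0\<^sub>m (r b) (r b)" using car[OF b xy(2)] by (intro eq_matI) auto
    qed
    then have "R x + (- 1) \<cdot>\<^sub>m R y = 0\<^sub>m n n" using rad_zero algmat_add algmat_scale by metis
    then have "(R x + (- 1) \<cdot>\<^sub>m R y) $$ (i, j) = 0" if "i < n" "j < n" for i j using that by simp
    then show ?thesis by (intro eq_matI) auto
  qed
  have P_sum: "(\<lambda>m. \<Sum>s\<in>I. c s * g s m) \<in> malg M \<and>
      (\<forall>i<r b. \<forall>j<r b. P b (\<lambda>m. \<Sum>s\<in>I. c s * g s m) $$ (i, j) = (\<Sum>s\<in>I. c s * P b (g s) $$ (i, j)))"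
    if I: "finite I" and g: "\<And>s. s \<in> I \<Longrightarrow> g s \<in> malg M" and b: "b < N"
    for I :: "(nat \<times> nat) set" and c g b
    using I g
  proof (induction I rule: finite_induct)
    case empty
    have "P b (\<lambda>m. 0 * (0 :: 'a \<Rightarrow> 'k) m) = 0 \<cdot>\<^sub>m P b 0" by (rule scale[OF b malg_zero])
    then have "P b (\<lambda>m. 0) $$ (i, j) = 0" if "i < r b" "j < r b" for i j
      using car[OF b malg_zero] that by simp
    then show ?case by (simp add: malg_def)
  next
    case (insert s I)
    let ?x = "\<lambda>m. c s * g s m" and ?y = "\<lambda>m. \<Sum>s\<in>I. c s * g s m"
    have x: "?x \<in> malg M" by (rule malg_scale) (use insert in simp)
    have y: "?y \<in> malg M" using insert by simp
    have e: "(\<lambda>m. \<Sum>s\<in>insert s I. c s * g s m) = ?x + ?y" using insert by (simp add: fun_eq_iff)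
    have gs: "g s \<in> malg M" using insert by simp
    have "P b (?x + ?y) = c s \<cdot>\<^sub>m P b (g s) + P b ?y" unfolding add[OF b x y] scale[OF b gs] ..
    then have "P b (?x + ?y) $$ (i, j) = c s * P b (g s) $$ (i, j) + P b ?y $$ (i, j)" if "i < r b" "j < r b" for i j
      using that car[OF b gs] car[OF b y] by simp
    then show ?case unfolding e using malg_add[OF x y] insert by simp
  qed
  have "\<exists>x\<in>malg M. \<forall>b'<N. P b' x = (if b' = b then mat (r b) (r b) (\<lambda>(k, l). if k = i \<and> l = j then 1 else 0)
      else 0\<^sub>m (r b') (r b'))" for b i j
    by (rule surj) auto
  then obtain eps where eps: "\<And>b i j. eps b i j \<in> malg M"
    "\<And>b i j b'. b' < N \<Longrightarrow> P b' (eps b i j)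
      = (if b' = b then mat (r b) (r b) (\<lambda>(k, l). if k = i \<and> l = j then 1 else 0) else 0\<^sub>m (r b') (r b'))"
    by metis
  let ?I = "Sigma {..<N} (\<lambda>b. {..<r b})"
  have finI: "finite ?I" by simp
  \<comment> \<open>The diagonal matrix units of all blocks sum to 1 modulo the radical, so one of
    them acts with a nonzero entry at \<open>(p, p)\<close>; this selects the block \<open>b\<close>
    and the index \<open>d\<close>.\<close>
  let ?one = "\<lambda>m. \<Sum>s\<in>?I. 1 * eps (fst s) (snd s) (snd s) m"
  have one_in: "?one \<in> malg M" using eps(1) by (auto simp: malg_def)
  have "R ?one = R (delta uu)"
  proof (rule eqR[OF one_in malg_delta[OF uu_in]])
    fix b assume b: "b < N"
    show "P b ?one = P b (delta uu)"
      unfolding one[OF b]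
    proof (rule eq_matI)
      fix i j assume "i < dim_row (1\<^sub>m (r b) :: 'k mat)" "j < dim_col (1\<^sub>m (r b) :: 'k mat)"
      then have ij: "i < r b" "j < r b" by auto
      have "P b ?one $$ (i, j) = (\<Sum>s\<in>?I. 1 * P b (eps (fst s) (snd s) (snd s)) $$ (i, j))"
        using P_sum[OF finI eps(1) b, of "\<lambda>_. 1"] ij by blast
      also have "\<dots> = (\<Sum>s\<in>?I. if s = (b, i) then (if i = j then 1 else 0) else 0)"
        by (intro sum.cong refl) (use eps(2)[OF b] ij in \<open>auto split: if_splits\<close>)
      also have "\<dots> = (if i = j then 1 else 0)" using b ij finI by simp
      finally show "P b ?one $$ (i, j) = 1\<^sub>m (r b) $$ (i, j)" using ij by simp
    qed (use car[OF b one_in] in auto)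
  qed
  then have Rone: "R ?one = 1\<^sub>m n" using R_uu by simp
  have "(\<Sum>s\<in>?I. 1 * R (eps (fst s) (snd s) (snd s)) $$ (p, p)) = 1"
    using algmat_sum_entry[OF finI pq(1) pq(1), of S "\<lambda>_. 1" "\<lambda>s. eps (fst s) (snd s) (snd s)"] Rone pq by simp
  then obtain s where s: "s \<in> ?I" "R (eps (fst s) (snd s) (snd s)) $$ (p, p) \<noteq> 0"
    by (metis (no_types, lifting) mult_1 sum.neutral zero_neq_one)
  obtain b d where bd: "b < N" "d < r b" "R (eps b d d) $$ (p, p) \<noteq> 0" using s by auto
  define w where "w = (unit_vec n p :: 'k vec)"
  have w: "w \<in> carrier_vec n" by (simp add: w_def)
  define vv where "vv j = R (eps b j d) *\<^sub>v w" for j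
  have vv: "vv j \<in> carrier_vec n" for j unfolding vv_def by (rule mult_mat_vec_carrier[OF algmat_car w])
  let ?v = "vv d"
  have "?v $ p = R (eps b d d) $$ (p, p)" using pq by (simp add: vv_def w_def)
  then have v0: "?v \<noteq> 0\<^sub>v n" using bd(3) pq by auto
  have "\<exists>a\<in>malg M. R a *\<^sub>v ?v = unit_vec n k" for k by (rule transitive[OF vv v0]) simp
  then obtain a where a: "\<And>k. a k \<in> malg M" "\<And>k. R (a k) *\<^sub>v ?v = unit_vec n k" by metis
  define co where "co k j = P b (a k) $$ (j, d)" for k j
  \<comment> \<open>Inside the block the product of \<open>eps b d j\<close>, \<open>a k\<close> and
    \<open>eps b d d\<close> is a multiple of \<open>eps b d d\<close>, the scalar being an entry of
    \<open>a k\<close>. Applied to \<open>w\<close> this confines the image of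
    \<open>R (eps b d j)\<close> to the line of \<open>?v\<close>.\<close>
  have sandwich: "R (eps b d j) *\<^sub>v unit_vec n k = co k j \<cdot>\<^sub>v ?v" if j: "j < r b" for j k
  proof -
    have "R (conv M mul (eps b d j) (conv M mul (a k) (eps b d d))) = R (\<lambda>m. co k j * eps b d d m)"
    proof (rule eqR)
      fix b' assume b': "b' < N"
      show "P b' (conv M mul (eps b d j) (conv M mul (a k) (eps b d d))) = P b' (\<lambda>m. co k j * eps b d d m)"
      proof (cases "b' = b")
        case True
        let ?E = "\<lambda>i l. mat (r b) (r b) (\<lambda>(x, y). if x = i \<and> y = l then 1 else 0) :: 'k mat"
        have Pa: "P b (a k) \<in> carrier_mat (r b) (r b)" by (rule car[OF bd(1) a(1)])
        have "?E d j * (P b (a k) * ?E d d) = co k j \<cdot>\<^sub>m ?E d d"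
        proof (rule eq_matI)
          fix x y assume "x < dim_row (co k j \<cdot>\<^sub>m ?E d d)" "y < dim_col (co k j \<cdot>\<^sub>m ?E d d)"
          then have xy: "x < r b" "y < r b" by auto
          have E: "?E i l \<in> carrier_mat (r b) (r b)" for i l by simp
          have 1: "(P b (a k) * ?E d d) $$ (l, y) = (if y = d then P b (a k) $$ (l, d) else 0)" if "l < r b" for l
          proof -
            have "(P b (a k) * ?E d d) $$ (l, y) = (\<Sum>t<r b. P b (a k) $$ (l, t) * ?E d d $$ (t, y))"
              by (rule mat_mult_entry[OF Pa E that xy(2)])
            also have "\<dots> = (\<Sum>t<r b. if t = d then (if y = d then P b (a k) $$ (l, d) else 0) else 0)"
              by (rule sum.cong) (use xy in auto)
            finally show ?thesis using bd(2) by simp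
          qed
          have "(?E d j * (P b (a k) * ?E d d)) $$ (x, y) = (\<Sum>l<r b. ?E d j $$ (x, l) * (P b (a k) * ?E d d) $$ (l, y))"
            by (rule mat_mult_entry[OF E mult_carrier_mat[OF Pa E] xy])
          also have "\<dots> = (\<Sum>l<r b. if l = j then (if x = d \<and> y = d then co k j else 0) else 0)"
            by (rule sum.cong) (use xy 1 co_def in auto)
          also have "\<dots> = (co k j \<cdot>\<^sub>m ?E d d) $$ (x, y)" using j xy by simp
          finally show "(?E d j * (P b (a k) * ?E d d)) $$ (x, y) = (co k j \<cdot>\<^sub>m ?E d d) $$ (x, y)" .
        qed (use Pa in auto)
        then show ?thesis
          unfolding True mult[OF bd(1) eps(1) malg_conv[OF a(1) eps(1)]] mult[OF bd(1) a(1) eps(1)]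
            scale[OF bd(1) eps(1)] eps(2)[OF bd(1)] by simp
      next
        case False
        have "P b' (a k) * 0\<^sub>m (r b') (r b') = 0\<^sub>m (r b') (r b')" by (rule right_mult_zero_mat[OF car[OF b' a(1)]])
        then show ?thesis
          unfolding mult[OF b' eps(1) malg_conv[OF a(1) eps(1)]] mult[OF b' a(1) eps(1)]
            scale[OF b' eps(1)] eps(2)[OF b'] using False by simp
      qed
    qed (intro malg_conv malg_scale eps(1) a(1))+
    then have "R (eps b d j) * (R (a k) * R (eps b d d)) = co k j \<cdot>\<^sub>m R (eps b d d)"
      unfolding R_conv algmat_scale .
    then have "(R (eps b d j) * (R (a k) * R (eps b d d))) *\<^sub>v w = (co k j \<cdot>\<^sub>m R (eps b d d)) *\<^sub>v w" by simp
    moreover have "(R (eps b d j) * (R (a k) * R (eps b d d))) *\<^sub>v w = R (eps b d j) *\<^sub>v (R (a k) *\<^sub>v ?v)"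
      using assoc_mult_mat_vec[OF algmat_car mult_carrier_mat[OF algmat_car algmat_car] w]
        assoc_mult_mat_vec[OF algmat_car algmat_car w] unfolding vv_def by metis
    moreover have "(co k j \<cdot>\<^sub>m R (eps b d d)) *\<^sub>v w = co k j \<cdot>\<^sub>v ?v"
      unfolding vv_def using w by (intro eq_vecI) (auto simp: smult_scalar_prod_distrib[of _ n])
    ultimately show ?thesis using a(2) by simp
  qed
  \<comment> \<open>Column \<open>d\<close> of \<open>a k\<close> in the block expresses
    \<open>unit_vec n k\<close> through the vectors \<open>vv j\<close> with coefficients
    \<open>co k j\<close>; the coordinate \<open>q\<close> of this expansion is the claim.\<close>
  have expand: "(\<Sum>j<r b. co k j * vv j $ q) = (if k = q then 1 else 0)" if k: "k < n" for k
  proof -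
    \<comment> \<open>The dummy coordinate 0 only brings the index set into the form of pairs for
      which \<open>P_sum\<close> is stated.\<close>
    let ?y = "\<lambda>m. \<Sum>s\<in>{0::nat} \<times> {..<r b}. co k (snd s) * eps b (snd s) d m"
    have fin1: "finite ({0::nat} \<times> {..<r b})" by simp
    have yin: "?y \<in> malg M" using eps(1) by (auto simp: malg_def)
    have "R (conv M mul (a k) (eps b d d)) = R ?y"
    proof (rule eqR[OF malg_conv[OF a(1) eps(1)] yin])
      fix b' assume b': "b' < N"
      show "P b' (conv M mul (a k) (eps b d d)) = P b' ?y"
      proof (rule eq_matI)
        fix x y assume "x < dim_row (P b' ?y)" "y < dim_col (P b' ?y)"
        then have xy: "x < r b'" "y < r b'" using car[OF b' yin] by auto
        have "?y \<in> malg M \<and> (\<forall>x<r b'. \<forall>y<r b'. P b' ?y $$ (x, y)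
            = (\<Sum>s\<in>{0::nat} \<times> {..<r b}. co k (snd s) * P b' (eps b (snd s) d) $$ (x, y)))"
          by (rule P_sum[OF fin1 eps(1) b'])
        then have L: "P b' ?y $$ (x, y) = (\<Sum>s\<in>{0::nat} \<times> {..<r b}. co k (snd s) * P b' (eps b (snd s) d) $$ (x, y))"
          using xy by blast
        have "P b' (conv M mul (a k) (eps b d d)) $$ (x, y)
          = (\<Sum>t<r b'. P b' (a k) $$ (x, t) * P b' (eps b d d) $$ (t, y))"
          unfolding mult[OF b' a(1) eps(1)] by (rule mat_mult_entry[OF car[OF b' a(1)] car[OF b' eps(1)] xy])
        also have "\<dots> = (\<Sum>t<r b'. if t = d then (if b' = b \<and> y = d then co k x else 0) else 0)"
          by (rule sum.cong) (use xy eps(2)[OF b'] co_def in auto)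
        also have "\<dots> = (if b' = b \<and> y = d then co k x else 0)" using bd(2) by auto
        also have "\<dots> = (\<Sum>s\<in>{0::nat} \<times> {..<r b}. if s = (0, x) then (if b' = b \<and> y = d then co k x else 0) else 0)"
          using xy by auto
        also have "\<dots> = P b' ?y $$ (x, y)"
          unfolding L by (rule sum.cong) (use xy eps(2)[OF b'] in \<open>auto split: if_splits\<close>)
        finally show "P b' (conv M mul (a k) (eps b d d)) $$ (x, y) = P b' ?y $$ (x, y)" .
      qed (use car[OF b' yin] car[OF b' malg_conv[OF a(1)[of k] eps(1)[of b d d]]] in auto)
    qed
    then have "(R (a k) * R (eps b d d)) $$ (q, p) = R ?y $$ (q, p)" unfolding R_conv by simp
    also have "\<dots> = (\<Sum>s\<in>{0::nat} \<times> {..<r b}. co k (snd s) * R (eps b (snd s) d) $$ (q, p))"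
      by (rule algmat_sum_entry[OF fin1 pq(2,1)])
    also have "\<dots> = (\<Sum>j<r b. co k j * R (eps b j d) $$ (q, p))"
      by (rule sum.reindex_bij_witness[where i = "\<lambda>j. (0, j)" and j = snd]) auto
    also have "\<dots> = (\<Sum>j<r b. co k j * vv j $ q)"
      using pq by (simp add: vv_def w_def)
    finally have "(\<Sum>j<r b. co k j * vv j $ q) = ((R (a k) * R (eps b d d)) *\<^sub>v w) $ q"
      using pq by (simp add: w_def del: index_mult_mat(1))
    also have "(R (a k) * R (eps b d d)) *\<^sub>v w = R (a k) *\<^sub>v ?v"
      unfolding vv_def by (rule assoc_mult_mat_vec[OF algmat_car algmat_car w])
    finally show ?thesis using a(2) pq k by simp
  qed
  \<comment> \<open>The product of \<open>a p\<close> with \<open>eps b d l\<close> maps everything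
    into the line of \<open>unit_vec n p\<close>; the weights \<open>vv l $ q\<close> combine the
    corresponding functionals into coordinate \<open>q\<close>, by \<open>expand\<close>.\<close>
  let ?x = "\<lambda>m. \<Sum>j<r b. vv j $ q * conv M mul (a p) (eps b d j) m"
  show ?thesis
  proof (intro bexI[of _ ?x] allI impI)
    show "?x \<in> malg M" using malg_conv[OF a(1) eps(1)] by (auto simp: malg_def)
    fix i j assume i: "i < n" and j: "j < n"
    have ent: "R (conv M mul (a p) (eps b d l)) $$ (i, j) = (if i = p then co j l else 0)" if l: "l < r b" for l
    proof -
      have "R (conv M mul (a p) (eps b d l)) $$ (i, j) = ((R (a p) * R (eps b d l)) *\<^sub>v unit_vec n j) $ i"
        unfolding R_conv using i j by (simp del: index_mult_mat(1))
      also have "(R (a p) * R (eps b d l)) *\<^sub>v unit_vec n j = R (a p) *\<^sub>v (co j l \<cdot>\<^sub>v ?v)"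
        unfolding sandwich[OF l, symmetric] by (rule assoc_mult_mat_vec[OF algmat_car algmat_car]) simp
      also have "\<dots> = co j l \<cdot>\<^sub>v unit_vec n p"
        using mult_mat_vec[OF algmat_car vv] a(2) by metis
      finally show ?thesis using i pq by simp
    qed
    have "R ?x $$ (i, j) = (\<Sum>l<r b. vv l $ q * R (conv M mul (a p) (eps b d l)) $$ (i, j))"
      by (rule algmat_sum_entry[OF finite_lessThan i j])
    also have "\<dots> = (\<Sum>l<r b. if i = p then co j l * vv l $ q else 0)"
      by (rule sum.cong) (use ent in auto)
    also have "\<dots> = (if i = p then (\<Sum>l<r b. co j l * vv l $ q) else 0)" by simp
    also have "\<dots> = (if i = p \<and> j = q then 1 else 0)" unfolding expand[OF j] by simp
    finally show "R ?x $$ (i, j) = (if i = p \<and> j = q then 1 else 0)" .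
  qed
qed

text \<open>An element of kM acting as a matrix unit is pushed forward to the group algebra along
  \<open>m \<mapsto> e m e\<close>; elements not above \<open>e\<close> contribute nothing, as the
  inflated module is zero there.\<close>

lemma splits_matrix_units:
  assumes split: "splits TYPE('k) M mul uu"
  shows "matrix_units_in_span (Gp M mul e) n U"
proof -
  obtain ns and \<phi> :: "('a \<Rightarrow> 'k) \<Rightarrow> 'k mat list" where
    len: "\<forall>a\<in>malg M. length (\<phi> a) = length ns \<and> (\<forall>i<length ns. \<phi> a ! i \<in> carrier_mat (ns!i) (ns!i))"
    and add: "\<forall>a\<in>malg M. \<forall>b\<in>malg M. \<phi> (a + b) = map2 (+) (\<phi> a) (\<phi> b)"
    and scale: "\<forall>c. \<forall>a\<in>malg M. \<phi> (\<lambda>x. c * a x) = map (\<lambda>A. c \<cdot>\<^sub>m A) (\<phi> a)"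
    and mult: "\<forall>a\<in>malg M. \<forall>b\<in>malg M. \<phi> (conv M mul a b) = map2 (*) (\<phi> a) (\<phi> b)"
    and one: "\<phi> (delta uu) = map (\<lambda>n. 1\<^sub>m n) ns"
    and surj: "\<forall>As. length As = length ns \<and> (\<forall>i<length ns. As ! i \<in> carrier_mat (ns!i) (ns!i))
           \<longrightarrow> (\<exists>a\<in>malg M. \<phi> a = As)"
    and ker: "{a \<in> malg M. \<phi> a = map (\<lambda>n. 0\<^sub>m n n) ns} = rad M mul"
    using split unfolding splits_def by blast
  have unit: "\<exists>x\<in>malg M. \<forall>i<n. \<forall>j<n. R x $$ (i, j) = (if i = p \<and> j = q then 1 else 0)"
    if pq: "p < n" "q < n" for p q
  proof (rule algebra_matrix_unit[where N = "length ns" and r = "\<lambda>b. ns ! b" and P = "\<lambda>b a. \<phi> a ! b"])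
    fix A :: "nat \<Rightarrow> 'k mat" assume A: "\<And>b. b < length ns \<Longrightarrow> A b \<in> carrier_mat (ns ! b) (ns ! b)"
    then have "\<exists>a\<in>malg M. \<phi> a = map A [0..<length ns]" by (intro surj[rule_format]) auto
    then obtain a where "a \<in> malg M" "\<phi> a = map A [0..<length ns]" by blast
    then show "\<exists>x\<in>malg M. \<forall>b<length ns. \<phi> x ! b = A b" by (intro bexI[of _ a]) simp_all
  next
    fix x assume x: "x \<in> malg M" "\<And>b. b < length ns \<Longrightarrow> \<phi> x ! b = 0\<^sub>m (ns ! b) (ns ! b)"
    have "\<phi> x = map (\<lambda>n. 0\<^sub>m n n) ns" by (rule nth_equalityI) (use x len in auto)
    then show "x \<in> rad M mul" using x(1) ker by blast
  qed (use len add scale mult one pq in auto)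
  show ?thesis
    unfolding matrix_units_in_span_def
  proof (intro allI impI)
    fix p q assume pq: "p < n" "q < n"
    obtain x where x: "\<And>i j. i < n \<Longrightarrow> j < n \<Longrightarrow> R x $$ (i, j) = (if i = p \<and> j = q then 1 else 0)"
      using unit[OF pq] by auto
    let ?D = "{m \<in> M. J e \<subseteq> J m}"
    show "\<exists>c. \<forall>i<n. \<forall>j<n. (\<Sum>g\<in>Gp M mul e. c g * U g $$ (i, j)) = (if i = p \<and> j = q then 1 else 0)"
    proof (intro exI allI impI)
      fix i j assume ij: "i < n" "j < n"
      have "(\<Sum>g\<in>Gp M mul e. (\<Sum>m\<in>{m \<in> ?D. e \<cdot> m \<cdot> e = g}. x m) * U g $$ (i, j))
        = (\<Sum>g\<in>Gp M mul e. \<Sum>m\<in>{m \<in> ?D. e \<cdot> m \<cdot> e = g}. x m * U (e \<cdot> m \<cdot> e) $$ (i, j))"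
        unfolding sum_distrib_right by (intro sum.cong) auto
      also have "\<dots> = (\<Sum>m\<in>?D. x m * U (e \<cdot> m \<cdot> e) $$ (i, j))"
        by (rule sum.group) (use fin finite_Gp[OF e] local_Gp[OF e] in auto)
      also have "\<dots> = (\<Sum>m\<in>M. x m * S m $$ (i, j))"
        by (rule sum.mono_neutral_cong_left) (use fin ij in \<open>auto simp: inflate_eq\<close>)
      also have "\<dots> = (if i = p \<and> j = q then 1 else 0)" using x[OF ij] algmat_entry[OF ij] by metis
      finally show "(\<Sum>g\<in>Gp M mul e. (\<Sum>m\<in>{m \<in> ?D. e \<cdot> m \<cdot> e = g}. x m) * U g $$ (i, j))
        = (if i = p \<and> j = q then 1 else 0)" .
    qed
  qed
qed

end

text \<open>A matrix unit of a Kronecker product is the Kronecker product of one matrix unit from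
  each factor, so the coefficients multiply.\<close>

lemma matrix_units_kron:
  assumes A: "\<And>g. g \<in> G \<Longrightarrow> A g \<in> carrier_mat a a" and B: "\<And>h. h \<in> H \<Longrightarrow> B h \<in> carrier_mat b b"
    and uA: "matrix_units_in_span G a A" and uB: "matrix_units_in_span H b B"
  shows "matrix_units_in_span (G \<times> H) (a * b) (\<lambda>(g, h). kron (A g) (B h :: 'k::field mat))"
  unfolding matrix_units_in_span_def
proof (intro allI impI)
  fix p q assume p: "p < a * b" and q: "q < a * b"
  note dp = div_mod_less[OF p] and dq = div_mod_less[OF q]
  obtain c where c: "\<And>i j. i < a \<Longrightarrow> j < a \<Longrightarrow>
      (\<Sum>g\<in>G. c g * A g $$ (i, j)) = (if i = p div b \<and> j = q div b then 1 else 0)"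
    by (rule matrix_units_in_spanD[OF uA dp(1) dq(1)]) blast
  obtain d where d: "\<And>i j. i < b \<Longrightarrow> j < b \<Longrightarrow>
      (\<Sum>h\<in>H. d h * B h $$ (i, j)) = (if i = p mod b \<and> j = q mod b then 1 else 0)"
    by (rule matrix_units_in_spanD[OF uB dp(2) dq(2)]) blast
  show "\<exists>c. \<forall>i<a * b. \<forall>j<a * b. (\<Sum>g\<in>G \<times> H. c g * (case g of (g, h) \<Rightarrow> kron (A g) (B h)) $$ (i, j))
      = (if i = p \<and> j = q then 1 else 0)"
  proof (intro exI allI impI)
    fix i j assume i: "i < a * b" and j: "j < a * b"
    note di = div_mod_less[OF i] and dj = div_mod_less[OF j]
    have "(\<Sum>g\<in>G \<times> H. (c (fst g) * d (snd g)) * (case g of (g, h) \<Rightarrow> kron (A g) (B h)) $$ (i, j))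
      = (\<Sum>g\<in>G. \<Sum>h\<in>H. (c g * A g $$ (i div b, j div b)) * (d h * B h $$ (i mod b, j mod b)))"
      unfolding sum.cartesian_product
      by (intro sum.cong refl) (use A B i j in \<open>auto simp: kron_index[of _ a _ b]\<close>)
    also have "\<dots> = (\<Sum>g\<in>G. c g * A g $$ (i div b, j div b)) * (\<Sum>h\<in>H. d h * B h $$ (i mod b, j mod b))"
      by (simp add: sum_product)
    also have "\<dots> = (if i = p \<and> j = q then 1 else 0)"
    proof -
      have "i = p \<longleftrightarrow> i div b = p div b \<and> i mod b = p mod b" "j = q \<longleftrightarrow> j div b = q div b \<and> j mod b = q mod b"
        by (metis div_mult_mod_eq)+
      then show ?thesis unfolding c[OF di(1) dj(1)] d[OF di(2) dj(2)] by simp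
    qed
    finally show "(\<Sum>g\<in>G \<times> H. (c (fst g) * d (snd g)) * (case g of (g, h) \<Rightarrow> kron (A g) (B h)) $$ (i, j))
      = (if i = p \<and> j = q then 1 else 0)" .
  qed
qed

context fin_orthogroup
begin

text \<open>Transposition exchanges row and column index, and inversion only reindexes the sum over
  the group.\<close>

lemma matrix_units_dual:
  assumes e: "idm e" and U: "mrep (Gp M mul e) mul e n U" and u: "matrix_units_in_span (Gp M mul e) n U"
  shows "matrix_units_in_span (Gp M mul e) n (\<lambda>g. transpose_mat (U (ginv M mul e g) :: 'k::field mat))"
  unfolding matrix_units_in_span_def
proof (intro allI impI)
  fix p q assume pq: "p < n" "q < n"
  obtain c where c: "\<And>i j. i < n \<Longrightarrow> j < n \<Longrightarrow>
      (\<Sum>g\<in>Gp M mul e. c g * U g $$ (i, j)) = (if i = q \<and> j = p then 1 else 0)"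
    by (rule matrix_units_in_spanD[OF u pq(2,1)]) blast
  have car: "U g \<in> carrier_mat n n" if "g \<in> Gp M mul e" for g using U that unfolding mrep_def by blast
  show "\<exists>c. \<forall>i<n. \<forall>j<n. (\<Sum>g\<in>Gp M mul e. c g * transpose_mat (U (ginv M mul e g)) $$ (i, j))
      = (if i = p \<and> j = q then 1 else 0)"
  proof (intro exI allI impI)
    fix i j assume ij: "i < n" "j < n"
    have "(\<Sum>g\<in>Gp M mul e. c (ginv M mul e g) * transpose_mat (U (ginv M mul e g)) $$ (i, j))
      = (\<Sum>g\<in>Gp M mul e. c (ginv M mul e g) * U (ginv M mul e g) $$ (j, i))"
    proof (rule sum.cong[OF refl])
      fix g assume "g \<in> Gp M mul e"
      then have "U (ginv M mul e g) \<in> carrier_mat n n" using car ginv_in[OF e] by blast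
      then show "c (ginv M mul e g) * transpose_mat (U (ginv M mul e g)) $$ (i, j)
        = c (ginv M mul e g) * U (ginv M mul e g) $$ (j, i)" using ij by simp
    qed
    also have "\<dots> = (\<Sum>g\<in>Gp M mul e. c g * U g $$ (j, i))"
      by (rule sum.reindex_bij_witness[where i = "ginv M mul e" and j = "ginv M mul e"])
        (use e ginv_ginv in auto)
    also have "\<dots> = (if i = p \<and> j = q then 1 else 0)" using c[OF ij(2,1)] by auto
    finally show "(\<Sum>g\<in>Gp M mul e. c (ginv M mul e g) * transpose_mat (U (ginv M mul e g)) $$ (i, j))
      = (if i = p \<and> j = q then 1 else 0)" .
  qed
qed

end

section \<open>Duality\<close>

lemma arrows_cong:
  fixes S S' T T' :: "'a \<Rightarrow> 'k::field mat"
  assumes "\<And>x. x \<in> M \<Longrightarrow> S x = S' x" "\<And>x. x \<in> M \<Longrightarrow> T x = T' x"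
  shows "arrows M mul s S t T = arrows M mul s S' t T'"
proof -
  have "cocycles M mul s S t T = cocycles M mul s S' t T'"
    using assms by (simp add: cocycles_def)
  moreover have "(\<lambda>i j. if i < t \<and> j < s then (T x * A - A * S x) $$ (i,j) else 0)
      = (\<lambda>i j. if i < t \<and> j < s then (T' x * A - A * S' x) $$ (i,j) else 0)" if "x \<in> M" for x A
    by (simp only: assms[OF that])
  then have "coboundaries M s S t T = coboundaries M s S' t T'"
    unfolding coboundaries_def by (simp cong: if_cong)
  ultimately show ?thesis by (simp add: arrows_def)
qed

definition swap_fun :: "('a \<Rightarrow> nat \<Rightarrow> nat \<Rightarrow> 'k::field) \<Rightarrow> ('a \<Rightarrow> nat \<Rightarrow> nat \<Rightarrow> 'k)" where
  "swap_fun Z = (\<lambda>x i j. Z x j i)"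

lemma swap_swap [simp]: "swap_fun (swap_fun Z) = Z"
  by (simp add: swap_fun_def)

lemma tomat_swap: "tomat s t (swap_fun Z x) = transpose_mat (tomat t s (Z x))"
  by (rule eq_matI) (auto simp: tomat_def swap_fun_def)

lemma dim_swap:
  assumes "F.subspace A" "fin_dim fscale (swap_fun ` A)"
  shows "F.dim (swap_fun ` A) = F.dim A"
  by (rule FF.dim_iso_on(2)[symmetric, OF assms(1) _ _ _ assms(2)])
    (auto simp: swap_fun_def fscale_def fun_eq_iff)

text \<open>Transposing the block triangular matrices of an extension reverses products and
  exchanges submodule and quotient, so the result is an extension over the opposite multiplication
  with the two modules interchanged.\<close>

lemma swap_cocycle:
  fixes S T :: "'a \<Rightarrow> 'k::field mat"
  assumes S: "\<And>x. x \<in> M \<Longrightarrow> S x \<in> carrier_mat s s" and T: "\<And>x. x \<in> M \<Longrightarrow> T x \<in> carrier_mat t t"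
    and Z: "Z \<in> cocycles M mul s S t T"
  shows "swap_fun Z \<in> cocycles M (opmul mul) t (\<lambda>x. transpose_mat (T x)) s (\<lambda>x. transpose_mat (S x))"
proof -
  have "tomat s t (swap_fun Z (mul y x)) = transpose_mat (S x) * tomat s t (swap_fun Z y)
      + tomat s t (swap_fun Z x) * transpose_mat (T y)" if "x \<in> M" "y \<in> M" for x y
  proof -
    have c: "T y * tomat t s (Z x) \<in> carrier_mat t s" "tomat t s (Z y) * S x \<in> carrier_mat t s"
      using mult_carrier_mat[OF T[OF that(2)] tomat_carrier] mult_carrier_mat[OF tomat_carrier S[OF that(1)]] by auto
    have "tomat s t (swap_fun Z (mul y x)) = transpose_mat (T y * tomat t s (Z x) + tomat t s (Z y) * S x)"
      unfolding tomat_swap using Z that by (simp add: cocycles_def)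
    also have "\<dots> = transpose_mat (T y * tomat t s (Z x)) + transpose_mat (tomat t s (Z y) * S x)"
      by (rule transpose_add[OF c])
    also have "transpose_mat (T y * tomat t s (Z x)) = tomat s t (swap_fun Z x) * transpose_mat (T y)"
      unfolding tomat_swap by (rule transpose_mult[OF T[OF that(2)] tomat_carrier])
    also have "transpose_mat (tomat t s (Z y) * S x) = transpose_mat (S x) * tomat s t (swap_fun Z y)"
      unfolding tomat_swap by (rule transpose_mult[OF tomat_carrier S[OF that(1)]])
    also have "tomat s t (swap_fun Z x) * transpose_mat (T y) + transpose_mat (S x) * tomat s t (swap_fun Z y)
      = transpose_mat (S x) * tomat s t (swap_fun Z y) + tomat s t (swap_fun Z x) * transpose_mat (T y)"
      by (rule comm_add_mat[of _ s t])
        (use mult_carrier_mat[of "tomat s t (swap_fun Z x)" s t "transpose_mat (T y)" t] mult_carrier_mat[of "transpose_mat (S x)" s s "tomat s t (swap_fun Z y)" t]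
          S[OF that(1)] T[OF that(2)] in simp_all)
    finally show ?thesis .
  qed
  then show ?thesis using Z by (auto simp: cocycles_def opmul_def) (auto simp: swap_fun_def)
qed

lemma swap_coboundary:
  fixes S T :: "'a \<Rightarrow> 'k::field mat"
  assumes S: "\<And>x. x \<in> M \<Longrightarrow> S x \<in> carrier_mat s s" and T: "\<And>x. x \<in> M \<Longrightarrow> T x \<in> carrier_mat t t"
    and Z: "Z \<in> coboundaries M s S t T"
  shows "swap_fun Z \<in> coboundaries M t (\<lambda>x. transpose_mat (T x)) s (\<lambda>x. transpose_mat (S x))"
proof -
  obtain A where A: "A \<in> carrier_mat t s" "Z = of_mat_fun M t s (\<lambda>x. T x * A - A * S x)"
    using Z coboundaries_iff[of Z M s S t T] by blast
  \<comment> \<open>The transpose of \<open>T x * A - A * S x\<close> carries the \<open>T\<close>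
    term with a plus sign, whereas a coboundary for the exchanged modules carries it with a minus
    sign; hence the negation.\<close>
  let ?B = "- transpose_mat A"
  have "(T x * A - A * S x) $$ (i, j) = (transpose_mat (S x) * ?B - ?B * transpose_mat (T x)) $$ (j, i)"
    if x: "x \<in> M" and ij: "i < t" "j < s" for x i j
  proof -
    have B: "?B \<in> carrier_mat s t" using A by simp
    have St: "transpose_mat (S x) \<in> carrier_mat s s" "transpose_mat (T x) \<in> carrier_mat t t" using S[OF x] T[OF x] by auto
    have c: "T x * A \<in> carrier_mat t s" "A * S x \<in> carrier_mat t s"
      "transpose_mat (S x) * ?B \<in> carrier_mat s t" "?B * transpose_mat (T x) \<in> carrier_mat s t"
      using mult_carrier_mat[OF T[OF x] A(1)] mult_carrier_mat[OF A(1) S[OF x]] mult_carrier_mat[OF St(1) B] mult_carrier_mat[OF B St(2)] by auto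
    have e1: "(T x * A) $$ (i, j) = (\<Sum>l<t. T x $$ (i, l) * A $$ (l, j))" by (rule mat_mult_entry[OF T[OF x] A(1) ij])
    have e2: "(A * S x) $$ (i, j) = (\<Sum>l<s. A $$ (i, l) * S x $$ (l, j))" by (rule mat_mult_entry[OF A(1) S[OF x] ij])
    have "(transpose_mat (S x) * ?B) $$ (j, i) = (\<Sum>l<s. transpose_mat (S x) $$ (j, l) * ?B $$ (l, i))"
      by (rule mat_mult_entry[OF St(1) B ij(2,1)])
    also have "\<dots> = - (A * S x) $$ (i, j)"
      unfolding e2 sum_negf[symmetric] by (rule sum.cong) (use A(1) S[OF x] ij in auto)
    finally have e3: "(transpose_mat (S x) * ?B) $$ (j, i) = - (A * S x) $$ (i, j)" .
    have "(?B * transpose_mat (T x)) $$ (j, i) = (\<Sum>l<t. ?B $$ (j, l) * transpose_mat (T x) $$ (l, i))"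
      by (rule mat_mult_entry[OF B St(2) ij(2,1)])
    also have "\<dots> = - (T x * A) $$ (i, j)"
      unfolding e1 sum_negf[symmetric] by (rule sum.cong) (use A(1) T[OF x] ij in auto)
    finally have e4: "(?B * transpose_mat (T x)) $$ (j, i) = - (T x * A) $$ (i, j)" .
    have "(T x * A - A * S x) $$ (i, j) = (T x * A) $$ (i, j) - (A * S x) $$ (i, j)"
      by (rule index_minus_mat(1)) (use carrier_matD[OF c(2)] ij in simp_all)
    moreover have "(transpose_mat (S x) * ?B - ?B * transpose_mat (T x)) $$ (j, i)
        = (transpose_mat (S x) * ?B) $$ (j, i) - (?B * transpose_mat (T x)) $$ (j, i)"
      by (rule index_minus_mat(1)) (use carrier_matD[OF c(4)] ij in simp_all)
    ultimately show ?thesis unfolding e3 e4 by simp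
  qed
  then have "swap_fun Z = of_mat_fun M s t (\<lambda>x. transpose_mat (S x) * ?B - ?B * transpose_mat (T x))"
    unfolding A(2) by (auto simp: swap_fun_def of_mat_fun_def fun_eq_iff)
  moreover have "?B \<in> carrier_mat s t" using A by simp
  ultimately show ?thesis using coboundaries_iff[of "swap_fun Z" M t "\<lambda>x. transpose_mat (T x)" s "\<lambda>x. transpose_mat (S x)"] by blast
qed

lemma (in rep_pair) arrows_op:
  "arrows M mul s S t T = arrows M (opmul mul) t (\<lambda>x. transpose_mat (T x)) s (\<lambda>x. transpose_mat (S x))"
proof -
  let ?St = "\<lambda>x. transpose_mat (S x)" and ?Tt = "\<lambda>x. transpose_mat (T x)"
  have car: "?St x \<in> carrier_mat s s" "?Tt x \<in> carrier_mat t t" if "x \<in> M" for x using that by auto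
  have oo: "opmul (opmul mul) = mul" by (simp add: opmul_def)
  have Z: "swap_fun ` cocycles M mul s S t T = cocycles M (opmul mul) t ?Tt s ?St"
  proof (intro equalityI subsetI)
    fix Y assume "Y \<in> cocycles M (opmul mul) t ?Tt s ?St"
    then have "swap_fun Y \<in> cocycles M (opmul (opmul mul)) s (\<lambda>x. transpose_mat (?St x)) t (\<lambda>x. transpose_mat (?Tt x))"
      by (rule swap_cocycle[rotated 2]) (use car in auto)
    then have "swap_fun Y \<in> cocycles M mul s S t T" by (simp add: oo)
    then show "Y \<in> swap_fun ` cocycles M mul s S t T" by (metis image_eqI swap_swap)
  next
    fix Y assume "Y \<in> swap_fun ` cocycles M mul s S t T"
    then obtain Z where Z: "Z \<in> cocycles M mul s S t T" "Y = swap_fun Z" by blast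
    show "Y \<in> cocycles M (opmul mul) t ?Tt s ?St"
      unfolding Z(2) by (rule swap_cocycle[OF S_car T_car Z(1)])
  qed
  have B: "swap_fun ` coboundaries M s S t T = coboundaries M t ?Tt s ?St"
  proof (intro equalityI subsetI)
    fix Y assume "Y \<in> coboundaries M t ?Tt s ?St"
    then have "swap_fun Y \<in> coboundaries M s (\<lambda>x. transpose_mat (?St x)) t (\<lambda>x. transpose_mat (?Tt x))"
      by (rule swap_coboundary[rotated 2]) (use car in auto)
    then have "swap_fun Y \<in> coboundaries M s S t T" by simp
    then show "Y \<in> swap_fun ` coboundaries M s S t T" by (metis image_eqI swap_swap)
  next
    fix Y assume "Y \<in> swap_fun ` coboundaries M s S t T"
    then obtain Z where Z: "Z \<in> coboundaries M s S t T" "Y = swap_fun Z" by blast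
    show "Y \<in> coboundaries M t ?Tt s ?St"
      unfolding Z(2) by (rule swap_coboundary[OF S_car T_car Z(1)])
  qed
  interpret FS: vspace fscale by standard
  have fZ: "fin_dim fscale (swap_fun ` cocycles M mul s S t T)"
    unfolding Z by (rule fin_dim_cocycles[OF fin car(2,1)])
  have fB: "fin_dim fscale (swap_fun ` coboundaries M s S t T)"
    by (rule FS.fin_dim_subset[OF fZ image_mono[OF coboundaries_subset]])
  have sB: "F.subspace (coboundaries M s S t T)"
  proof -
    show ?thesis
      unfolding F.subspace_def
    proof (intro conjI ballI allI)
      show "0 \<in> coboundaries M s S t T"
        unfolding coboundaries_def by (intro CollectI bexI[of _ "0\<^sub>m t s"]) (auto simp: fun_eq_iff)
    next
      fix Z Z' assume Z: "Z \<in> coboundaries M s S t T" "Z' \<in> coboundaries M s S t T"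
      obtain A where A1: "A \<in> carrier_mat t s" "Z = of_mat_fun M t s (cob A)"
        using iffD1[OF coboundaries_iff Z(1)] by blast
      obtain A' where A2: "A' \<in> carrier_mat t s" "Z' = of_mat_fun M t s (cob A')"
        using iffD1[OF coboundaries_iff Z(2)] by blast
      note A = A1 A2
      have "cob (A + A') x $$ (i, j) = cob A x $$ (i, j) + cob A' x $$ (i, j)" if "x \<in> M" "i < t" "j < s" for x i j
        unfolding mult_add_distrib_mat[OF T_car[OF that(1)] A(1,3)] add_mult_distrib_mat[OF A(1,3) S_car[OF that(1)]]
        using that carrier_matD[OF T_mult_car[OF that(1) A(1)]] carrier_matD[OF T_mult_car[OF that(1) A(3)]]
          carrier_matD[OF mult_S_car[OF that(1) A(1)]] carrier_matD[OF mult_S_car[OF that(1) A(3)]]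
        by (simp del: index_mult_mat)
      then have "Z + Z' = of_mat_fun M t s (cob (A + A'))"
        unfolding A(2,4) by (auto simp: of_mat_fun_def fun_eq_iff)
      then show "Z + Z' \<in> coboundaries M s S t T"
        by (intro iffD2[OF coboundaries_iff] bexI[of _ "A + A'"] add_carrier_mat A)
    next
      fix c Z assume Z: "Z \<in> coboundaries M s S t T"
      obtain A where A: "A \<in> carrier_mat t s" "Z = of_mat_fun M t s (cob A)"
        using iffD1[OF coboundaries_iff Z] by blast
      have "cob (c \<cdot>\<^sub>m A) x $$ (i, j) = c * cob A x $$ (i, j)" if "x \<in> M" "i < t" "j < s" for x i j
        unfolding mult_smult_distrib[OF T_car[OF that(1)] A(1)] mult_smult_assoc_mat[OF A(1) S_car[OF that(1)]]
        using that carrier_matD[OF T_mult_car[OF that(1) A(1)]] carrier_matD[OF mult_S_car[OF that(1) A(1)]]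
        by (simp add: right_diff_distrib del: index_mult_mat)
      then have "fscale c Z = of_mat_fun M t s (cob (c \<cdot>\<^sub>m A))"
        unfolding A(2) by (auto simp: of_mat_fun_def fun_eq_iff fscale_def)
      then show "fscale c Z \<in> coboundaries M s S t T"
        by (intro iffD2[OF coboundaries_iff] bexI[of _ "c \<cdot>\<^sub>m A"] smult_carrier_mat A)
    qed
  qed
  show ?thesis
    unfolding arrows_def Z[symmetric] B[symmetric]
    using dim_swap[OF subspace_cocycles[OF S_car T_car] fZ] dim_swap[OF sB fB] by simp
qed

context idem_pair
begin

text \<open>The permutation action on the group \<open>Ge\<close>, the image of \<open>X/Q\<close> under \<open>x \<mapsto> e x\<close>.\<close>
definition pe :: "'a \<times> 'a \<Rightarrow> 'a \<Rightarrow> 'a" where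
  "pe g y = e \<cdot> (fst g \<cdot> y \<cdot> ie (snd g))"

lemma pe_in: "g \<in> GG \<Longrightarrow> y \<in> Ge \<Longrightarrow> pe g y \<in> Ge"
  unfolding pe_def using eX gxh_X Ge_X ginv_in[OF e] by (auto simp: mem_Times_iff)

lemma pe_mul:
  assumes g: "g \<in> GG" "h \<in> GG" and y: "y \<in> Ge"
  shows "pe (mG g h) y = pe g (pe h y)"
proof -
  have i: "fst g \<in> Gf" "fst h \<in> Gf" "ie (snd g) \<in> Ge" "ie (snd h) \<in> Ge"
    using g ginv_in[OF e] by (auto simp: mem_Times_iff)
  have hX: "fst h \<cdot> y \<cdot> ie (snd h) \<in> X" by (rule gxh_X[OF i(2) Ge_X[OF y] i(4)])
  have M: "fst g \<in> M" "fst h \<in> M" "ie (snd g) \<in> M" "ie (snd h) \<in> M" "y \<in> M" using i y by auto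
  have "fst (mG g h) \<cdot> y \<cdot> ie (snd (mG g h)) = fst g \<cdot> (fst h \<cdot> y \<cdot> ie (snd h)) \<cdot> ie (snd g)"
    using g M ginv_mul[OF e, of "snd g" "snd h"] by (simp add: assoc mem_Times_iff)
  then show ?thesis unfolding pe_def using e_gxh[OF i(1) hX i(3)] by simp
qed

lemma pe_one: "y \<in> Ge \<Longrightarrow> pe (f, e) y = y"
  using Ge_X[of y] by (simp add: pe_def ginv_one[OF e])

end

context idem_pair_reps
begin

text \<open>\<open>VX\<close> is the kernel of the projection from the permutation module on
  \<open>X // Q\<close> to the one on \<open>Ge\<close>. An equivariant map vanishing on
  \<open>VX\<close> is one that factors through this projection.\<close>

lemma dim_equivariant_funs_eq:
  "V.dim (equivariant_funs GG (X // Q) pG (nv * nu) rho)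
    = V.dim (equivariant_funs GG Ge pe (nv * nu) rho) + V.dim HX"
proof -
  let ?n = "nv * nu"
  let ?E = "equivariant_funs GG (X // Q) pG ?n rho" and ?E2 = "equivariant_funs GG Ge pe ?n rho"
  let ?K = "{F \<in> ?E. \<forall>v\<in>VX. \<forall>i. (\<Sum>c\<in>X // Q. v c * F (c, i)) = 0}"
  have K_iff: "F \<in> ?K \<longleftrightarrow> F \<in> ?E \<and> (\<forall>x\<in>X. \<forall>i. F (cl x, i) = F (cl (e \<cdot> x), i))" for F
  proof -
    have "(\<forall>v\<in>VX. \<forall>i. (\<Sum>c\<in>X // Q. v c * F (c, i)) = 0) \<longleftrightarrow> (\<forall>x\<in>X. \<forall>i. F (cl x, i) = F (cl (e \<cdot> x), i))"
    proof
      assume A: "\<forall>v\<in>VX. \<forall>i. (\<Sum>c\<in>X // Q. v c * F (c, i)) = 0"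
      show "\<forall>x\<in>X. \<forall>i. F (cl x, i) = F (cl (e \<cdot> x), i)"
      proof (intro ballI allI)
        fix x i assume x: "x \<in> X"
        have "(\<Sum>c\<in>X // Q. dd x c * F (c, i)) = 0" using A P.dd_VX[OF x] by blast
        then show "F (cl x, i) = F (cl (e \<cdot> x), i)" using sum_dd[OF x, of "\<lambda>c. F (c, i)"] by simp
      qed
    next
      assume A: "\<forall>x\<in>X. \<forall>i. F (cl x, i) = F (cl (e \<cdot> x), i)"
      show "\<forall>v\<in>VX. \<forall>i. (\<Sum>c\<in>X // Q. v c * F (c, i)) = 0"
      proof (intro ballI allI)
        fix v i assume "v \<in> VX"
        then show "(\<Sum>c\<in>X // Q. v c * F (c, i)) = 0"
        proof (rule P.VX_induct)
          fix x assume "x \<in> X"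
          then show "(\<Sum>c\<in>X // Q. dd x c * F (c, i)) = 0" using sum_dd[of x "\<lambda>c. F (c, i)"] A by simp
        qed (simp_all add: distrib_right sum.distrib vscale_def mult.assoc zero_fun_def flip: sum_distrib_left)
      qed
    qed
    then show ?thesis by blast
  qed
  have subK: "V.subspace ?K"
  proof -
    have "?K = {F \<in> ?E. \<forall>x\<in>X. \<forall>i. F (cl x, i) = F (cl (e \<cdot> x), i)}" using K_iff by blast
    then show ?thesis
      using subspace_equivariant_funs[of GG "X // Q" pG ?n rho] unfolding V.subspace_def
      by (simp add: vscale_def)
  qed
  define r where "r F = (\<lambda>(y, i). if y \<in> Ge then F (cl y, i) else 0)" for F :: "'a set \<times> nat \<Rightarrow> 'k"
  have rK: "r F \<in> ?E2" if "F \<in> ?K" for F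
    unfolding equivariant_funs_def
  proof (intro CollectI conjI allI impI ballI)
    fix c i assume "c \<notin> Ge \<or> nv * nu \<le> i"
    then show "r F (c, i) = 0" using that by (auto simp: r_def equivariant_funs_def)
  next
    fix g y i assume g: "g \<in> GG" and y: "y \<in> Ge" and i: "i < nv * nu"
    have yX: "y \<in> X" by (rule Ge_X[OF y])
    have gX: "fst g \<cdot> y \<cdot> ie (snd g) \<in> X"
      by (rule gxh_X) (use g yX ginv_in[OF e] in \<open>auto simp: mem_Times_iff\<close>)
    have "F (cl (pe g y), i) = F (pG g (cl y), i)"
      using that[unfolded K_iff] gX unfolding pe_def clsmap_cl[OF g yX] by simp
    also have "\<dots> = (\<Sum>j<nv * nu. rho g $$ (i, j) * F (cl y, j))"
      using that g i cl_in[OF yX] unfolding equivariant_funs_def by blast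
    finally show "r F (pe g y, i) = (\<Sum>j<nv * nu. rho g $$ (i, j) * r F (y, j))"
      using pe_in[OF g y] y by (simp add: r_def)
  qed
  have img: "r ` ?K = ?E2"
  proof (intro equalityI subsetI)
    fix F2 assume F2: "F2 \<in> ?E2"
    \<comment> \<open>Pullback along the projection from classes to \<open>Ge\<close>; independence
      of the representative is \<open>cl_eq_e\<close>.\<close>
    define F where "F = (\<lambda>(c, i). if c \<in> X // Q then F2 (e \<cdot> rp c, i) else 0)"
    have F_cl: "F (cl x, i) = F2 (e \<cdot> x, i)" if x: "x \<in> X" for x i
    proof -
      note s = class_some[OF cl_in[OF x]]
      have "e \<cdot> rp (cl x) = e \<cdot> x" by (rule cl_eq_e[OF s(1) x s(2)])
      then show ?thesis using cl_in[OF x] by (simp add: F_def)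
    qed
    have "F \<in> ?E"
      unfolding equivariant_funs_def
    proof (intro CollectI conjI allI impI ballI)
      fix c i assume "c \<notin> X // Q \<or> nv * nu \<le> i"
      then show "F (c, i) = 0" using F2 by (auto simp: F_def equivariant_funs_def)
    next
      fix g c i assume g: "g \<in> GG" and c: "c \<in> X // Q" and i: "i < nv * nu"
      obtain x where x: "x \<in> X" "c = cl x" using class_some[OF c] by metis
      have g': "fst g \<in> Gf" "ie (snd g) \<in> Ge" using g ginv_in[OF e] by (auto simp: mem_Times_iff)
      have "F (pG g c, i) = F2 (e \<cdot> (fst g \<cdot> x \<cdot> ie (snd g)), i)"
        unfolding x(2) clsmap_cl[OF g x(1)] by (rule F_cl[OF gxh_X[OF g'(1) x(1) g'(2)]])
      also have "\<dots> = F2 (pe g (e \<cdot> x), i)" unfolding pe_def e_gxh[OF g'(1) x(1) g'(2)] ..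
      also have "\<dots> = (\<Sum>j<nv * nu. rho g $$ (i, j) * F2 (e \<cdot> x, j))"
        using F2 g i eX[OF x(1)] unfolding equivariant_funs_def by blast
      finally show "F (pG g c, i) = (\<Sum>j<nv * nu. rho g $$ (i, j) * F (c, j))"
        unfolding x(2) F_cl[OF x(1)] .
    qed
    then have "F \<in> ?K" unfolding K_iff using F_cl Ge_X eX by simp
    moreover have "r F = F2"
    proof
      fix yi :: "'a \<times> nat"
      obtain y i where yi: "yi = (y, i)" by (cases yi)
      show "r F yi = F2 yi"
        using F2 F_cl[OF Ge_X, of y i] yi by (cases "y \<in> Ge") (auto simp: r_def equivariant_funs_def)
    qed
    ultimately show "F2 \<in> r ` ?K" by blast
  qed (use rK in blast)
  have "V.dim ?K = V.dim (r ` ?K)"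
  proof (rule VV.dim_iso_on(2)[OF subK])
    fix F assume F: "F \<in> ?K" "r F = 0"
    have "F (c, i) = 0" for c i
    proof (cases "c \<in> X // Q")
      case True
      obtain x where x: "x \<in> X" "c = cl x" using class_some[OF True] by metis
      have "F (c, i) = F (cl (e \<cdot> x), i)" using F(1) x unfolding K_iff by blast
      also have "\<dots> = r F (e \<cdot> x, i)" using eX[OF x(1)] by (simp add: r_def)
      finally show ?thesis using F(2) by simp
    next
      case False
      then show ?thesis using F(1) by (auto simp: equivariant_funs_def)
    qed
    then show "F = 0" by (auto simp: fun_eq_iff)
  next
    show "fin_dim vscale (r ` ?K)" unfolding img by (rule fin_dim_equivariant_funs[OF finite_Gp[OF e]])
  qed (auto simp: r_def fun_eq_iff vscale_def)
  then show ?thesis using P.dim_equivariant_funs_split[OF P.invsub_VX P.VX_sub] unfolding img by simp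
qed

lemma dim_equivariant_funs_dual:
  assumes dual: "\<And>g i j. g \<in> GG \<Longrightarrow> i < nv * nu \<Longrightarrow> j < nv * nu \<Longrightarrow> \<rho>' g $$ (i, j) = rho (iG g) $$ (j, i)"
  shows "V.dim (equivariant_funs GG (X // Q) pG (nv * nu) rho) \<le> V.dim (equivariant_funs GG (X // Q) pG (nv * nu) \<rho>')" (is ?A)
    and "V.dim (equivariant_funs GG Ge pe (nv * nu) rho) \<le> V.dim (equivariant_funs GG Ge pe (nv * nu) \<rho>')" (is ?B)
proof -
  show ?A by (rule P.dim_equivariant_funs_le_dual[OF P.finX P.p_in P.p_m P.p_u dual])
  show ?B by (rule P.dim_equivariant_funs_le_dual[OF finite_Gp[OF e] pe_in pe_mul pe_one dual])
qed

end

context fin_orthogroup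
begin

abbreviation "dual_rep e U \<equiv> \<lambda>g. transpose_mat (U (ginv M mul e g))"

lemma mrep_dual:
  fixes U :: "'a \<Rightarrow> 'k::field mat"
  assumes e: "idm e" and U: "mrep (Gp M mul e) mul e n U"
  shows "mrep (Gp M mul e) mul e n (dual_rep e U)"
proof -
  have car: "U g \<in> carrier_mat n n" if "g \<in> Gp M mul e" for g using U that unfolding mrep_def by blast
  have "dual_rep e U (g \<cdot> h) = dual_rep e U g * dual_rep e U h" if gh: "g \<in> Gp M mul e" "h \<in> Gp M mul e" for g h
  proof -
    have i: "ginv M mul e g \<in> Gp M mul e" "ginv M mul e h \<in> Gp M mul e" using gh ginv_in[OF e] by auto
    have "U (ginv M mul e (g \<cdot> h)) = U (ginv M mul e h) * U (ginv M mul e g)"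
      unfolding ginv_mul[OF e gh] using U i unfolding mrep_def by blast
    then show ?thesis using transpose_mult[OF car[OF i(2)] car[OF i(1)]] by simp
  qed
  moreover have "dual_rep e U e = 1\<^sub>m n" using U ginv_one[OF e] by (simp add: mrep_def)
  ultimately show ?thesis using car ginv_in[OF e] unfolding mrep_def by auto
qed

text \<open>The pairing argument gives inequalities only. Used for the tensor product and for its
  dual, whose dual is the original again, it yields equality for the permutation modules on
  \<open>X // Q\<close> and on \<open>Ge\<close>; subtracting leaves \<open>VX\<close>.\<close>

lemma arrows_dual_idem_pair:
  fixes U W :: "'a \<Rightarrow> 'k::field mat"
  assumes ip: "idem_pair M mul uu e f"
    and U: "mrep (Gp M mul e) mul e nu U" and W: "mrep (Gp M mul f) mul f nv W"
    and cG: "of_nat (card (Gp M mul e)) \<noteq> (0::'k)" "of_nat (card (Gp M mul f)) \<noteq> (0::'k)"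
  shows "arrows M mul nu (inflate M mul uu e nu U) nv (inflate M mul uu f nv W)
    = arrows M mul nu (inflate M mul uu e nu (dual_rep e U)) nv (inflate M mul uu f nv (dual_rep f W))"
proof -
  interpret I: idem_pair M mul uu e f by (rule ip)
  note U' = mrep_dual[OF I.e U] and W' = mrep_dual[OF I.f W]
  have A: "idem_pair_reps M mul uu e f nu nv U W"
    by (intro idem_pair_reps.intro idem_pair_reps_axioms.intro ip U W cG)
  have B: "idem_pair_reps M mul uu e f nu nv (dual_rep e U) (dual_rep f W)"
    by (intro idem_pair_reps.intro idem_pair_reps_axioms.intro ip U' W' cG)
  let ?A = "tensor_dual M mul e W U" and ?B = "tensor_dual M mul e (dual_rep f W) (dual_rep e U)"
  have carU: "U g \<in> carrier_mat nu nu" if "g \<in> I.Ge" for g using U that unfolding mrep_def by blast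
  have carW: "W g \<in> carrier_mat nv nv" if "g \<in> I.Gf" for g using W that unfolding mrep_def by blast
  have ii: "I.ie h \<in> I.Ge" "I.ie (I.ie h) = h" if "h \<in> I.Ge" for h
    using that ginv_in[OF I.e] ginv_ginv[OF I.e] by auto
  have jj: "I.jf h \<in> I.Gf" "I.jf (I.jf h) = h" if "h \<in> I.Gf" for h
    using that ginv_in[OF I.f] ginv_ginv[OF I.f] by auto
  have dual: "?B g $$ (i, j) = ?A (I.iG g) $$ (j, i)"
    if g: "g \<in> I.GG" and ij: "i < nv * nu" "j < nv * nu" for g i j
  proof -
    obtain x y where xy: "g = (x, y)" "x \<in> I.Gf" "y \<in> I.Ge" using g by auto
    note d = div_mod_less[OF ij(1)] div_mod_less[OF ij(2)]
    have cx: "W (I.jf x) \<in> carrier_mat nv nv" and cy: "U y \<in> carrier_mat nu nu" using carW carU jj xy by auto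
    have "?B g $$ (i, j) = W (I.jf x) $$ (j div nu, i div nu) * U y $$ (i mod nu, j mod nu)"
      using kron_index[of "transpose_mat (W (I.jf x))" nv "U y" nu i j] cx cy ij d
      by (simp add: tensor_dual_def xy ii)
    moreover have "?A (I.iG g) $$ (j, i) = W (I.jf x) $$ (j div nu, i div nu) * U y $$ (i mod nu, j mod nu)"
      using kron_index[of "W (I.jf x)" nv "transpose_mat (U y)" nu j i] cx cy ij d
      by (simp add: tensor_dual_def xy ii)
    ultimately show ?thesis by simp
  qed
  have dual': "?A g $$ (i, j) = ?B (I.iG g) $$ (j, i)"
    if g: "g \<in> I.GG" and ij: "i < nv * nu" "j < nv * nu" for g i j
  proof -
    have "I.iG g \<in> I.GG" "I.iG (I.iG g) = g" using g ii jj by (auto simp: mem_Times_iff)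
    then show ?thesis using dual[of "I.iG g" j i] ij by simp
  qed
  show ?thesis
    using idem_pair_reps.dim_equivariant_funs_eq[OF A] idem_pair_reps.dim_equivariant_funs_eq[OF B]
      idem_pair_reps.dim_equivariant_funs_dual[OF A dual] idem_pair_reps.dim_equivariant_funs_dual[OF B dual']
    unfolding idem_pair_reps.arrows_eq_dim_homs[OF A] idem_pair_reps.arrows_eq_dim_homs[OF B]
    by linarith
qed

text \<open>The element \<open>f e f\<close> keeps the ideal of \<open>e\<close> because
  \<open>f\<close> is above \<open>e\<close>, and its idempotent power stays in the corner of
  \<open>f\<close>.\<close>

lemma idem_pair_below:
  assumes e: "idm e" and f: "idm f" and lt: "J e \<subset> J f"
  obtains e' where "idem_pair M mul uu e' f" "J e' = J e"
proof -
  define e' where "e' = om (f \<cdot> e \<cdot> f)"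
  have M: "e \<in> M" "f \<in> M" "f \<cdot> e \<cdot> f \<in> M" using e f by auto
  have "J (f \<cdot> e \<cdot> f) = J e" using J_mul_eq(2)[of e f] J_mul_eq(1)[of "f \<cdot> e" f] M lt by auto
  then have J: "J e' = J e" unfolding e'_def using J_omega[OF M(3)] by simp
  have "f \<cdot> (f \<cdot> e \<cdot> f) = (f \<cdot> f) \<cdot> e \<cdot> f" "f \<cdot> e \<cdot> f \<cdot> f = f \<cdot> e \<cdot> (f \<cdot> f)" using M by (simp_all add: assoc)
  then have "f \<cdot> e \<cdot> f \<in> corner M mul f" using corner_iff[OF f] M idm_sq[OF f] by simp
  moreover obtain k where "k \<ge> 1" "e' = pw (f \<cdot> e \<cdot> f) k" unfolding e'_def using omega_power[OF M(3)] by blast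
  ultimately have "e' \<in> corner M mul f" using corner_pw[OF f] by blast
  then have c: "f \<cdot> e' = e'" "e' \<cdot> f = e'" using corner_iff[OF f] by auto
  have "e' \<noteq> f" using J lt by blast
  then have "idem_less mul e' f" using c by (simp add: idem_less_def)
  moreover have "idm e'" unfolding e'_def by (rule omega_idm[OF M(3)])
  ultimately have "idem_pair M mul uu e' f"
    using f J lt by (intro idem_pair.intro fin_orthogroup_axioms idem_pair_axioms.intro) auto
  then show thesis using that J by blast
qed

section \<open>Independence of the chosen idempotent\<close>

lemma transport_Gp:
  assumes e: "idm e" and e': "idm e'" and J: "J e' = J e" and g: "g \<in> Gp M mul e'"
  shows "e \<cdot> g \<cdot> e \<in> Gp M mul e"
    and "ginv M mul e (e \<cdot> g \<cdot> e) = e \<cdot> ginv M mul e' g \<cdot> e"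
proof -
  have M: "x \<in> M \<and> J e \<subseteq> J x" if "x \<in> Gp M mul e'" for x using Gp_iff[OF e', of x] that J by blast
  have in': "e \<cdot> x \<cdot> e \<in> Gp M mul e" if "x \<in> Gp M mul e'" for x using local_Gp[OF e] M[OF that] by blast
  show 1: "e \<cdot> g \<cdot> e \<in> Gp M mul e" by (rule in'[OF g])
  let ?h = "ginv M mul e' g"
  have h: "?h \<in> Gp M mul e'" "g \<cdot> ?h = e'" "?h \<cdot> g = e'" using ginv[OF e' g] by auto
  have ee: "e \<cdot> e' \<cdot> e = e" by (rule local_Gp_idm[OF e e']) (use J in simp)
  have "(e \<cdot> g \<cdot> e) \<cdot> (e \<cdot> ?h \<cdot> e) = e \<cdot> (g \<cdot> ?h) \<cdot> e"
    using local_hom[OF e, of g ?h] M[OF g] M[OF h(1)] e by (simp add: assoc)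
  moreover have "(e \<cdot> ?h \<cdot> e) \<cdot> (e \<cdot> g \<cdot> e) = e \<cdot> (?h \<cdot> g) \<cdot> e"
    using local_hom[OF e, of ?h g] M[OF g] M[OF h(1)] e by (simp add: assoc)
  ultimately show "ginv M mul e (e \<cdot> g \<cdot> e) = e \<cdot> ?h \<cdot> e"
    using in'[OF h(1)] 1 h ee by (intro ginv_unique[OF e]) (auto simp: Gp_def)
qed

lemma transport_rep:
  fixes U :: "'a \<Rightarrow> 'k::field mat"
  assumes e: "idm e" and e': "idm e'" and J: "J e' = J e" and U: "mrep (Gp M mul e) mul e n U"
  shows "mrep (Gp M mul e') mul e' n (\<lambda>g. U (e \<cdot> g \<cdot> e))"
proof -
  have M: "x \<in> M \<and> J e \<subseteq> J x" if "x \<in> Gp M mul e'" for x using Gp_iff[OF e', of x] that J by blast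
  have ee: "e \<cdot> e' \<cdot> e = e" by (rule local_Gp_idm[OF e e']) (use J in simp)
  have "U (e \<cdot> (g \<cdot> h) \<cdot> e) = U (e \<cdot> g \<cdot> e) * U (e \<cdot> h \<cdot> e)" if gh: "g \<in> Gp M mul e'" "h \<in> Gp M mul e'" for g h
  proof -
    have "e \<cdot> (g \<cdot> h) \<cdot> e = (e \<cdot> g \<cdot> e) \<cdot> (e \<cdot> h \<cdot> e)"
      using local_hom[OF e, of g h] M[OF gh(1)] M[OF gh(2)] e by (simp add: assoc)
    then show ?thesis using U transport_Gp(1)[OF e e' J] gh unfolding mrep_def by simp
  qed
  then show ?thesis using U ee transport_Gp(1)[OF e e' J] unfolding mrep_def by auto
qed

text \<open>Two uses of \<open>local_hom\<close> together with \<open>e e' e = e\<close> give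
  \<open>e (e' x e') e = e x e\<close>. So transporting the group representation leaves the inflated
  module literally the same matrix function on \<open>M\<close>.\<close>

lemma transport_inflate:
  assumes e: "idm e" and e': "idm e'" and J: "J e' = J e" and x: "x \<in> M"
  shows "inflate M mul uu e n U x = inflate M mul uu e' n (\<lambda>g. U (e \<cdot> g \<cdot> e)) x"
proof (cases "J e \<subseteq> J x")
  case True
  have M: "e \<in> M" "e' \<in> M" using e e' by auto
  have ee: "e \<cdot> e' \<cdot> e = e" by (rule local_Gp_idm[OF e e']) (use J in simp)
  have g: "e \<cdot> x \<cdot> e \<in> Gp M mul e" by (rule local_Gp[OF e x True])
  have "e \<cdot> (e' \<cdot> x \<cdot> e') \<cdot> e = e \<cdot> (e' \<cdot> x) \<cdot> e' \<cdot> e" using M x by (simp add: assoc)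
  also have "\<dots> = (e \<cdot> (e' \<cdot> x) \<cdot> e) \<cdot> (e \<cdot> e' \<cdot> e)"
    by (rule local_hom[OF e]) (use M x J True J_le_mul_iff[of e' x e] in auto)
  also have "e \<cdot> (e' \<cdot> x) \<cdot> e = e \<cdot> e' \<cdot> x \<cdot> e" using M x by (simp add: assoc)
  also have "\<dots> = (e \<cdot> e' \<cdot> e) \<cdot> (e \<cdot> x \<cdot> e)"
    by (rule local_hom[OF e]) (use M x J True in auto)
  finally have "e \<cdot> (e' \<cdot> x \<cdot> e') \<cdot> e = e \<cdot> x \<cdot> e" unfolding ee using g Gp_iff[OF e, of "e \<cdot> x \<cdot> e"] by simp
  then show ?thesis using True J x by (simp add: inflate_eq)
next
  case False
  then show ?thesis using J x by (simp add: inflate_eq)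
qed

text \<open>Reduces comparable ideals to comparable idempotents: \<open>e\<close> is replaced by an
  idempotent below \<open>f\<close> with the same ideal, the dual is taken there and carried back.
  Carrying back works because transport commutes with group inverses.\<close>

lemma arrows_dual:
  fixes U W :: "'a \<Rightarrow> 'k::field mat"
  assumes e: "idm e" and f: "idm f" and lt: "J e \<subset> J f"
    and U: "mrep (Gp M mul e) mul e nu U" and W: "mrep (Gp M mul f) mul f nv W"
    and char: "\<And>d. idm d \<Longrightarrow> of_nat (card (Gp M mul d)) \<noteq> (0::'k)"
  shows "arrows M mul nu (inflate M mul uu e nu U) nv (inflate M mul uu f nv W)
    = arrows M mul nu (inflate M mul uu e nu (dual_rep e U)) nv (inflate M mul uu f nv (dual_rep f W))"
proof -
  obtain e' where ip: "idem_pair M mul uu e' f" and J: "J e' = J e" using idem_pair_below[OF e f lt] by blast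
  have e': "idm e'" using idem_pair.e[OF ip] .
  let ?U = "\<lambda>g. U (e \<cdot> g \<cdot> e)"
  have "arrows M mul nu (inflate M mul uu e nu U) nv (inflate M mul uu f nv W)
    = arrows M mul nu (inflate M mul uu e' nu ?U) nv (inflate M mul uu f nv W)"
    by (rule arrows_cong) (simp_all add: transport_inflate[OF e e' J, of _ nu U])
  also have "\<dots> = arrows M mul nu (inflate M mul uu e' nu (dual_rep e' ?U)) nv (inflate M mul uu f nv (dual_rep f W))"
    by (rule arrows_dual_idem_pair[OF ip transport_rep[OF e e' J U] W char[OF e'] char[OF f]])
  also have "\<dots> = arrows M mul nu (inflate M mul uu e nu (dual_rep e U)) nv (inflate M mul uu f nv (dual_rep f W))"
  proof (rule arrows_cong)
    fix x assume x: "x \<in> M"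
    have "dual_rep e' ?U (e' \<cdot> x \<cdot> e') = dual_rep e U (e \<cdot> (e' \<cdot> x \<cdot> e') \<cdot> e)" if "J e' \<subseteq> J x"
      using transport_Gp(2)[OF e e' J local_Gp[OF e' x that]] by simp
    then have "inflate M mul uu e' nu (dual_rep e' ?U) x
        = inflate M mul uu e' nu (\<lambda>g. dual_rep e U (e \<cdot> g \<cdot> e)) x"
      using x by (simp add: inflate_eq)
    then show "inflate M mul uu e' nu (dual_rep e' ?U) x = inflate M mul uu e nu (dual_rep e U) x"
      using transport_inflate[OF e e' J x, of nu "dual_rep e U"] by simp
  qed simp
  finally show ?thesis .
qed

section \<open>The opposite monoid\<close>

lemma op_facts:
  assumes "x \<in> M"
  shows "ideal2 M (opmul mul) x = J x" "corner M (opmul mul) x = corner M mul x"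
    "Gp M (opmul mul) x = Gp M mul x" "ginv M (opmul mul) x = ginv M mul x"
    "idem M (opmul mul) = idem M mul"
proof -
  show "ideal2 M (opmul mul) x = J x"
  proof (intro equalityI subsetI)
    fix z assume "z \<in> ideal2 M (opmul mul) x"
    then obtain a b where "a \<in> M" "b \<in> M" "z = b \<cdot> (x \<cdot> a)" unfolding ideal2_def opmul_def by blast
    then have "z = (b \<cdot> x) \<cdot> a" "a \<in> M" "b \<in> M" using assms by (simp_all add: assoc)
    then show "z \<in> J x" unfolding ideal2_def by blast
  next
    fix z assume "z \<in> J x"
    then obtain a b where "a \<in> M" "b \<in> M" "z = (a \<cdot> x) \<cdot> b" unfolding ideal2_def by blast
    then have "z = a \<cdot> (x \<cdot> b)" "a \<in> M" "b \<in> M" using assms by (simp_all add: assoc)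
    then show "z \<in> ideal2 M (opmul mul) x" unfolding ideal2_def opmul_def by blast
  qed
  show c: "corner M (opmul mul) x = corner M mul x"
    unfolding corner_def opmul_def using assms assoc by metis
  show "Gp M (opmul mul) x = Gp M mul x" unfolding Gp_def c by (auto simp: opmul_def)
  show "ginv M (opmul mul) x = ginv M mul x"
    unfolding ginv_def[abs_def] c by (simp add: opmul_def conj_commute)
  show "idem M (opmul mul) = idem M mul" by (intro ext) (simp add: idem_def opmul_def)
qed

lemma fin_orthogroup_op: "fin_orthogroup M (opmul mul) uu"
proof
  show "is_monoid M (opmul mul) uu" by (simp add: is_monoid_def opmul_def assoc)
  show "finite M" by (rule fin)
  show "rectangular M (opmul mul)"
    unfolding rectangular_def
  proof (intro allI impI)
    fix e f g assume A: "idem M (opmul mul) e \<and> idem M (opmul mul) f \<and> idem M (opmul mul) g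
      \<and> ideal2 M (opmul mul) f = ideal2 M (opmul mul) e \<and> ideal2 M (opmul mul) g = ideal2 M (opmul mul) e"
    then have i: "idm e" "idm f" "idm g" using op_facts(5)[OF uu_in] by auto
    then have J: "J f = J e" "J g = J e" using A op_facts(1) by auto
    have "idm (g \<cdot> f)" "J (g \<cdot> f) = J e" using rect_closed[OF i(3,2)] J by auto
    then show "idem M (opmul mul) (opmul mul f g) \<and> ideal2 M (opmul mul) (opmul mul f g) = ideal2 M (opmul mul) e"
      using i op_facts(1)[of e] op_facts(1)[of "g \<cdot> f"] op_facts(5)[OF uu_in] by (simp add: opmul_def)
  qed
  show "regular M (opmul mul)"
    unfolding regular_def opmul_def
  proof
    fix m assume m: "m \<in> M"
    then obtain n where "n \<in> M" "m \<cdot> n \<cdot> m = m" using regu unfolding regular_def by blast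
    then show "\<exists>n\<in>M. m \<cdot> (n \<cdot> m) = m" using m by (auto simp: assoc)
  qed
qed

end

section \<open>Assembly of the three cases\<close>

lemma (in idem_pair_reps) arrows_eq_multiplicity:
  assumes n: "nu > 0" "nv > 0"
    and uU: "matrix_units_in_span Ge nu U" and uW: "matrix_units_in_span Gf nv W"
  shows "arrows M mul nu S nv T = multiplicity GG (act M mul uu e f) VX (nv * nu) rho"
proof -
  have "matrix_units_in_span GG (nv * nu) (\<lambda>(g, h). kron (W g) (dual_rep e U h))"
  proof (rule matrix_units_kron[OF _ _ uW matrix_units_dual[OF e U uU]])
    show "W g \<in> carrier_mat nv nv" if "g \<in> Gf" for g using W that unfolding mrep_def by blast
    show "dual_rep e U h \<in> carrier_mat nu nu" if "h \<in> Ge" for h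
      using mrep_dual[OF e U] that unfolding mrep_def by blast
  qed
  then have "matrix_units_in_span GG (nv * nu) rho" by (simp add: tensor_dual_def)
  then show ?thesis
    using P.act.multiplicity_eq_dim_homs[OF _ _ P.invsub_VX P.VX_sub] n
    by (simp add: arrows_eq_dim_homs P.perm_act_eq)
qed

theorem mainTheorem3:
  fixes M :: "'a set" and mul :: "'a \<Rightarrow> 'a \<Rightarrow> 'a" and uu :: "'a"
  assumes orth: "orthogroup M mul uu" and fin: "finite M"
    and split: "splits TYPE('k::field) M mul uu"
    and char: "\<forall>e. idem M mul e \<longrightarrow> \<not> CHAR('k) dvd card (Gp M mul e)"
  shows
   "(\<forall>e f nu nv (\<rho>U :: 'a \<Rightarrow> 'k mat) (\<rho>V :: 'a \<Rightarrow> 'k mat).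
       idem M mul e \<and> idem M mul f
       \<and> irrep (Gp M mul e) mul e nu \<rho>U \<and> irrep (Gp M mul f) mul f nv \<rho>V
       \<and> ((\<not> ideal2 M mul e \<subseteq> ideal2 M mul f \<and> \<not> ideal2 M mul f \<subseteq> ideal2 M mul e)
          \<or> ideal2 M mul e = ideal2 M mul f)
       \<longrightarrow> arrows M mul nu (inflate M mul uu e nu \<rho>U) nv (inflate M mul uu f nv \<rho>V) = 0)
  \<and> (\<forall>e f nu nv (\<rho>U :: 'a \<Rightarrow> 'k mat) (\<rho>V :: 'a \<Rightarrow> 'k mat).
       idem M mul e \<and> idem M mul f
       \<and> irrep (Gp M mul e) mul e nu \<rho>U \<and> irrep (Gp M mul f) mul f nv \<rho>V
       \<and> ideal2 M mul e \<subset> ideal2 M mul f \<and> idem_less mul e f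
       \<longrightarrow> arrows M mul nu (inflate M mul uu e nu \<rho>U) nv (inflate M mul uu f nv \<rho>V)
           = multiplicity (Gp M mul f \<times> Gp M mul e) (act M mul uu e f) (VXY M mul uu e f)
               (nv * nu) (tensor_dual M mul e \<rho>V \<rho>U))
  \<and> (\<forall>e f nu nv (\<rho>U :: 'a \<Rightarrow> 'k mat) (\<rho>V :: 'a \<Rightarrow> 'k mat).
       idem M mul e \<and> idem M mul f
       \<and> irrep (Gp M mul e) mul e nu \<rho>U \<and> irrep (Gp M mul f) mul f nv \<rho>V
       \<and> ideal2 M mul f \<subset> ideal2 M mul e
       \<longrightarrow> arrows M mul nu (inflate M mul uu e nu \<rho>U) nv (inflate M mul uu f nv \<rho>V)
           = arrows M (opmul mul) nv (inflate M (opmul mul) uu f nv (\<lambda>g. \<rho>V (ginv M mul f g)))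
                                  nu (inflate M (opmul mul) uu e nu (\<lambda>g. \<rho>U (ginv M mul e g))))"
proof -
  interpret fin_orthogroup M mul uu
    using orth fin by unfold_locales (auto simp: orthogroup_def)
  have cG: "of_nat (card (Gp M mul d)) \<noteq> (0::'k)" if "idem M mul d" for d
    using char that by (simp add: of_nat_eq_0_iff_char_dvd)
  have rp: "rep_pair M mul uu e f nu nv (inflate M mul uu e nu \<rho>U) (inflate M mul uu f nv \<rho>V)"
    if "idem M mul e" "idem M mul f" "irrep (Gp M mul e) mul e nu \<rho>U" "irrep (Gp M mul f) mul f nv \<rho>V"
    for e f nu nv and \<rho>U \<rho>V :: "'a \<Rightarrow> 'k mat"
    using rep_pair_inflate[of e f nu \<rho>U nv \<rho>V] that unfolding irrep_def by blast
  show ?thesis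
  proof (intro conjI allI impI; elim conjE)
    fix e f nu nv and \<rho>U \<rho>V :: "'a \<Rightarrow> 'k mat"
    assume e: "idem M mul e" and f: "idem M mul f"
      and U: "irrep (Gp M mul e) mul e nu \<rho>U" and W: "irrep (Gp M mul f) mul f nv \<rho>V"
      and X: "(\<not> ideal2 M mul e \<subseteq> ideal2 M mul f \<and> \<not> ideal2 M mul f \<subseteq> ideal2 M mul e)
          \<or> ideal2 M mul e = ideal2 M mul f"
    have "cocycles M mul nu (inflate M mul uu e nu \<rho>U) nv (inflate M mul uu f nv \<rho>V)
      = coboundaries M nu (inflate M mul uu e nu \<rho>U) nv (inflate M mul uu f nv \<rho>V)"
      using X rep_pair.no_arrows_incomparable[OF rp[OF e f U W]]
        rep_pair.no_arrows_equal[OF rp[OF e f U W] _ cG[OF e]] by blast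
    then show "arrows M mul nu (inflate M mul uu e nu \<rho>U) nv (inflate M mul uu f nv \<rho>V) = 0"
      by (simp add: arrows_def)
  next
    fix e f nu nv and \<rho>U \<rho>V :: "'a \<Rightarrow> 'k mat"
    assume e: "idem M mul e" and f: "idem M mul f"
      and U: "irrep (Gp M mul e) mul e nu \<rho>U" and W: "irrep (Gp M mul f) mul f nv \<rho>V"
      and lt: "ideal2 M mul e \<subset> ideal2 M mul f" "idem_less mul e f"
    have ip: "idem_pair M mul uu e f"
      by (intro idem_pair.intro fin_orthogroup_axioms idem_pair_axioms.intro e f lt)
    have mU: "mrep (Gp M mul e) mul e nu \<rho>U" "nu > 0" and mW: "mrep (Gp M mul f) mul f nv \<rho>V" "nv > 0"
      using U W unfolding irrep_def by auto
    have uU: "matrix_units_in_span (Gp M mul e) nu \<rho>U"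
      by (rule irrep_inflated.splits_matrix_units[OF _ split])
        (intro irrep_inflated.intro fin_orthogroup_axioms irrep_inflated_axioms.intro e U)
    have uW: "matrix_units_in_span (Gp M mul f) nv \<rho>V"
      by (rule irrep_inflated.splits_matrix_units[OF _ split])
        (intro irrep_inflated.intro fin_orthogroup_axioms irrep_inflated_axioms.intro f W)
    have "idem_pair_reps M mul uu e f nu nv \<rho>U \<rho>V"
      by (intro idem_pair_reps.intro idem_pair_reps_axioms.intro ip mU(1) mW(1) cG e f)
    from idem_pair_reps.arrows_eq_multiplicity[OF this mU(2) mW(2) uU uW]
    show "arrows M mul nu (inflate M mul uu e nu \<rho>U) nv (inflate M mul uu f nv \<rho>V)
           = multiplicity (Gp M mul f \<times> Gp M mul e) (act M mul uu e f) (VXY M mul uu e f)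
               (nv * nu) (tensor_dual M mul e \<rho>V \<rho>U)" .
  next
    fix e f nu nv and \<rho>U \<rho>V :: "'a \<Rightarrow> 'k mat"
    assume e: "idem M mul e" and f: "idem M mul f"
      and U: "irrep (Gp M mul e) mul e nu \<rho>U" and W: "irrep (Gp M mul f) mul f nv \<rho>V"
      and lt: "ideal2 M mul f \<subset> ideal2 M mul e"
    note O = fin_orthogroup_op
    have M: "e \<in> M" "f \<in> M" using idm_in[OF e] idm_in[OF f] by auto
    have mU: "mrep (Gp M mul e) mul e nu \<rho>U" and mW: "mrep (Gp M mul f) mul f nv \<rho>V"
      using U W unfolding irrep_def by auto
    \<comment> \<open>Transposition reverses products, so it turns a representation of the group
      into one of the opposite group without inverting elements.\<close>
    have op: "mrep (Gp M (opmul mul) d) (opmul mul) d n (\<lambda>g. transpose_mat (R g))"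
      if d: "d \<in> M" and R: "mrep (Gp M mul d) mul d n R" for d n and R :: "'a \<Rightarrow> 'k mat"
    proof -
      have "transpose_mat (R (mul h g)) = transpose_mat (R g) * transpose_mat (R h)"
        if "g \<in> Gp M mul d" "h \<in> Gp M mul d" for g h
        using R that transpose_mult[of "R h" n n "R g" n] unfolding mrep_def by simp
      then show ?thesis using R unfolding mrep_def op_facts(3)[OF d] by (simp add: opmul_def)
    qed
    have infl: "transpose_mat (inflate M mul uu d n R x) = inflate M (opmul mul) uu d n (\<lambda>g. transpose_mat (R g)) x"
      if d: "d \<in> M" and x: "x \<in> M" for d n x and R :: "'a \<Rightarrow> 'k mat"
      using d x op_facts(1)[OF d] op_facts(1)[OF x]
      by (simp add: inflate_eq fin_orthogroup.inflate_eq[OF O]) (simp add: opmul_def assoc)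
    have eo: "idem M (opmul mul) e" "idem M (opmul mul) f" using e f op_facts(5)[OF M(1)] by simp_all
    have lto: "ideal2 M (opmul mul) f \<subset> ideal2 M (opmul mul) e"
      using lt op_facts(1)[OF M(1)] op_facts(1)[OF M(2)] by simp
    have co: "of_nat (card (Gp M (opmul mul) d)) \<noteq> (0::'k)" if "idem M (opmul mul) d" for d
    proof -
      have "idem M mul d" using that op_facts(5)[OF M(1)] by simp
      then show ?thesis using cG[of d] op_facts(3)[of d] by (simp add: idem_def)
    qed
    have "arrows M mul nu (inflate M mul uu e nu \<rho>U) nv (inflate M mul uu f nv \<rho>V)
      = arrows M (opmul mul) nv (\<lambda>x. transpose_mat (inflate M mul uu f nv \<rho>V x))
          nu (\<lambda>x. transpose_mat (inflate M mul uu e nu \<rho>U x))"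
      by (rule rep_pair.arrows_op[OF rp[OF e f U W]])
    also have "\<dots> = arrows M (opmul mul) nv (inflate M (opmul mul) uu f nv (\<lambda>g. transpose_mat (\<rho>V g)))
          nu (inflate M (opmul mul) uu e nu (\<lambda>g. transpose_mat (\<rho>U g)))"
      by (rule arrows_cong) (rule infl[OF M(2)] infl[OF M(1)], assumption)+
    \<comment> \<open>Here \<open>f\<close> is the lower idempotent class, so
      \<open>arrows_dual\<close> is used over the opposite monoid with \<open>f\<close> and
      \<open>e\<close> exchanged. The dual of a transposed representation is a double transpose at
      inverse elements, which is the module of the statement.\<close>
    also have "\<dots> = arrows M (opmul mul)
        nv (inflate M (opmul mul) uu f nv (\<lambda>g. transpose_mat (transpose_mat (\<rho>V (ginv M (opmul mul) f g)))))
        nu (inflate M (opmul mul) uu e nu (\<lambda>g. transpose_mat (transpose_mat (\<rho>U (ginv M (opmul mul) e g)))))"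
      by (rule fin_orthogroup.arrows_dual[OF O eo(2,1) lto op[OF M(2) mW] op[OF M(1) mU] co])
    also have "\<dots> = arrows M (opmul mul) nv (inflate M (opmul mul) uu f nv (\<lambda>g. \<rho>V (ginv M mul f g)))
                                  nu (inflate M (opmul mul) uu e nu (\<lambda>g. \<rho>U (ginv M mul e g)))"
      using op_facts(4)[OF M(1)] op_facts(4)[OF M(2)] by simp
    finally show "arrows M mul nu (inflate M mul uu e nu \<rho>U) nv (inflate M mul uu f nv \<rho>V)
           = arrows M (opmul mul) nv (inflate M (opmul mul) uu f nv (\<lambda>g. \<rho>V (ginv M mul f g)))
                                  nu (inflate M (opmul mul) uu e nu (\<lambda>g. \<rho>U (ginv M mul e g)))" .
  qed
qed

end
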